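(* Let $\mathcal{A}=\{A_1,\dots,A_J\}$ be any partition of $\mathcal{X}$ into measurable sets with $\pi_k[A_j]>0$ for all $k\in\{0,\dots,N\}$ and $j\in\{1,\dots,J\}$. Then the swapping chain satisfies $$\mathrm{Gap}(P_{\mathrm{sc}}) \;\ge\; \frac{\gamma(\mathcal{A})^{J+3}\,\delta(\mathcal{A})^2}{2^{12}(N+1)^4J^3}\;\mathrm{Gap}(\bar T_0)\;\min_{k\in\{0,\dots,N\},\,j\in\{1,\dots,J\}}\mathrm{Gap}(T_k|_{A_j}).$$ In particular this holds for parallel tempering, i.e. when $\pi_k\propto\pi^{\beta_k}$ with $0\le\beta_0<\dots<\beta_N=1$ and $\int\pi^{\beta_0}\,d\lambda<\infty$.
   Context: Let $(\mathcal{X},\mathcal{F},\lambda)$ be a measure space with countably generated $\sigma$-algebra. For a transition kernel $P$ reversible with respect to a probability measure $\mu$ (i.e. $(f,Pg)_\mu=(Pf,g)_\mu$ for all $f,g\in L_2(\mu)$, where $(f,g)_\mu=\int fg\,d\mu$), the spectral gap is $\mathrm{Gap}(P)=\inf\{\mathcal{E}(f,f)/\mathrm{Var}_\mu(f): f\in L_2(\mu),\ \mathrm{Var}_\mu(f)>0\}$ with Dirichlet form $\mathcal{E}(f,f)=(f,(I-P)f)_\mu$ and $\mathrm{Var}_\mu(f)=(f,f)_\mu-(f,1)_\mu^2$; for a finite-state chain this is the same formula with sums. Swapping chain: fix $N\ge1$, probability densities $\pi_0,\dots,\pi_N$ on $\mathcal{X}$ with respect to $\lambda$, and for each $k$ a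 transition kernel $T_k$ on $\mathcal{X}$ reversible with respect to $\pi_k$. Write $\pi_k[A]=\int_A\pi_k\,d\lambda$. The state space is $\mathcal{X}_{\mathrm{sc}}=\mathcal{X}^{N+1}$, $x=(x_{[0]},\dots,x_{[N]})$, with product measure $\lambda_{\mathrm{sc}}$ and density $\pi_{\mathrm{sc}}(x)=\prod_{k=0}^N\pi_k(x_{[k]})$. The update kernel $T$: with probability $1/2$ stay at $x$; otherwise choose $k$ uniformly in $\{0,\dots,N\}$ and replace $x_{[k]}$ by a draw from $T_k(x_{[k]},\cdot)$, keeping the other coordinates fixed. The swap kernel $Q$: for each $k\in\{0,\dots,N-1\}$, with probability $1/(2N)$ propose the state $(k,k+1)x$ obtained by exchanging $x_{[k]}$ and $x_{[k+1]}$, and accept it with probability $\rho(x,(k,k+1)x)=\min\{1,\frac{\pi_k(x_{[k+1]})\pi_{k+1}(x_{[k]})}{\pi_k(x_{[k]})\pi_{k+1}(x_{[k+1]})}\}$; otherwise stay at $x$. The swapping chain is $P_{\mathrm{sc}}=QTQ$ (it is $\pi_{\mathrm{sc}}$-reversible and nonnegative definite). For a $\mu$-reversible kernel $P$ and measurable $A$, the restriction is $P|_A(x,B)=P(x,B)+\mathbf{1}_B(x)P(x,A^c)$ for $x\in A$, $B\subset A$. For a partition $\{A_1,\dots,A_J\}$ with $\mu(A_j)>0$, the projection matrix is $\bar P(i,j)=\frac{1}{\mu(A_i)}\int_{A_i}\int_{A_j}P(x,dy)\mu(dx)$, a chain on $\{1,\dots,J\}$ reversible w.r.t. $(\mu(A_j))_j$.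 $\bar T_0$ denotes the projection matrix of $T_0$ (with $\mu=\pi_0\,d\lambda$) with respect to $\mathcal{A}$; $T_k|_{A_j}$ is taken with respect to $\pi_k$. Overlap: $\delta(\mathcal{A})=\min_{|k-l|=1,\ j\in\{1,\dots,J\}}\frac{1}{\pi_k[A_j]}\int_{A_j}\min\{\pi_k(z),\pi_l(z)\}\lambda(dz)$ (with $k,l\in\{0,\dots,N\}$). Also $\gamma(\mathcal{A})=\min_{j}\prod_{k=1}^N\min\{1,\pi_{k-1}[A_j]/\pi_k[A_j]\}$. *)

theory Defs
  imports "HOL-Probability.Probability"
begin

text \<open>A transition kernel is represented by the operator it induces on functions,
  (P f)(x) = integral of f with respect to P(x, .).\<close>

definition L2fun :: "'b measure \<Rightarrow> ('b \<Rightarrow> real) set" where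
  "L2fun M = {f. f \<in> borel_measurable M \<and> integrable M (\<lambda>x. (f x)^2)}"

definition inner_mu :: "'b measure \<Rightarrow> ('b \<Rightarrow> real) \<Rightarrow> ('b \<Rightarrow> real) \<Rightarrow> real" where
  "inner_mu M f g = (\<integral>x. f x * g x \<partial>M)"

definition var_mu :: "'b measure \<Rightarrow> ('b \<Rightarrow> real) \<Rightarrow> real" where
  "var_mu M f = inner_mu M f f - (inner_mu M f (\<lambda>_. 1))^2"

definition dirichlet :: "'b measure \<Rightarrow> (('b \<Rightarrow> real) \<Rightarrow> 'b \<Rightarrow> real) \<Rightarrow> ('b \<Rightarrow> real) \<Rightarrow> real" where
  "dirichlet M P f = inner_mu M f (\<lambda>x. f x - P f x)"

definition reversible :: "'b measure \<Rightarrow> (('b \<Rightarrow> real) \<Rightarrow> 'b \<Rightarrow> real) \<Rightarrow> bool" where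
  "reversible M P \<longleftrightarrow> (\<forall>f\<in>L2fun M. \<forall>g\<in>L2fun M. inner_mu M f (P g) = inner_mu M (P f) g)"

definition gap :: "'b measure \<Rightarrow> (('b \<Rightarrow> real) \<Rightarrow> 'b \<Rightarrow> real) \<Rightarrow> real" where
  "gap M P = (if \<exists>f\<in>L2fun M. var_mu M f > 0
     then Inf {dirichlet M P f / var_mu M f | f. f \<in> L2fun M \<and> var_mu M f > 0}
     else 1)"

definition fin_inner :: "nat set \<Rightarrow> (nat \<Rightarrow> real) \<Rightarrow> (nat \<Rightarrow> real) \<Rightarrow> (nat \<Rightarrow> real) \<Rightarrow> real" where
  "fin_inner I w f g = (\<Sum>i\<in>I. w i * f i * g i)"

definition fin_var :: "nat set \<Rightarrow> (nat \<Rightarrow> real) \<Rightarrow> (nat \<Rightarrow> real) \<Rightarrow> real" where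
  "fin_var I w f = fin_inner I w f f - (fin_inner I w f (\<lambda>_. 1))^2"

definition fin_dirichlet :: "nat set \<Rightarrow> (nat \<Rightarrow> real) \<Rightarrow> (nat \<Rightarrow> nat \<Rightarrow> real) \<Rightarrow> (nat \<Rightarrow> real) \<Rightarrow> real" where
  "fin_dirichlet I w P f = fin_inner I w f (\<lambda>i. f i - (\<Sum>j\<in>I. P i j * f j))"

definition gap_fin :: "nat set \<Rightarrow> (nat \<Rightarrow> real) \<Rightarrow> (nat \<Rightarrow> nat \<Rightarrow> real) \<Rightarrow> real" where
  "gap_fin I w P = (if \<exists>f. fin_var I w f > 0
     then Inf {fin_dirichlet I w P f / fin_var I w f | f. fin_var I w f > 0}
     else 1)"

definition kop :: "('a \<Rightarrow> 'a measure) \<Rightarrow> ('a \<Rightarrow> real) \<Rightarrow> 'a \<Rightarrow> real" where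
  "kop K f x = (\<integral>y. f y \<partial>K x)"

definition pmass :: "'a measure \<Rightarrow> ('a \<Rightarrow> real) \<Rightarrow> 'a set \<Rightarrow> real" where
  "pmass L p A = (\<integral>x. indicator A x * p x \<partial>L)"

definition dens :: "'a measure \<Rightarrow> ('a \<Rightarrow> real) \<Rightarrow> 'a measure" where
  "dens L p = density L (\<lambda>x. ennreal (p x))"

text \<open>mu restricted to A and normalized (the invariant law of the restricted kernel)\<close>
definition cond_dens :: "'a measure \<Rightarrow> ('a \<Rightarrow> real) \<Rightarrow> 'a set \<Rightarrow> 'a measure" where
  "cond_dens L p A = density L (\<lambda>x. ennreal (indicator A x * p x / pmass L p A))"

text \<open>restriction P|_A (x,B) = P(x,B) + 1_B(x) P(x,A^c), as an operator on functions on A\<close>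
definition restr_op :: "('a \<Rightarrow> 'a measure) \<Rightarrow> 'a set \<Rightarrow> ('a \<Rightarrow> real) \<Rightarrow> 'a \<Rightarrow> real" where
  "restr_op K A f x = (\<integral>y. indicator A y * f y \<partial>K x) + f x * measure (K x) (space (K x) - A)"

definition proj_mat :: "'a measure \<Rightarrow> ('a \<Rightarrow> real) \<Rightarrow> ('a \<Rightarrow> 'a measure) \<Rightarrow> (nat \<Rightarrow> 'a set) \<Rightarrow> nat \<Rightarrow> nat \<Rightarrow> real" where
  "proj_mat L p K A i j = (1 / pmass L p (A i)) * (\<integral>x. indicator (A i) x * measure (K x) (A j) * p x \<partial>L)"

definition sc_meas :: "'a measure \<Rightarrow> (nat \<Rightarrow> 'a \<Rightarrow> real) \<Rightarrow> nat \<Rightarrow> (nat \<Rightarrow> 'a) measure" where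
  "sc_meas L p N = density (PiM {..N} (\<lambda>_. L)) (\<lambda>x. ennreal (\<Prod>k\<le>N. p k (x k)))"

definition swp :: "nat \<Rightarrow> (nat \<Rightarrow> 'a) \<Rightarrow> nat \<Rightarrow> 'a" where
  "swp k x = x(k := x (Suc k), Suc k := x k)"

definition swap_acc :: "(nat \<Rightarrow> 'a \<Rightarrow> real) \<Rightarrow> nat \<Rightarrow> (nat \<Rightarrow> 'a) \<Rightarrow> real" where
  "swap_acc p k x = min 1 ((p k (x (Suc k)) * p (Suc k) (x k)) / (p k (x k) * p (Suc k) (x (Suc k))))"

definition T_op :: "(nat \<Rightarrow> 'a \<Rightarrow> 'a measure) \<Rightarrow> nat \<Rightarrow> ((nat \<Rightarrow> 'a) \<Rightarrow> real) \<Rightarrow> (nat \<Rightarrow> 'a) \<Rightarrow> real" where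
  "T_op T N f x = f x / 2 + (1 / (2 * real (N + 1))) * (\<Sum>k\<le>N. \<integral>y. f (x(k := y)) \<partial>(T k (x k)))"

definition Q_op :: "(nat \<Rightarrow> 'a \<Rightarrow> real) \<Rightarrow> nat \<Rightarrow> ((nat \<Rightarrow> 'a) \<Rightarrow> real) \<Rightarrow> (nat \<Rightarrow> 'a) \<Rightarrow> real" where
  "Q_op p N f x = f x / 2 + (\<Sum>k<N. (1 / (2 * real N)) *
      (swap_acc p k x * f (swp k x) + (1 - swap_acc p k x) * f x))"

definition P_sc :: "(nat \<Rightarrow> 'a \<Rightarrow> real) \<Rightarrow> (nat \<Rightarrow> 'a \<Rightarrow> 'a measure) \<Rightarrow> nat \<Rightarrow> ((nat \<Rightarrow> 'a) \<Rightarrow> real) \<Rightarrow> (nat \<Rightarrow> 'a) \<Rightarrow> real" where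
  "P_sc p T N f = Q_op p N (T_op T N (Q_op p N f))"

definition delta_ov :: "'a measure \<Rightarrow> (nat \<Rightarrow> 'a \<Rightarrow> real) \<Rightarrow> nat \<Rightarrow> nat \<Rightarrow> (nat \<Rightarrow> 'a set) \<Rightarrow> real" where
  "delta_ov L p N J A = Min {(1 / pmass L (p k) (A j)) * (\<integral>z. indicator (A j) z * min (p k z) (p l z) \<partial>L) |
      k l j. k \<le> N \<and> l \<le> N \<and> (k = Suc l \<or> l = Suc k) \<and> j \<in> {1..J}}"

definition gamma_ov :: "'a measure \<Rightarrow> (nat \<Rightarrow> 'a \<Rightarrow> real) \<Rightarrow> nat \<Rightarrow> nat \<Rightarrow> (nat \<Rightarrow> 'a set) \<Rightarrow> real" where
  "gamma_ov L p N J A = Min {(\<Prod>k\<in>{1..N}. min 1 (pmass L (p (k - 1)) (A j) / pmass L (p k) (A j))) | j. j \<in> {1..J}}"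

end

theory Submission
  imports Defs
begin

text \<open>Put \<open>Y = E(f,f)\<close> for the chain \<open>QTQ\<close>. Since \<open>T\<close> is nonnegative definite and \<open>Q\<close> is at least
  one half lazy, \<open>Y\<close> dominates both the Dirichlet form of \<open>Q\<close> and half of that of \<open>T\<close> at \<open>f\<close>.
  Averaging \<open>f\<close> over the cell of one coordinate after the other gives a function \<open>h\<close> of the cell
  labels, and by the local gaps \<open>f - h\<close> costs only the Dirichlet form of \<open>T\<close>; as all Dirichlet forms
  are quadratic, those of \<open>h\<close> are controlled by those of \<open>f\<close> and by the norm of \<open>f - h\<close>. What remains is
  a comparison on the finite product of label sets, where the overlap makes the swaps have
  conductance \<open>\<delta>\<^sup>2\<close> and the gap of the projected \<open>T 0\<close> resamples coordinate 0.

  To change label \<open>i\<close> into \<open>j\<close> at level \<open>k\<close>: resample level 0 to \<open>j\<close>, swap this \<open>j\<close> up to level \<open>k\<close>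
  (which moves every other label, and finally \<open>i\<close>, one level down), swap \<open>i\<close> on down to level 0 (which
  puts the other labels back), and resample level 0. All labels but the moving one only ever sit
  below their original level, so \<open>\<gamma>\<close> bounds the weights along the path from below by
  \<open>\<gamma>\<^sup>J\<^sup>+\<^sup>1\<close>; pushing labels up would admit no such bound.\<close>

subsection \<open>Paths between product states\<close>

text \<open>Passing from \<open>f\<close> to \<open>h\<close> is cheap because each coordinate form
  and each swap form is at most four times the squared norm: at \<open>h\<close> it is at most twice
  its value at \<open>f\<close> plus eight times the squared norm of \<open>f - h\<close>. The same
  estimate bounds every gap by 2, so a term that lacks one of the two gaps still fits under their
  product. Reversibility is given only on square-integrable functions. The forms are therefore kept
  as extended nonnegative double integrals of squared increments, where slicing and summing need no
  integrability, and become inner products only for functions in \<open>L2fun\<close>. The four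
  powers of \<open>N + 1\<close> come from the sum over coordinates in the variance, the length of a
  path, the number of swap forms that each pay for \<open>f - h\<close>, and the rate at which
  \<open>T\<close> selects a coordinate. The numerical constants add up to 3088, below
  \<open>2 ^ 12\<close>. The estimate is obtained with \<open>\<gamma> ^ (J + 1)\<close> and without
  \<open>J ^ 3\<close>; as \<gamma> \<le> 1 and J \<ge> 1, it implies the stated one.\<close>

lemma swp_swp [simp]: "swp l (swp l x) = x"
  by (auto simp: swp_def fun_eq_iff)

text \<open>The finite data left once only labels matter: \<open>w k j\<close> stands for the mass
  of cell \<open>j\<close> at level \<open>k\<close>, and \<gamma> for any positive number below all
  the products whose minimum is \<open>gamma_ov\<close>.\<close>

locale cell_weights =
  fixes w :: "nat \<Rightarrow> nat \<Rightarrow> real" and N J :: nat and \<gamma> :: real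
  assumes w_pos: "\<And>k j. k \<le> N \<Longrightarrow> j \<in> {1..J} \<Longrightarrow> w k j > 0"
    and w_sum: "\<And>k. k \<le> N \<Longrightarrow> (\<Sum>j\<in>{1..J}. w k j) = 1"
    and gamma_pos: "\<gamma> > 0"
    and gamma_le: "\<And>j. j \<in> {1..J} \<Longrightarrow> \<gamma> \<le> (\<Prod>k\<in>{1..N}. min 1 (w (k - 1) j / w k j))"
begin

abbreviation states :: "(nat \<Rightarrow> nat) set" where
  "states \<equiv> {..N} \<rightarrow>\<^sub>E {1..J}"

definition weight :: "(nat \<Rightarrow> nat) \<Rightarrow> real" where
  "weight s = (\<Prod>k\<le>N. w k (s k))"

text \<open>Twice the mean conditional variance of \<open>F\<close> in coordinate \<open>k\<close>
  under \<open>weight\<close>.\<close>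

definition resample_form :: "nat \<Rightarrow> ((nat \<Rightarrow> nat) \<Rightarrow> real) \<Rightarrow> real" where
  "resample_form k F = (\<Sum>s\<in>states. \<Sum>j\<in>{1..J}. weight s * w k j * (F s - F (s(k := j)))\<^sup>2)"

text \<open>The rate is the full mass \<open>weight s\<close>, without an acceptance probability:
  the overlap guarantees accepted mass at least \<open>\<delta>\<^sup>2 * weight s\<close> for every
  \<open>s\<close>, so the acceptance later costs only a constant factor.\<close>

definition swap_form :: "nat \<Rightarrow> ((nat \<Rightarrow> nat) \<Rightarrow> real) \<Rightarrow> real" where
  "swap_form l F = (\<Sum>s\<in>states. weight s * (F s - F (swp l s))\<^sup>2)"

lemma states_mem: "s \<in> states \<Longrightarrow> k \<le> N \<Longrightarrow> s k \<in> {1..J}"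
  by (auto simp: PiE_iff)

lemma states_upd: "s \<in> states \<Longrightarrow> k \<le> N \<Longrightarrow> j \<in> {1..J} \<Longrightarrow> s(k := j) \<in> states"
  by (auto simp: PiE_iff extensional_def)

lemma states_swp: "s \<in> states \<Longrightarrow> l < N \<Longrightarrow> swp l s \<in> states"
  by (auto simp: swp_def PiE_iff extensional_def)

lemma bij_swp: "l < N \<Longrightarrow> bij_betw (swp l) states states"
  by (rule bij_betwI[of _ _ _ "swp l"]) (use states_swp in auto)

lemma weight_pos: "s \<in> states \<Longrightarrow> weight s > 0"
  unfolding weight_def by (intro prod_pos ballI w_pos states_mem) auto

text \<open>Detailed balance for redrawing one coordinate, written without division.\<close>

lemma weight_upd:
  assumes "k \<le> N"
  shows "weight (s(k := j)) * w k (s k) = weight s * w k j"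
proof -
  have "weight t = w k (t k) * (\<Prod>i\<in>{..N}-{k}. w i (t i))" for t
    unfolding weight_def using assms by (intro prod.remove) auto
  note this[of s] this[of "s(k:=j)"]
  moreover have "(\<Prod>i\<in>{..N}-{k}. w i ((s(k:=j)) i)) = (\<Prod>i\<in>{..N}-{k}. w i (s i))"
    by (intro prod.cong) auto
  ultimately show ?thesis by simp
qed

lemma weight_swp:
  assumes "l < N" "s \<in> states"
  shows "weight (swp l s) * w l (s l) * w (Suc l) (s (Suc l))
       = weight s * w l (s (Suc l)) * w (Suc l) (s l)"
proof -
  have "weight (swp l s) * w (Suc l) (s (Suc l)) = weight (s(l := s (Suc l))) * w (Suc l) (s l)"
    using weight_upd[of "Suc l" "s(l := s (Suc l))" "s l"] assms by (simp add: swp_def)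
  then show ?thesis
    using weight_upd[of l s "s (Suc l)"] assms by (simp add: algebra_simps)
qed

text \<open>The map \<open>(s, j)\<close> to \<open>(s(k := j), s k)\<close> is an involution, and
  by \<open>weight_upd\<close> it preserves the mass \<open>weight s * w k j\<close>.\<close>

lemma sum_resample:
  assumes "k \<le> N"
  shows "(\<Sum>s\<in>states. \<Sum>j\<in>{1..J}. weight s * w k j * \<Phi> (s(k := j)) (s k))
       = (\<Sum>s\<in>states. \<Sum>j\<in>{1..J}. weight s * w k j * \<Phi> s j)"
proof -
  define g where "g = (\<lambda>(s::nat \<Rightarrow> nat, j::nat). (s(k := j), s k))"
  have gg: "g (g x) = x" for x by (cases x) (simp add: g_def)
  have gm: "g x \<in> states \<times> {1..J}" if "x \<in> states \<times> {1..J}" for x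
    using that states_upd[of "fst x" k "snd x"] states_mem[of "fst x" k] assms
    by (cases x) (auto simp: g_def)
  show ?thesis
    unfolding sum.cartesian_product
  proof (rule sum.reindex_bij_witness[of _ g g])
    fix x assume "x \<in> states \<times> {1..J}"
    then show "(case g x of (s, j) \<Rightarrow> weight s * w k j * \<Phi> s j) =
       (case x of (s, j) \<Rightarrow> weight s * w k j * \<Phi> (s(k := j)) (s k))"
      using weight_upd[OF assms, of "fst x" "snd x"] by (cases x) (simp add: g_def)
  qed (use gg gm in auto)
qed

text \<open>The ratios \<open>w (i - 1) j / w i j\<close> from level \<open>l\<close> to level
  \<open>k\<close> telescope to \<open>w l j / w k j\<close>; leaving out the other factors, all at
  most 1, and then the minimum with 1 only enlarges the product. Thus a label may sit below the
  level at which it is weighed for a single factor \<gamma>.\<close>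

lemma gamma_w:
  assumes "l \<le> k" "k \<le> N" "j \<in> {1..J}"
  shows "\<gamma> * w k j \<le> w l j"
proof -
  define r where "r i = w (i - 1) j / w i j" for i
  have rpos: "i \<in> {1..N} \<Longrightarrow> r i > 0" for i
    unfolding r_def using w_pos assms by auto
  have "\<gamma> \<le> (\<Prod>i\<in>{1..N}. min 1 (r i))"
    unfolding r_def using gamma_le assms(3) by simp
  also have "\<dots> \<le> (\<Prod>i\<in>{Suc l..k}. min 1 (r i))"
  proof -
    have "(\<Prod>i\<in>{1..N}. min 1 (r i))
        = (\<Prod>i\<in>{1..N} - {Suc l..k}. min 1 (r i)) * (\<Prod>i\<in>{Suc l..k}. min 1 (r i))"
      using assms by (intro prod.subset_diff) auto
    also have "\<dots> \<le> 1 * (\<Prod>i\<in>{Suc l..k}. min 1 (r i))"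
    proof (intro mult_right_mono prod_le_1 prod_nonneg conjI)
      fix i
      { assume "i \<in> {1..N} - {Suc l..k}"
        then have "0 < r i" by (intro rpos) auto
        then show "0 \<le> min 1 (r i)" by simp }
      { assume "i \<in> {Suc l..k}"
        then have "0 < r i" using assms by (intro rpos) auto
        then show "0 \<le> min 1 (r i)" by simp }
    qed simp
    finally show ?thesis by simp
  qed
  also have "\<dots> \<le> (\<Prod>i\<in>{Suc l..k}. r i)"
  proof (intro prod_mono conjI)
    fix i assume "i \<in> {Suc l..k}"
    then have "0 < r i" using assms by (intro rpos) auto
    then show "0 \<le> min 1 (r i)" "min 1 (r i) \<le> r i" by auto
  qed
  also have "(\<Prod>i\<in>{Suc l..k}. r i) = w l j / w k j"
    using assms(1,2)
  proof (induction k rule: dec_induct)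
    case base
    have "w l j > 0" using base assms(3) by (intro w_pos)
    then show ?case by simp
  next
    case (step n)
    have pos: "w n j > 0" "w (Suc n) j > 0" using step.prems assms(3) by (auto intro!: w_pos)
    have "(\<Prod>i\<in>{Suc l..Suc n}. r i) = (\<Prod>i\<in>{Suc l..n}. r i) * r (Suc n)"
      using step.hyps by (subst prod.nat_ivl_Suc') auto
    also have "\<dots> = w l j / w n j * r (Suc n)"
      using step.IH step.prems by simp
    also have "\<dots> = w l j / w (Suc n) j"
      using pos by (simp only: r_def diff_Suc_1) simp
    finally show ?case .
  qed
  finally have "\<gamma> \<le> w l j / w k j" .
  moreover have "w k j > 0" using assms by (intro w_pos) auto
  ultimately show ?thesis by (simp only: pos_le_divide_eq)
qed

end

lemma square_sum3_le: "(x + y - z)\<^sup>2 \<le> 3 * (x\<^sup>2 + y\<^sup>2 + z\<^sup>2)" for x y z :: real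
proof -
  have "3 * (x\<^sup>2 + y\<^sup>2 + z\<^sup>2) - (x + y - z)\<^sup>2 = (x - y)\<^sup>2 + (x + z)\<^sup>2 + (y + z)\<^sup>2"
    by (simp add: power2_eq_square algebra_simps)
  then show ?thesis by (smt (verit) zero_le_power2)
qed

context cell_weights begin

lemma weight_nonneg: "s \<in> states \<Longrightarrow> weight s \<ge> 0"
  using weight_pos[of s] by simp

lemma w_nonneg: "k \<le> N \<Longrightarrow> j \<in> {1..J} \<Longrightarrow> w k j \<ge> 0"
  using w_pos[of k j] by simp

text \<open>Each label contributes one factor \<gamma>, bounded by its own product over all levels.
  After the two products are exchanged, level \<open>m\<close> keeps only the factor of the label
  \<open>s m\<close> that is present there, the factors of the other labels being at most 1. This is
  why the exponent is the number of labels and not the number of levels.\<close>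

lemma prod_ratio_ge:
  assumes "s \<in> states" "l \<le> N"
  shows "\<gamma> ^ J \<le> (\<Prod>m\<in>{1..l}. w (m - 1) (s m) / w m (s m))"
proof -
  define r where "r m j = w (m - 1) j / w m j" for m j
  have rpos: "r m j > 0" if "m \<in> {1..N}" "j \<in> {1..J}" for m j
    unfolding r_def using that by (intro divide_pos_pos w_pos) auto
  have min1: "0 \<le> min 1 (r m j)" if "m \<in> {1..N}" "j \<in> {1..J}" for m j
    using rpos[OF that] by simp
  have sm: "s m \<in> {1..J}" if "m \<in> {1..N}" for m
    using assms that by (intro states_mem) auto
  have "\<gamma> ^ J = (\<Prod>j\<in>{1..J}. \<gamma>)" by simp
  also have "\<dots> \<le> (\<Prod>j\<in>{1..J}. \<Prod>m\<in>{1..N}. min 1 (r m j))"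
    unfolding r_def by (intro prod_mono conjI gamma_le) (use gamma_pos in auto)
  also have "\<dots> = (\<Prod>m\<in>{1..N}. \<Prod>j\<in>{1..J}. min 1 (r m j))"
    by (rule prod.swap)
  also have "\<dots> \<le> (\<Prod>m\<in>{1..N}. if m \<le> l then r m (s m) else 1)"
  proof (intro prod_mono conjI prod_nonneg ballI)
    fix m assume m: "m \<in> {1..N}"
    have "(\<Prod>j\<in>{1..J}. min 1 (r m j)) = min 1 (r m (s m)) * (\<Prod>j\<in>{1..J}-{s m}. min 1 (r m j))"
      using sm[OF m] by (intro prod.remove) auto
    also have "\<dots> \<le> min 1 (r m (s m)) * 1"
      using min1 m sm[OF m] by (intro mult_left_mono prod_le_1) auto
    finally show "(\<Prod>j\<in>{1..J}. min 1 (r m j)) \<le> (if m \<le> l then r m (s m) else 1)"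
      by (auto simp: min_def split: if_splits)
  qed (use min1 in auto)
  also have "\<dots> = (\<Prod>m\<in>{m\<in>{1..N}. m \<le> l}. r m (s m))"
    by (subst prod.inter_filter) auto
  also have "{m\<in>{1..N}. m \<le> l} = {1..l}" using assms by auto
  finally show ?thesis by (simp add: r_def)
qed

section \<open>Carrying the label of level 0 upwards\<close>

primrec rot :: "nat \<Rightarrow> (nat \<Rightarrow> nat) \<Rightarrow> nat \<Rightarrow> nat" where
  "rot 0 s = s"
| "rot (Suc l) s = swp l (rot l s)"

lemma rot_eq: "rot l s i = (if i < l then s (Suc i) else if i = l then s 0 else s i)"
  by (induction l arbitrary: i) (auto simp: swp_def less_Suc_eq)

lemma bij_rot: "l \<le> N \<Longrightarrow> bij_betw (rot l) states states"
proof (induction l)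
  case 0
  have "rot 0 = id" by auto
  then show ?case by (simp only: bij_betw_id)
next
  case (Suc l)
  have eq: "rot (Suc l) = swp l \<circ> rot l" by auto
  show ?case unfolding eq using Suc by (intro bij_betw_trans[OF _ bij_swp]) auto
qed

text \<open>The carried label trades its mass at level 0 for its mass at level \<open>l\<close>, and
  the label passed at step \<open>m\<close> trades its mass at level \<open>m\<close> for that at
  level \<open>m - 1\<close>.\<close>

lemma weight_rot:
  assumes "l \<le> N" "s \<in> states"
  shows "weight (rot l s) * w 0 (s 0)
       = weight s * w l (s 0) * (\<Prod>m\<in>{1..l}. w (m - 1) (s m) / w m (s m))"
  using assms(1)
proof (induction l)
  case (Suc l)
  let ?P = "\<Prod>m\<in>{1..l}. w (m - 1) (s m) / w m (s m)"
  have l: "l < N" using Suc.prems by simp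
  have rs: "rot l s \<in> states" using bij_betwE[OF bij_rot[of l]] l assms(2) by simp
  have pos: "w l (s 0) > 0" "w (Suc l) (s (Suc l)) > 0"
    using l states_mem[OF assms(2), of 0] states_mem[OF assms(2), of "Suc l"]
    by (auto intro!: w_pos simp del: atLeastAtMost_iff)
  have "weight (rot (Suc l) s) * w l (s 0) * w (Suc l) (s (Suc l))
      = weight (rot l s) * w l (s (Suc l)) * w (Suc l) (s 0)"
    using weight_swp[OF l rs] by (simp add: rot_eq)
  then have "weight (rot (Suc l) s) * w 0 (s 0) * w l (s 0) * w (Suc l) (s (Suc l))
      = (weight (rot l s) * w 0 (s 0)) * w l (s (Suc l)) * w (Suc l) (s 0)"
    by (simp add: ac_simps)
  also have "weight (rot l s) * w 0 (s 0) = weight s * w l (s 0) * ?P"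
    using Suc.IH l by simp
  finally have "weight (rot (Suc l) s) * w 0 (s 0)
     = weight s * w (Suc l) (s 0) * (?P * (w l (s (Suc l)) / w (Suc l) (s (Suc l))))"
    using pos by (simp add: field_simps)
  also have "?P * (w l (s (Suc l)) / w (Suc l) (s (Suc l)))
      = (\<Prod>m\<in>{1..Suc l}. w (m - 1) (s m) / w m (s m))"
    by (subst prod.nat_ivl_Suc') auto
  finally show ?case .
qed simp

text \<open>The image of the mass \<open>weight s * w k j\<close> under \<open>s(0 := j)\<close>:
  the law of the state after level 0 has received a label drawn from \<open>w k\<close>, the level
  for which this label is destined.\<close>

definition path_weight :: "nat \<Rightarrow> (nat \<Rightarrow> nat) \<Rightarrow> real" where
  "path_weight k s = weight s * w k (s 0) / w 0 (s 0)"

text \<open>One \<gamma> pays for the carried label, weighed at level \<open>k\<close> but sitting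
  at level \<open>l \<le> k\<close>; the factor \<open>\<gamma> ^ J\<close> pays for the labels
  passed, each one level below its origin.\<close>

lemma path_weight_le:
  assumes "l \<le> k" "k \<le> N" "s \<in> states"
  shows "\<gamma> ^ (J + 1) * path_weight k s \<le> weight (rot l s)"
proof -
  have s0: "s 0 \<in> {1..J}" using assms by (intro states_mem) auto
  have pos: "w 0 (s 0) > 0" "w l (s 0) > 0" using s0 assms by (auto intro!: w_pos simp del: atLeastAtMost_iff)
  have "\<gamma> ^ (J + 1) * path_weight k s = weight s / w 0 (s 0) * ((\<gamma> * w k (s 0)) * \<gamma> ^ J)"
    by (simp add: path_weight_def)
  also have "\<dots> \<le> weight s / w 0 (s 0) * (w l (s 0) * (\<Prod>m\<in>{1..l}. w (m - 1) (s m) / w m (s m)))"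
    using weight_pos[OF assms(3)] pos assms gamma_pos
    by (intro mult_left_mono mult_mono gamma_w prod_ratio_ge s0) auto
  also have "\<dots> = weight (rot l s)"
    using weight_rot[of l s] assms pos by (simp add: field_simps)
  finally show ?thesis .
qed

lemma path_weight_nonneg: "s \<in> states \<Longrightarrow> k \<le> N \<Longrightarrow> path_weight k s \<ge> 0"
  unfolding path_weight_def
  using states_mem[of s 0]
  by (intro divide_nonneg_nonneg mult_nonneg_nonneg weight_nonneg w_nonneg) auto

lemma swap_form_nonneg: "swap_form l F \<ge> 0"
  unfolding swap_form_def by (intro sum_nonneg mult_nonneg_nonneg weight_nonneg) auto

text \<open>Since \<open>rot l\<close> is a bijection of the states, no swap of step
  \<open>l\<close> is charged by two different paths; the congestion is measured by the masses
  alone.\<close>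

lemma rot_step_le:
  assumes "l < k" "k \<le> N"
  shows "\<gamma> ^ (J + 1) * (\<Sum>s\<in>states. path_weight k s * (F (rot l s) - F (rot (Suc l) s))\<^sup>2) \<le> swap_form l F"
proof -
  have "\<gamma> ^ (J + 1) * (\<Sum>s\<in>states. path_weight k s * (F (rot l s) - F (rot (Suc l) s))\<^sup>2)
      = (\<Sum>s\<in>states. (\<gamma> ^ (J + 1) * path_weight k s) * (F (rot l s) - F (swp l (rot l s)))\<^sup>2)"
    by (simp add: sum_distrib_left mult.assoc)
  also have "\<dots> \<le> (\<Sum>s\<in>states. weight (rot l s) * (F (rot l s) - F (swp l (rot l s)))\<^sup>2)"
    using assms by (intro sum_mono mult_right_mono path_weight_le) auto
  also have "\<dots> = (\<Sum>s\<in>states. weight s * (F s - F (swp l s))\<^sup>2)"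
    using assms by (intro sum.reindex_bij_betw[OF bij_rot]) auto
  finally show ?thesis unfolding swap_form_def .
qed

lemma sum_diff_square_le:
  fixes a :: "nat \<Rightarrow> real"
  shows "(a 0 - a n)\<^sup>2 \<le> real n * (\<Sum>l<n. (a l - a (Suc l))\<^sup>2)"
proof -
  have "a 0 - a n = (\<Sum>l<n. a l - a (Suc l))" by (simp add: sum_lessThan_telescope')
  then show ?thesis using sum_squared_le_sum_of_squares[of "\<lambda>l. a l - a (Suc l)" "{..<n}"]
    by (simp add: mult.commute)
qed

text \<open>Cauchy-Schwarz over the \<open>n\<close> steps produces the factor
  \<open>n\<close>.\<close>

lemma rot_path_le:
  assumes "n \<le> k" "k \<le> N"
  shows "\<gamma> ^ (J + 1) * (\<Sum>s\<in>states. path_weight k s * (F s - F (rot n s))\<^sup>2)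
       \<le> real n * (\<Sum>l<n. swap_form l F)"
proof -
  have "\<gamma> ^ (J + 1) * (\<Sum>s\<in>states. path_weight k s * (F s - F (rot n s))\<^sup>2)
      \<le> \<gamma> ^ (J + 1) * (\<Sum>s\<in>states. path_weight k s * (real n * (\<Sum>l<n. (F (rot l s) - F (rot (Suc l) s))\<^sup>2)))"
    using gamma_pos sum_diff_square_le[of "\<lambda>l. F (rot l s)" n for s] assms
    by (intro mult_left_mono sum_mono path_weight_nonneg) (auto simp del: rot.simps(2))
  also have "\<dots> = real n * (\<Sum>l<n. \<gamma> ^ (J + 1) * (\<Sum>s\<in>states. path_weight k s * (F (rot l s) - F (rot (Suc l) s))\<^sup>2))"
    unfolding sum_distrib_left by (subst sum.swap) (simp only: ac_simps)
  also have "\<dots> \<le> real n * (\<Sum>l<n. swap_form l F)"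
    using assms by (intro mult_left_mono sum_mono rot_step_le) auto
  finally show ?thesis .
qed

definition exch :: "nat \<Rightarrow> (nat \<Rightarrow> nat) \<Rightarrow> nat \<Rightarrow> nat" where
  "exch k s = s(0 := s k, k := s 0)"

text \<open>The upward paths from \<open>s\<close> and from \<open>exch k s\<close> meet:
  \<open>rot k s\<close> is \<open>rot (k - 1) (exch k s)\<close>. So the exchange consists of
  \<open>k - 1\<close> swaps up, one more swap, and an upward path of \<open>k - 1\<close> swaps
  traversed backwards. As \<open>path_weight\<close> is invariant under the exchange, the last leg
  costs as much as the first.\<close>

lemma exch_le:
  assumes "1 \<le> k" "k \<le> N"
  shows "\<gamma> ^ (J + 1) * (\<Sum>s\<in>states. path_weight k s * (F s - F (exch k s))\<^sup>2)
       \<le> 6 * real k * (\<Sum>l<N. swap_form l F)"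
proof -
  obtain n where k: "k = Suc n" using assms by (cases k) auto
  have ex_mem: "exch k s \<in> states" if "s \<in> states" for s
    using that assms unfolding exch_def by (intro states_upd states_mem) auto
  have ex_ex: "exch k (exch k s) = s" for s by (auto simp: exch_def fun_eq_iff)
  have pw: "path_weight k (exch k s) = path_weight k s" if "s \<in> states" for s
  proof -
    have m: "s 0 \<in> {1..J}" "s k \<in> {1..J}" using states_mem[OF that, of 0] states_mem[OF that, of k] assms by auto
    have "weight (exch k s) * w k (s k) = weight (s(0 := s k)) * w k (s 0)"
      using weight_upd[of k "s(0 := s k)" "s 0"] assms by (simp add: exch_def)
    moreover have "weight (s(0 := s k)) * w 0 (s 0) = weight s * w 0 (s k)"
      by (rule weight_upd) simp
    moreover have "w 0 (s 0) > 0" "w 0 (s k) > 0" "w k (s k) > 0"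
      using m assms by (auto intro!: w_pos simp del: atLeastAtMost_iff)
    moreover have "exch k s 0 = s k" using assms by (simp add: exch_def)
    ultimately show ?thesis
      unfolding path_weight_def by (simp add: nonzero_divide_eq_eq nonzero_eq_divide_eq)
  qed
  have rot_ex: "rot n (exch k s) = rot k s" for s
    by (auto simp: fun_eq_iff rot_eq exch_def k simp del: rot.simps dest: less_antisym)
  let ?S = "\<lambda>G. (\<Sum>s\<in>states. path_weight k s * G s)"
  have "?S (\<lambda>s. (F s - F (exch k s))\<^sup>2)
     \<le> ?S (\<lambda>s. 3 * ((F s - F (rot n s))\<^sup>2 + (F (rot n s) - F (rot k s))\<^sup>2 + (F (exch k s) - F (rot n (exch k s)))\<^sup>2))"
  proof (intro sum_mono mult_left_mono path_weight_nonneg assms)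
    fix s
    from square_sum3_le[of "F s - F (rot n s)" "F (rot n s) - F (rot k s)" "F (exch k s) - F (rot n (exch k s))"]
    show "(F s - F (exch k s))\<^sup>2 \<le> 3 * ((F s - F (rot n s))\<^sup>2 + (F (rot n s) - F (rot k s))\<^sup>2 + (F (exch k s) - F (rot n (exch k s)))\<^sup>2)"
      unfolding rot_ex by simp
  qed
  also have "\<dots> = 3 * (?S (\<lambda>s. (F s - F (rot n s))\<^sup>2) + ?S (\<lambda>s. (F (rot n s) - F (rot k s))\<^sup>2)
       + ?S (\<lambda>s. (F (exch k s) - F (rot n (exch k s)))\<^sup>2))"
    by (simp add: sum.distrib sum_distrib_left algebra_simps)
  also have "?S (\<lambda>s. (F (exch k s) - F (rot n (exch k s)))\<^sup>2) = ?S (\<lambda>s. (F s - F (rot n s))\<^sup>2)"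
    by (rule sum.reindex_bij_witness[of _ "exch k" "exch k"]) (use ex_mem ex_ex pw in auto)
  finally have "\<gamma> ^ (J + 1) * ?S (\<lambda>s. (F s - F (exch k s))\<^sup>2)
     \<le> \<gamma> ^ (J + 1) * (3 * (?S (\<lambda>s. (F s - F (rot n s))\<^sup>2) + ?S (\<lambda>s. (F (rot n s) - F (rot k s))\<^sup>2) + ?S (\<lambda>s. (F s - F (rot n s))\<^sup>2)))"
    using gamma_pos by (intro mult_left_mono) auto
  also have "\<dots> = 6 * (\<gamma> ^ (J + 1) * ?S (\<lambda>s. (F s - F (rot n s))\<^sup>2))
       + 3 * (\<gamma> ^ (J + 1) * ?S (\<lambda>s. (F (rot n s) - F (rot k s))\<^sup>2))"
    by (simp add: algebra_simps)
  also have "\<dots> \<le> 6 * (real n * (\<Sum>l<n. swap_form l F)) + 3 * swap_form n F"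
    using rot_path_le[of n k F] rot_step_le[of n k F] assms
    by (intro add_mono mult_left_mono) (auto simp: k simp del: rot.simps(2))
  \<comment> \<open>The coefficients \<open>6 * n\<close> of the first \<open>n\<close> swaps and 3
    of the last one are both at most \<open>6 * Suc n\<close>.\<close>
  also have "\<dots> \<le> 6 * real k * (\<Sum>l<k. swap_form l F)"
    using swap_form_nonneg[of n F] sum_nonneg[of "{..<n}" "\<lambda>l. swap_form l F"] swap_form_nonneg
    by (simp add: k algebra_simps)
  also have "\<dots> \<le> 6 * real k * (\<Sum>l<N. swap_form l F)"
    using assms swap_form_nonneg by (intro mult_left_mono sum_mono2) auto
  finally show ?thesis .
qed

lemma gamma_le_1: "\<gamma> \<le> 1"
proof -
  have "J \<noteq> 0" using w_sum[of 0] by (cases "J = 0") auto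
  then have "\<gamma> * w 0 1 \<le> w 0 1" "w 0 1 > 0" using gamma_w[of 0 0 1] w_pos[of 0 1] by auto
  then show ?thesis by simp
qed

text \<open>Three legs give a factor 3. The two resamplings of level 0 cost the same, whence 6, and
  the exchange brings its own \<open>6 * k\<close>, whence \<open>18 * k\<close>.\<close>

proposition resample_form_le:
  assumes "1 \<le> k" "k \<le> N"
  shows "\<gamma> ^ (J + 1) * resample_form k F \<le> 6 * resample_form 0 F + 18 * real k * (\<Sum>l<N. swap_form l F)"
proof -
  define S where "S G = (\<Sum>s\<in>states. \<Sum>j\<in>{1..J}. weight s * w k j * G s j)" for G :: "(nat \<Rightarrow> nat) \<Rightarrow> nat \<Rightarrow> real"
  have wn: "weight s * w k j \<ge> 0" if "s \<in> states" "j \<in> {1..J}" for s j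
    using that assms by (intro mult_nonneg_nonneg weight_nonneg w_nonneg) auto
  define G1 where "G1 s j = (F s - F (s(0 := j)))\<^sup>2" for s j
  define G2 where "G2 s j = (F (s(0 := j)) - F (exch k (s(0 := j))))\<^sup>2" for s and j :: nat
  define G3 where "G3 s j = (F (s(k := j)) - F ((s(k := j))(0 := s k)))\<^sup>2" for s j
  have "resample_form k F = S (\<lambda>s j. (F s - F (s(k := j)))\<^sup>2)"
    by (simp add: resample_form_def S_def)
  also have "\<dots> \<le> S (\<lambda>s j. 3 * (G1 s j + G2 s j + G3 s j))"
    unfolding S_def
  proof (intro sum_mono mult_left_mono wn)
    fix s and j :: nat
    have e: "exch k (s(0 := j)) = (s(k := j))(0 := s k)"
      using assms by (auto simp: exch_def fun_eq_iff)
    from square_sum3_le[of "F s - F (s(0 := j))" "F (s(0 := j)) - F (exch k (s(0 := j)))" "F (s(k := j)) - F ((s(k := j))(0 := s k))"]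
    show "(F s - F (s(k := j)))\<^sup>2 \<le> 3 * (G1 s j + G2 s j + G3 s j)"
      by (simp add: G1_def G2_def G3_def e)
  qed
  also have "\<dots> = 3 * (S G1 + S G2 + S G3)"
    by (simp add: S_def sum.distrib sum_distrib_left algebra_simps)
  finally have le: "resample_form k F \<le> 3 * (S G1 + S G2 + S G3)" .
  \<comment> \<open>Read backwards from the final state, the last leg is a first leg: the involution
    behind \<open>sum_resample\<close> maps one sum to the other.\<close>
  have S3: "S G3 = S G1"
    unfolding S_def G3_def G1_def
    by (rule sum_resample[OF assms(2), of "\<lambda>s j. (F s - F (s(0 := j)))\<^sup>2"])
  \<comment> \<open>The label \<open>j\<close> is drawn from \<open>w k\<close>; comparison with a
    draw from \<open>w 0\<close> costs one \<gamma>.\<close>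
  have S1: "\<gamma> * S G1 \<le> resample_form 0 F"
    unfolding S_def resample_form_def sum_distrib_left G1_def
  proof (intro sum_mono)
    fix s j assume sj: "s \<in> states" "j \<in> {1..J}"
    have "\<gamma> * (weight s * w k j * (F s - F (s(0 := j)))\<^sup>2) = (\<gamma> * w k j) * (weight s * (F s - F (s(0 := j)))\<^sup>2)"
      by simp
    also have "\<dots> \<le> w 0 j * (weight s * (F s - F (s(0 := j)))\<^sup>2)"
      using sj assms weight_pos[of s] by (intro mult_right_mono gamma_w) auto
    finally show "\<gamma> * (weight s * w k j * (F s - F (s(0 := j)))\<^sup>2) \<le> weight s * w 0 j * (F s - F (s(0 := j)))\<^sup>2"
      by (simp add: ac_simps)
  qed
  \<comment> \<open>The state in the middle leg is \<open>s(0 := j)\<close>, whose law is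
    \<open>path_weight\<close>. The density \<open>w k / w 0\<close> turns the draw from
    \<open>w k\<close> into one from \<open>w 0\<close>, to which \<open>sum_resample\<close>
    applies.\<close>
  have S2: "S G2 = (\<Sum>s\<in>states. path_weight k s * (F s - F (exch k s))\<^sup>2)"
  proof -
    define \<Psi> where "\<Psi> s = w k (s 0) / w 0 (s 0) * (F s - F (exch k s))\<^sup>2" for s
    have "S G2 = (\<Sum>s\<in>states. \<Sum>j\<in>{1..J}. weight s * w 0 j * \<Psi> (s(0 := j)))"
      unfolding S_def
    proof (intro sum.cong refl)
      fix s j assume sj: "s \<in> states" "j \<in> {1..J}"
      have "w 0 j > 0" using sj by (intro w_pos) auto
      then show "weight s * w k j * G2 s j = weight s * w 0 j * \<Psi> (s(0 := j))"
        by (simp add: \<Psi>_def G2_def)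
    qed
    also have "\<dots> = (\<Sum>s\<in>states. \<Sum>j\<in>{1..J}. weight s * w 0 j * \<Psi> s)"
      by (rule sum_resample[of 0 "\<lambda>s j. \<Psi> s"]) simp
    also have "\<dots> = (\<Sum>s\<in>states. weight s * \<Psi> s * (\<Sum>j\<in>{1..J}. w 0 j))"
      by (simp add: sum_distrib_left ac_simps)
    also have "\<dots> = (\<Sum>s\<in>states. path_weight k s * (F s - F (exch k s))\<^sup>2)"
      unfolding w_sum[OF le0[of N]] by (simp add: \<Psi>_def path_weight_def ac_simps)
    finally show ?thesis .
  qed
  have S1n: "S G1 \<ge> 0" unfolding S_def G1_def by (intro sum_nonneg mult_nonneg_nonneg wn) auto
  have "\<gamma> ^ (J + 1) * resample_form k F \<le> \<gamma> ^ (J + 1) * (3 * (S G1 + S G2 + S G1))"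
    using le gamma_pos unfolding S3 by (intro mult_left_mono) auto
  also have "\<dots> = 6 * (\<gamma> ^ J * (\<gamma> * S G1)) + 3 * (\<gamma> ^ (J + 1) * S G2)"
    by (simp add: algebra_simps)
  also have "\<dots> \<le> 6 * resample_form 0 F + 3 * (6 * real k * (\<Sum>l<N. swap_form l F))"
  proof -
    have "\<gamma> ^ J * (\<gamma> * S G1) \<le> 1 * resample_form 0 F"
      using S1 gamma_pos gamma_le_1 S1n by (intro mult_mono power_le_one) auto
    with exch_le[OF assms, of F] show ?thesis unfolding S2 by linarith
  qed
  finally show ?thesis by simp
qed

end

subsection \<open>Square-integrable functions and reversible kernels\<close>

text \<open>A Bochner integral is 0 by convention where the integrand is not integrable, so
  measurability in the parameter reduces to three nonnegative integrals: that of the absolute value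
  decides integrability, the other two give the value.\<close>

lemma borel_measurable_kernel_integral:
  fixes f :: "'a \<Rightarrow> 'b \<Rightarrow> real"
  assumes f[measurable]: "(\<lambda>(x, y). f x y) \<in> borel_measurable (M \<Otimes>\<^sub>M N)"
    and K: "K \<in> M \<rightarrow>\<^sub>M prob_algebra N"
  shows "(\<lambda>x. \<integral>y. f x y \<partial>K x) \<in> borel_measurable M"
proof -
  have K'[measurable]: "K \<in> M \<rightarrow>\<^sub>M subprob_algebra N" using K by (rule measurable_prob_algebraD)
  have sK: "sets (K x) = sets N" if "x \<in> space M" for x
    using measurable_space[OF K that] by (simp add: space_prob_algebra)
  have fx: "f x \<in> borel_measurable (K x)" if "x \<in> space M" for x
    using measurable_Pair2[OF f that] sK[OF that] by (simp cong: measurable_cong_sets)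
  have "(\<integral>y. f x y \<partial>K x) = (if (\<integral>\<^sup>+y. ennreal \<bar>f x y\<bar> \<partial>K x) < \<infinity>
      then enn2real (\<integral>\<^sup>+y. ennreal (f x y) \<partial>K x) - enn2real (\<integral>\<^sup>+y. ennreal (- f x y) \<partial>K x) else 0)"
    if "x \<in> space M" for x
    using fx[OF that] by (auto simp: real_lebesgue_integral_def integrable_iff_bounded
        intro!: not_integrable_integral_eq)
  moreover have [measurable]: "(\<lambda>x. \<integral>\<^sup>+y. ennreal \<bar>f x y\<bar> \<partial>K x) \<in> borel_measurable M"
    "(\<lambda>x. \<integral>\<^sup>+y. ennreal (f x y) \<partial>K x) \<in> borel_measurable M"
    "(\<lambda>x. \<integral>\<^sup>+y. ennreal (- f x y) \<partial>K x) \<in> borel_measurable M"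
    by (rule nn_integral_measurable_subprob_algebra2[where N=N]; measurable)+
  ultimately show ?thesis
    by (subst measurable_cong) measurable
qed

lemma L2fun_integrable_mult:
  assumes "f \<in> L2fun M" "g \<in> L2fun M"
  shows "integrable M (\<lambda>x. f x * g x)"
proof (rule Bochner_Integration.integrable_bound)
  show "integrable M (\<lambda>x. (f x)\<^sup>2 + (g x)\<^sup>2)" using assms by (auto simp: L2fun_def)
  show "(\<lambda>x. f x * g x) \<in> borel_measurable M" using assms by (auto simp: L2fun_def)
  have "\<bar>a * b\<bar> \<le> \<bar>a\<^sup>2 + b\<^sup>2\<bar>" for a b :: real
  proof -
    have "2 * (\<bar>a\<bar> * \<bar>b\<bar>) \<le> a\<^sup>2 + b\<^sup>2"
      using sum_squares_bound[of "\<bar>a\<bar>" "\<bar>b\<bar>"] by simp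
    then show ?thesis using abs_ge_zero[of a] abs_ge_zero[of b] mult_nonneg_nonneg[of "\<bar>a\<bar>" "\<bar>b\<bar>"]
      unfolding abs_mult by linarith
  qed
  then show "AE x in M. norm (f x * g x) \<le> norm ((f x)\<^sup>2 + (g x)\<^sup>2)" by simp
qed

lemma L2fun_add:
  assumes "f \<in> L2fun M" "g \<in> L2fun M"
  shows "(\<lambda>x. f x + g x) \<in> L2fun M"
proof -
  have "integrable M (\<lambda>x. (f x)\<^sup>2 + 2 * (f x * g x) + (g x)\<^sup>2)"
    using assms L2fun_integrable_mult[OF assms] by (auto simp: L2fun_def)
  then show ?thesis using assms by (auto simp: L2fun_def power2_sum algebra_simps)
qed

lemma L2fun_cmult: "f \<in> L2fun M \<Longrightarrow> (\<lambda>x. c * f x) \<in> L2fun M"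
  by (auto simp: L2fun_def power_mult_distrib)

lemma L2fun_diff:
  assumes "f \<in> L2fun M" "g \<in> L2fun M"
  shows "(\<lambda>x. f x - g x) \<in> L2fun M"
  using L2fun_add[OF assms(1) L2fun_cmult[OF assms(2), of "-1"]] by simp

lemma L2fun_sum:
  "finite I \<Longrightarrow> (\<And>i. i \<in> I \<Longrightarrow> f i \<in> L2fun M) \<Longrightarrow> (\<lambda>x. \<Sum>i\<in>I. f i x) \<in> L2fun M"
  by (induction I rule: finite_induct) (auto intro!: L2fun_add, auto simp: L2fun_def)

lemma (in finite_measure) L2fun_const: "(\<lambda>x. c) \<in> L2fun M"
  by (simp add: L2fun_def)

lemma L2fun_indicator:
  assumes "f \<in> L2fun M" "B \<in> sets M"
  shows "(\<lambda>x. indicator B x * f x) \<in> L2fun M"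
proof -
  have "integrable M (\<lambda>x. indicator B x * (f x)\<^sup>2)"
    using assms integrable_mult_indicator[of B M "\<lambda>x. (f x)\<^sup>2"] by (auto simp: L2fun_def)
  moreover have "(indicator B x * f x)\<^sup>2 = indicator B x * (f x)\<^sup>2" for x by (auto simp: indicator_def)
  ultimately show ?thesis using assms by (auto simp: L2fun_def)
qed

lemma (in finite_measure) L2fun_integrable: "f \<in> L2fun M \<Longrightarrow> integrable M f"
  using L2fun_integrable_mult[OF _ L2fun_const[of 1]] by simp

lemma L2fun_iff_nn:
  "f \<in> L2fun M \<longleftrightarrow> f \<in> borel_measurable M \<and> (\<integral>\<^sup>+x. ennreal ((f x)\<^sup>2) \<partial>M) < \<infinity>"
  by (auto simp: L2fun_def integrable_iff_bounded)

lemma (in finite_measure) integral_square_shift: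
  assumes f: "f \<in> L2fun M" and B[measurable]: "B \<in> sets M"
  shows "integrable M (\<lambda>x. indicator B x * (f x - c)\<^sup>2)"
    and "(\<integral>x. indicator B x * (f x - c)\<^sup>2 \<partial>M)
       = (\<integral>x. indicator B x * (f x)\<^sup>2 \<partial>M) - 2 * c * (\<integral>x. indicator B x * f x \<partial>M) + c\<^sup>2 * measure M B"
proof -
  have i: "integrable M (\<lambda>x. indicator B x * (f x)\<^sup>2)" "integrable M (\<lambda>x. indicator B x * f x)"
    using f L2fun_integrable[OF f] integrable_mult_indicator[OF B, of "\<lambda>x. (f x)\<^sup>2"]
      integrable_mult_indicator[OF B, of f] by (auto simp: L2fun_def)
  have eq: "indicator B x * (f x - c)\<^sup>2
      = indicator B x * (f x)\<^sup>2 - 2 * c * (indicator B x * f x) + c\<^sup>2 * indicator B x" for x :: 'a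
    by (simp add: power2_diff algebra_simps)
  show "integrable M (\<lambda>x. indicator B x * (f x - c)\<^sup>2)"
    unfolding eq using i by (auto intro!: integrable_real_indicator simp: less_top[symmetric])
  show "(\<integral>x. indicator B x * (f x - c)\<^sup>2 \<partial>M)
       = (\<integral>x. indicator B x * (f x)\<^sup>2 \<partial>M) - 2 * c * (\<integral>x. indicator B x * f x \<partial>M) + c\<^sup>2 * measure M B"
    unfolding eq using i by (simp add: less_top[symmetric])
qed

text \<open>The variance is nonnegative. Outside \<open>L2fun\<close> the right-hand side is
  infinite, so measurability of \<open>f\<close> suffices.\<close>

lemma (in prob_space) square_integral_le:
  assumes "f \<in> borel_measurable M"
  shows "ennreal ((\<integral>x. f x \<partial>M)\<^sup>2) \<le> (\<integral>\<^sup>+x. ennreal ((f x)\<^sup>2) \<partial>M)"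
proof (cases "f \<in> L2fun M")
  case True
  have "0 \<le> (\<integral>x. indicator (space M) x * (f x - (\<integral>x. f x \<partial>M))\<^sup>2 \<partial>M)" by simp
  also have "\<dots> = (\<integral>x. (f x)\<^sup>2 \<partial>M) - (\<integral>x. f x \<partial>M)\<^sup>2"
    unfolding integral_square_shift(2)[OF True sets.top]
    by (simp add: prob_space power2_eq_square cong: Bochner_Integration.integral_cong)
  finally have "(\<integral>x. f x \<partial>M)\<^sup>2 \<le> (\<integral>x. (f x)\<^sup>2 \<partial>M)" by simp
  then show ?thesis
    using True by (subst nn_integral_eq_integral) (auto simp: L2fun_def)
next
  case False
  then show ?thesis using assms by (simp add: L2fun_iff_nn less_top[symmetric])
qed

section \<open>Symmetry and jump forms of a reversible kernel\<close>

locale reversible_kernel = prob_space D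
  for D :: "'a measure" and K :: "'a \<Rightarrow> 'a measure" +
  assumes kernel: "K \<in> D \<rightarrow>\<^sub>M prob_algebra D"
    and rev: "reversible D (kop K)"
begin

lemma kernel_subprob[measurable]: "K \<in> D \<rightarrow>\<^sub>M subprob_algebra D"
  using kernel by (rule measurable_prob_algebraD)

lemma prob_K: "x \<in> space D \<Longrightarrow> prob_space (K x)"
  and sets_K[measurable_cong]: "x \<in> space D \<Longrightarrow> sets (K x) = sets D"
  using measurable_space[OF kernel] by (auto simp: space_prob_algebra)

lemma space_K: "x \<in> space D \<Longrightarrow> space (K x) = space D"
  by (intro sets_eq_imp_space_eq sets_K)

lemma measurable_K: "x \<in> space D \<Longrightarrow> f \<in> borel_measurable D \<Longrightarrow> f \<in> borel_measurable (K x)"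
  by (simp cong: measurable_cong_sets add: sets_K)

text \<open>Reversibility on indicators: the joint law of start and arrival point is symmetric on
  rectangles.\<close>

lemma kernel_symm:
  assumes [measurable]: "A \<in> sets D" "B \<in> sets D"
  shows "(\<integral>\<^sup>+x. indicator A x * emeasure (K x) B \<partial>D) = (\<integral>\<^sup>+x. indicator B x * emeasure (K x) A \<partial>D)"
proof -
  have ind: "indicator C \<in> L2fun D" if "C \<in> sets D" for C
    using L2fun_indicator[OF L2fun_const[of 1] that] by simp
  have nn: "(\<integral>\<^sup>+x. indicator A x * emeasure (K x) B \<partial>D) = ennreal (inner_mu D (indicator A) (kop K (indicator B)))"
    if [measurable]: "A \<in> sets D" "B \<in> sets D" for A B
  proof -
    have kB: "kop K (indicator B) x = measure (K x) B" if "x \<in> space D" for x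
      using that sets.sets_into_space[of B D] by (simp add: kop_def space_K Int_absorb1)
    have [measurable]: "(\<lambda>x. measure (K x) B) \<in> borel_measurable D"
      by (rule measurable_compose[OF kernel measurable_measure_prob_algebra]) fact
    have "(\<integral>\<^sup>+x. indicator A x * emeasure (K x) B \<partial>D) = (\<integral>\<^sup>+x. ennreal (indicator A x * measure (K x) B) \<partial>D)"
    proof (intro nn_integral_cong)
      fix x assume "x \<in> space D"
      then interpret P: prob_space "K x" by (rule prob_K)
      show "indicator A x * emeasure (K x) B = ennreal (indicator A x * measure (K x) B)"
        by (simp add: P.emeasure_eq_measure indicator_def)
    qed
    also have "\<dots> = ennreal (\<integral>x. indicator A x * measure (K x) B \<partial>D)"
    proof (intro nn_integral_eq_integral integrable_const_bound[of _ 1] AE_I2)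
      fix x assume "x \<in> space D"
      then interpret P: prob_space "K x" by (rule prob_K)
      show "norm (indicator A x * measure (K x) B) \<le> 1"
        by (simp add: indicator_def)
    qed auto
    also have "(\<integral>x. indicator A x * measure (K x) B \<partial>D) = inner_mu D (indicator A) (kop K (indicator B))"
      unfolding inner_mu_def by (intro Bochner_Integration.integral_cong) (auto simp: kB)
    finally show ?thesis .
  qed
  have "inner_mu D (indicator A) (kop K (indicator B)) = inner_mu D (indicator B) (kop K (indicator A))"
    using rev[unfolded reversible_def, rule_format, OF ind ind, OF assms]
    unfolding inner_mu_def by (simp only: mult.commute)
  then show ?thesis by (simp only: nn[OF assms] nn[OF assms(2,1)])
qed

text \<open>Monotone approximation extends the symmetry to nonnegative functions of one argument.
  The other argument stays an indicator, which suffices to transfer second moments between start and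
  arrival point.\<close>

lemma kernel_symm_fun:
  assumes A[measurable]: "A \<in> sets D" and g: "g \<in> borel_measurable D"
  shows "(\<integral>\<^sup>+x. indicator A x * (\<integral>\<^sup>+y. g y \<partial>K x) \<partial>D) = (\<integral>\<^sup>+x. g x * emeasure (K x) A \<partial>D)"
  using g
proof (induction g rule: borel_measurable_induct)
  case (cong f g)
  moreover have "(\<integral>\<^sup>+x. indicator A x * (\<integral>\<^sup>+y. f y \<partial>K x) \<partial>D) = (\<integral>\<^sup>+x. indicator A x * (\<integral>\<^sup>+y. g y \<partial>K x) \<partial>D)"
    by (intro nn_integral_cong arg_cong2[where f="(*)"] refl) (auto simp: space_K cong(3))
  moreover have "(\<integral>\<^sup>+x. f x * emeasure (K x) A \<partial>D) = (\<integral>\<^sup>+x. g x * emeasure (K x) A \<partial>D)"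
    by (intro nn_integral_cong) (auto simp: cong(3))
  ultimately show ?case by simp
next
  case (set B)
  have "(\<integral>\<^sup>+x. indicator A x * (\<integral>\<^sup>+y. indicator B y \<partial>K x) \<partial>D) = (\<integral>\<^sup>+x. indicator A x * emeasure (K x) B \<partial>D)"
    using set by (intro nn_integral_cong arg_cong2[where f="(*)"] refl nn_integral_indicator) (simp add: sets_K)
  then show ?case using kernel_symm[OF A set] by simp
next
  case (mult u c)
  note [measurable] = mult(2)
  have "(\<integral>\<^sup>+x. indicator A x * (\<integral>\<^sup>+y. c * u y \<partial>K x) \<partial>D) = (\<integral>\<^sup>+x. c * (indicator A x * (\<integral>\<^sup>+y. u y \<partial>K x)) \<partial>D)"
    using mult(2) by (intro nn_integral_cong) (simp add: nn_integral_cmult measurable_K ac_simps)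
  also have "\<dots> = c * (\<integral>\<^sup>+x. indicator A x * (\<integral>\<^sup>+y. u y \<partial>K x) \<partial>D)"
    by (intro nn_integral_cmult) measurable
  also have "\<dots> = (\<integral>\<^sup>+x. c * (u x * emeasure (K x) A) \<partial>D)"
    unfolding mult(4) by (intro nn_integral_cmult[symmetric]) measurable
  finally show ?case by (simp add: ac_simps)
next
  case (add u v)
  note [measurable] = add(1,3)
  have "(\<integral>\<^sup>+x. indicator A x * (\<integral>\<^sup>+y. v y + u y \<partial>K x) \<partial>D)
     = (\<integral>\<^sup>+x. indicator A x * (\<integral>\<^sup>+y. v y \<partial>K x) + indicator A x * (\<integral>\<^sup>+y. u y \<partial>K x) \<partial>D)"
    using add(1,3) by (intro nn_integral_cong) (simp add: nn_integral_add measurable_K distrib_left)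
  also have "\<dots> = (\<integral>\<^sup>+x. indicator A x * (\<integral>\<^sup>+y. v y \<partial>K x) \<partial>D) + (\<integral>\<^sup>+x. indicator A x * (\<integral>\<^sup>+y. u y \<partial>K x) \<partial>D)"
    by (intro nn_integral_add) measurable
  also have "\<dots> = (\<integral>\<^sup>+x. v x * emeasure (K x) A + u x * emeasure (K x) A \<partial>D)"
    unfolding add(6,7) by (intro nn_integral_add[symmetric]) measurable
  finally show ?case by (simp add: distrib_right)
next
  case (seq U)
  note [measurable] = seq(1)
  have mono: "x \<in> space D \<Longrightarrow> incseq (\<lambda>i. U i x)" for x
    using seq(3) by (auto simp: incseq_def le_fun_def)
  have "(\<integral>\<^sup>+x. indicator A x * (\<integral>\<^sup>+y. (SUP i. U i) y \<partial>K x) \<partial>D)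
      = (\<integral>\<^sup>+x. (SUP i. indicator A x * (\<integral>\<^sup>+y. U i y \<partial>K x)) \<partial>D)"
    using seq(1,3) by (intro nn_integral_cong)
      (simp add: image_comp nn_integral_monotone_convergence_SUP measurable_K SUP_mult_left_ennreal)
  also have "\<dots> = (SUP i. \<integral>\<^sup>+x. indicator A x * (\<integral>\<^sup>+y. U i y \<partial>K x) \<partial>D)"
    using seq(3)
    by (intro nn_integral_monotone_convergence_SUP)
      (auto simp: incseq_def le_fun_def intro!: mult_left_mono nn_integral_mono)
  also have "\<dots> = (SUP i. \<integral>\<^sup>+x. U i x * emeasure (K x) A \<partial>D)"
    using seq(5) by simp
  also have "\<dots> = (\<integral>\<^sup>+x. (SUP i. U i x * emeasure (K x) A) \<partial>D)"
    using seq(3)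
    by (intro nn_integral_monotone_convergence_SUP[symmetric])
      (auto simp: incseq_def le_fun_def intro!: mult_right_mono)
  also have "\<dots> = (\<integral>\<^sup>+x. (SUP i. U i) x * emeasure (K x) A \<partial>D)"
    by (simp add: image_comp SUP_mult_right_ennreal)
  finally show ?case .
qed

lemma kernel_invariant:
  assumes "g \<in> borel_measurable D"
  shows "(\<integral>\<^sup>+x. \<integral>\<^sup>+y. g y \<partial>K x \<partial>D) = (\<integral>\<^sup>+x. g x \<partial>D)"
proof -
  have "emeasure (K x) (space D) = 1" if "x \<in> space D" for x
    using prob_space.emeasure_space_1[OF prob_K[OF that]] space_K[OF that] by simp
  then have "(\<integral>\<^sup>+x. g x * emeasure (K x) (space D) \<partial>D) = (\<integral>\<^sup>+x. g x \<partial>D)"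
    by (intro nn_integral_cong) simp
  then show ?thesis
    using kernel_symm_fun[OF sets.top assms] by (simp cong: nn_integral_cong_simp)
qed

end

lemma ennreal_indicator_mult: "indicator A x * ennreal r = ennreal (indicator A x * r)"
  by (simp add: indicator_def)

lemma (in finite_measure) nn_integral_square_shift:
  assumes f: "f \<in> L2fun M" and B[measurable]: "B \<in> sets M"
  shows "(\<integral>\<^sup>+x. indicator B x * ennreal ((f x - c)\<^sup>2) \<partial>M)
    = ennreal ((\<integral>x. indicator B x * (f x)\<^sup>2 \<partial>M) - 2 * c * (\<integral>x. indicator B x * f x \<partial>M) + c\<^sup>2 * measure M B)"
  unfolding ennreal_indicator_mult integral_square_shift(2)[OF assms, symmetric]
  by (intro nn_integral_eq_integral integral_square_shift(1)[OF assms]) auto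

lemma square_diff_le: "(a - b)\<^sup>2 \<le> 2 * a\<^sup>2 + 2 * b\<^sup>2" for a b :: real
  using zero_le_power2[of "a + b"] by (simp add: power2_sum power2_diff)

context reversible_kernel begin

text \<open>For square-integrable \<open>f\<close>, twice the mass of \<open>A\<close> times the
  Dirichlet form of the kernel restricted to \<open>A\<close>. As an extended nonnegative integral
  it can be estimated before anything is known about integrability.\<close>

definition jump :: "'a set \<Rightarrow> ('a \<Rightarrow> real) \<Rightarrow> ennreal" where
  "jump A f = (\<integral>\<^sup>+x. indicator A x * (\<integral>\<^sup>+y. indicator A y * ennreal ((f x - f y)\<^sup>2) \<partial>K x) \<partial>D)"

lemma AE_L2fun_K:
  assumes f: "f \<in> L2fun D"
  shows "AE x in D. f \<in> L2fun (K x)"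
proof -
  have [measurable]: "f \<in> borel_measurable D" using f by (simp add: L2fun_def)
  have "(\<integral>\<^sup>+x. \<integral>\<^sup>+y. ennreal ((f y)\<^sup>2) \<partial>K x \<partial>D) < \<infinity>"
    using f by (subst kernel_invariant) (auto simp: L2fun_iff_nn)
  then have "AE x in D. (\<integral>\<^sup>+y. ennreal ((f y)\<^sup>2) \<partial>K x) \<noteq> \<infinity>"
    by (intro nn_integral_PInf_AE) (auto simp: less_top)
  then show ?thesis
    by (rule AE_mp) (auto intro!: AE_I2 simp: L2fun_iff_nn measurable_K less_top[symmetric])
qed

text \<open>Expanding the square under \<open>K x\<close> leaves the mass \<open>t\<close>, the
  first moment \<open>b\<close> and the second moment \<open>c\<close> of the arrival point within
  \<open>A\<close>. Symmetry exchanges the two square terms, so the whole is twice the integral of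
  \<open>f\<^sup>2 * t - f * b\<close> over \<open>A\<close>.\<close>

lemma
  assumes f: "f \<in> L2fun D" and A[measurable]: "A \<in> sets D"
  defines "h \<equiv> (\<lambda>x. indicator A x * (f x * (f x * measure (K x) A - (\<integral>y. indicator A y * f y \<partial>K x))))"
  shows jump_eq: "jump A f = ennreal (2 * (\<integral>x. h x \<partial>D))"
    and restricted_form_nonneg: "0 \<le> (\<integral>x. h x \<partial>D)"
proof -
  have fm[measurable]: "f \<in> borel_measurable D" and f2: "integrable D (\<lambda>x. (f x)\<^sup>2)"
    using f by (auto simp: L2fun_def)
  define t where "t x = measure (K x) A" for x
  define b where "b x = (\<integral>y. indicator A y * f y \<partial>K x)" for x
  define c where "c x = (\<integral>y. indicator A y * (f y)\<^sup>2 \<partial>K x)" for x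
  have [measurable]: "b \<in> borel_measurable D" "c \<in> borel_measurable D"
    unfolding b_def c_def by (intro borel_measurable_kernel_integral[OF _ kernel]; measurable)+
  have [measurable]: "t \<in> borel_measurable D"
    unfolding t_def by (rule measurable_compose[OF kernel measurable_measure_prob_algebra]) fact
  have c0: "0 \<le> c x" for x unfolding c_def by simp
  have t01: "0 \<le> t x" "x \<in> space D \<Longrightarrow> t x \<le> 1" for x
    unfolding t_def using prob_space.prob_le_1[OF prob_K] by auto
  then have tabs: "x \<in> space D \<Longrightarrow> \<bar>t x\<bar> \<le> 1" for x by simp
  \<comment> \<open>The exceptional null set does not depend on \<open>d\<close>, so that
    \<open>d\<close> can later be taken to be 0, \<open>f x\<close> or \<open>- f x\<close> at the
    point \<open>x\<close> itself.\<close>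
  have good: "AE x in D. (\<forall>d. (\<integral>\<^sup>+y. indicator A y * ennreal ((f y - d)\<^sup>2) \<partial>K x)
        = ennreal (c x - 2 * d * b x + d\<^sup>2 * t x) \<and> 0 \<le> c x - 2 * d * b x + d\<^sup>2 * t x)"
    using AE_L2fun_K[OF f]
  proof (rule AE_mp, intro AE_I2 impI allI)
    fix x d assume x: "x \<in> space D" and fx: "f \<in> L2fun (K x)"
    interpret P: prob_space "K x" using x by (rule prob_K)
    have AK: "A \<in> sets (K x)" using x by (simp add: sets_K)
    have "0 \<le> (\<integral>y. indicator A y * (f y - d)\<^sup>2 \<partial>K x)" by simp
    then show "(\<integral>\<^sup>+y. indicator A y * ennreal ((f y - d)\<^sup>2) \<partial>K x) = ennreal (c x - 2 * d * b x + d\<^sup>2 * t x)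
       \<and> 0 \<le> c x - 2 * d * b x + d\<^sup>2 * t x"
      using P.nn_integral_square_shift[OF fx AK, of d] P.integral_square_shift(2)[OF fx AK, of d]
      by (simp add: b_def c_def t_def)
  qed
  have i1: "integrable D (\<lambda>x. indicator A x * ((f x)\<^sup>2 * t x))"
    by (rule Bochner_Integration.integrable_bound[OF f2])
      (auto intro!: AE_I2 mult_left_le tabs simp: abs_mult indicator_def)
  \<comment> \<open>Symmetry of the kernel: over jumps within \<open>A\<close>, start and arrival
    point have the same second moment.\<close>
  have eqc: "(\<integral>\<^sup>+x. ennreal (indicator A x * c x) \<partial>D) = (\<integral>\<^sup>+x. ennreal (indicator A x * ((f x)\<^sup>2 * t x)) \<partial>D)"
  proof -
    have "(\<integral>\<^sup>+x. ennreal (indicator A x * c x) \<partial>D)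
        = (\<integral>\<^sup>+x. indicator A x * (\<integral>\<^sup>+y. ennreal (indicator A y * (f y)\<^sup>2) \<partial>K x) \<partial>D)"
    proof (rule nn_integral_cong_AE, use good in eventually_elim)
      case (elim x)
      from elim[rule_format, of 0] show ?case
        by (simp add: ennreal_indicator_mult[symmetric])
    qed
    also have "\<dots> = (\<integral>\<^sup>+x. ennreal (indicator A x * (f x)\<^sup>2) * emeasure (K x) A \<partial>D)"
      by (rule kernel_symm_fun) measurable
    also have "\<dots> = (\<integral>\<^sup>+x. ennreal (indicator A x * ((f x)\<^sup>2 * t x)) \<partial>D)"
    proof (rule nn_integral_cong)
      fix x assume "x \<in> space D"
      then interpret P: prob_space "K x" by (rule prob_K)
      show "ennreal (indicator A x * (f x)\<^sup>2) * emeasure (K x) A = ennreal (indicator A x * ((f x)\<^sup>2 * t x))"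
        by (simp add: P.emeasure_eq_measure t_def ennreal_mult' mult.assoc[symmetric])
    qed
    finally show ?thesis .
  qed
  have i2: "integrable D (\<lambda>x. indicator A x * c x)"
    using i1 c0 t01 eqc by (auto simp: integrable_iff_bounded abs_mult)
  have eqc': "(\<integral>x. indicator A x * c x \<partial>D) = (\<integral>x. indicator A x * ((f x)\<^sup>2 * t x) \<partial>D)"
    using eqc c0 t01 by (subst (1 2) integral_eq_nn_integral) auto
  \<comment> \<open>The mixed term is dominated by the two square terms, since the quadratic in
    \<open>good\<close> is nonnegative at both \<open>d = f x\<close> and
    \<open>d = - f x\<close>.\<close>
  have i3: "integrable D (\<lambda>x. indicator A x * (f x * b x))"
  proof (rule Bochner_Integration.integrable_bound)
    show "integrable D (\<lambda>x. indicator A x * ((f x)\<^sup>2 * t x) + indicator A x * c x)"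
      using i1 i2 by simp
    show "AE x in D. norm (indicator A x * (f x * b x)) \<le> norm (indicator A x * ((f x)\<^sup>2 * t x) + indicator A x * c x)"
      using good
    proof (rule AE_mp, intro AE_I2 impI)
      fix x assume x: "x \<in> space D" and *: "\<forall>d. (\<integral>\<^sup>+y. indicator A y * ennreal ((f y - d)\<^sup>2) \<partial>K x)
        = ennreal (c x - 2 * d * b x + d\<^sup>2 * t x) \<and> 0 \<le> c x - 2 * d * b x + d\<^sup>2 * t x"
      have "0 \<le> c x - 2 * f x * b x + (f x)\<^sup>2 * t x" "0 \<le> c x + 2 * f x * b x + (f x)\<^sup>2 * t x"
        using *[rule_format, of "f x"] *[rule_format, of "- f x"] by auto
      then have "\<bar>f x * b x\<bar> \<le> (f x)\<^sup>2 * t x + c x"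
        using c0[of x] t01(1)[of x] mult_nonneg_nonneg[of "(f x)\<^sup>2" "t x"] by (auto simp: abs_le_iff)
      then show "norm (indicator A x * (f x * b x)) \<le> norm (indicator A x * ((f x)\<^sup>2 * t x) + indicator A x * c x)"
        by (auto simp: indicator_def abs_mult)
    qed
  qed measurable
  have h: "h = (\<lambda>x. indicator A x * ((f x)\<^sup>2 * t x) - indicator A x * (f x * b x))"
    by (auto simp: h_def t_def b_def power2_eq_square algebra_simps)
  have pos: "AE x in D. 0 \<le> indicator A x * c x - 2 * (indicator A x * (f x * b x)) + indicator A x * ((f x)\<^sup>2 * t x)"
    using good
  proof eventually_elim
    case (elim x)
    show ?case using conjunct2[OF elim[rule_format, of "f x"]] by (simp add: indicator_def)
  qed
  have "jump A f = (\<integral>\<^sup>+x. ennreal (indicator A x * (c x - 2 * f x * b x + (f x)\<^sup>2 * t x)) \<partial>D)"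
    unfolding jump_def
    unfolding ennreal_indicator_mult[symmetric]
  proof (rule nn_integral_cong_AE, use good in eventually_elim)
    case (elim x)
    show ?case using conjunct1[OF elim[rule_format, of "f x"]] by (simp only: power2_commute)
  qed
  also have "\<dots> = (\<integral>\<^sup>+x. ennreal (indicator A x * c x - 2 * (indicator A x * (f x * b x)) + indicator A x * ((f x)\<^sup>2 * t x)) \<partial>D)"
    by (intro nn_integral_cong arg_cong[where f=ennreal]) (simp add: algebra_simps)
  also have "\<dots> = ennreal (\<integral>x. indicator A x * c x - 2 * (indicator A x * (f x * b x)) + indicator A x * ((f x)\<^sup>2 * t x) \<partial>D)"
    using i1 i2 i3 pos by (intro nn_integral_eq_integral) auto
  also have eq: "(\<integral>x. indicator A x * c x - 2 * (indicator A x * (f x * b x)) + indicator A x * ((f x)\<^sup>2 * t x) \<partial>D)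
      = 2 * (\<integral>x. h x \<partial>D)"
    unfolding h using i1 i2 i3 eqc' by simp
  finally show "jump A f = ennreal (2 * (\<integral>x. h x \<partial>D))" .
  have "0 \<le> (\<integral>x. indicator A x * c x - 2 * (indicator A x * (f x * b x)) + indicator A x * ((f x)\<^sup>2 * t x) \<partial>D)"
    using pos by (rule integral_nonneg_AE)
  then show "0 \<le> (\<integral>x. h x \<partial>D)" unfolding eq by simp
qed

text \<open>After \<open>square_diff_le\<close>, invariance of the law makes the two square terms
  equal. This comparison of the form with the norm yields the bound 2 on the gaps and the
  perturbation estimate for coordinate forms.\<close>

lemma jump_le:
  assumes [measurable]: "f \<in> borel_measurable D" "A \<in> sets D"
  shows "jump A f \<le> 4 * (\<integral>\<^sup>+x. indicator A x * ennreal ((f x)\<^sup>2) \<partial>D)"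
proof -
  let ?g = "\<lambda>x. indicator A x * ennreal ((f x)\<^sup>2)"
  have "jump A f \<le> (\<integral>\<^sup>+x. (\<integral>\<^sup>+y. 2 * ?g x + 2 * ?g y \<partial>K x) \<partial>D)"
    unfolding jump_def
  proof (intro nn_integral_mono)
    fix x
    have "ennreal ((f x - f y)\<^sup>2) \<le> 2 * ennreal ((f x)\<^sup>2) + 2 * ennreal ((f y)\<^sup>2)" for y
      using square_diff_le[of "f x" "f y"]
      by (simp add: ennreal_plus[symmetric] ennreal_mult''[symmetric] ennreal_numeral[symmetric]
          del: ennreal_plus ennreal_numeral)
    then show "indicator A x * (\<integral>\<^sup>+y. indicator A y * ennreal ((f x - f y)\<^sup>2) \<partial>K x) \<le> (\<integral>\<^sup>+y. 2 * ?g x + 2 * ?g y \<partial>K x)"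
      by (auto intro!: nn_integral_mono simp: indicator_def)
  qed
  also have "\<dots> = (\<integral>\<^sup>+x. 2 * ?g x + (\<integral>\<^sup>+y. 2 * ?g y \<partial>K x) \<partial>D)"
  proof (intro nn_integral_cong)
    fix x assume x: "x \<in> space D"
    interpret P: prob_space "K x" using x by (rule prob_K)
    have [measurable]: "f \<in> borel_measurable (K x)" "A \<in> sets (K x)" using x assms by (auto simp: measurable_K sets_K)
    show "(\<integral>\<^sup>+y. 2 * ?g x + 2 * ?g y \<partial>K x) = 2 * ?g x + (\<integral>\<^sup>+y. 2 * ?g y \<partial>K x)"
      by (subst nn_integral_add) (auto simp: P.emeasure_space_1)
  qed
  also have "\<dots> = 2 * (\<integral>\<^sup>+x. ?g x \<partial>D) + (\<integral>\<^sup>+x. \<integral>\<^sup>+y. 2 * ?g y \<partial>K x \<partial>D)"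
    by (subst nn_integral_add) (auto simp: nn_integral_cmult)
  also have "(\<integral>\<^sup>+x. \<integral>\<^sup>+y. 2 * ?g y \<partial>K x \<partial>D) = 2 * (\<integral>\<^sup>+x. ?g x \<partial>D)"
    by (subst kernel_invariant) (auto simp: nn_integral_cmult)
  finally show ?thesis by (simp add: distrib_right[symmetric])
qed

definition energy :: "('a \<Rightarrow> real) \<Rightarrow> ennreal" where
  "energy f = (\<integral>\<^sup>+x. (\<integral>\<^sup>+y. ennreal ((f x - f y)\<^sup>2) \<partial>K x) \<partial>D)"

lemma energy_eq_jump: "energy f = jump (space D) f"
  unfolding energy_def jump_def by (intro nn_integral_cong) (auto simp: space_K intro!: nn_integral_cong)

lemma
  assumes f: "f \<in> L2fun D"
  shows energy_eq: "energy f = ennreal (2 * dirichlet D (kop K) f)"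
    and dirichlet_nonneg: "0 \<le> dirichlet D (kop K) f"
proof -
  have *: "indicator (space D) x * (f x * (f x * measure (K x) (space D) - (\<integral>y. indicator (space D) y * f y \<partial>K x)))
      = f x * (f x - kop K f x)" if x: "x \<in> space D" for x
  proof -
    interpret P: prob_space "K x" using x by (rule prob_K)
    have "(\<integral>y. indicator (space D) y * f y \<partial>K x) = kop K f x"
      unfolding kop_def using x by (intro Bochner_Integration.integral_cong) (auto simp: space_K)
    then show ?thesis using P.prob_space x by (simp add: space_K)
  qed
  show "energy f = ennreal (2 * dirichlet D (kop K) f)"
    unfolding energy_eq_jump jump_eq[OF f sets.top] dirichlet_def inner_mu_def
    by (simp only: Bochner_Integration.integral_cong[OF refl *])
  show "0 \<le> dirichlet D (kop K) f"
    using restricted_form_nonneg[OF f sets.top] unfolding dirichlet_def inner_mu_def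
    by (simp only: Bochner_Integration.integral_cong[OF refl *])
qed

section \<open>Conditional laws and restricted kernels\<close>

abbreviation cond :: "'a set \<Rightarrow> 'a measure" where
  "cond A \<equiv> density D (\<lambda>x. ennreal (indicator A x / measure D A))"

lemma integral_cond:
  fixes g :: "'a \<Rightarrow> real"
  assumes [measurable]: "A \<in> sets D" "g \<in> borel_measurable D"
  shows "(\<integral>x. g x \<partial>cond A) = (\<integral>x. indicator A x * g x \<partial>D) / measure D A"
  by (subst integral_density) (auto simp: measure_nonneg)

text \<open>Membership in \<open>L2fun (cond A)\<close> says nothing about the size of
  \<open>f\<close> off \<open>A\<close>; arguments under \<open>D\<close> therefore go through the
  truncation.\<close>

lemma L2fun_cond:
  assumes A[measurable]: "A \<in> sets D" and pos: "measure D A > 0" and f: "f \<in> L2fun (cond A)"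
  shows "(\<lambda>x. indicator A x * f x) \<in> L2fun D"
proof -
  have [measurable]: "f \<in> borel_measurable D" using f by (simp add: L2fun_def)
  have "integrable (cond A) (\<lambda>x. (f x)\<^sup>2)" using f by (simp add: L2fun_def)
  then have "integrable D (\<lambda>x. (indicator A x / measure D A) *\<^sub>R (f x)\<^sup>2)"
    by (subst (asm) integrable_density) (auto simp: measure_nonneg)
  then have "integrable D (\<lambda>x. measure D A * ((indicator A x / measure D A) *\<^sub>R (f x)\<^sup>2))"
    by (intro integrable_mult_right)
  also have "(\<lambda>x. measure D A * ((indicator A x / measure D A) *\<^sub>R (f x)\<^sup>2)) = (\<lambda>x. (indicator A x * f x)\<^sup>2)"
    using pos by (auto simp: indicator_def)
  finally show ?thesis by (auto simp: L2fun_def)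
qed

lemma cond_L2fun:
  assumes A[measurable]: "A \<in> sets D" and pos: "measure D A > 0" and f: "f \<in> L2fun D"
  shows "f \<in> L2fun (cond A)"
proof -
  have [measurable]: "f \<in> borel_measurable D" using f by (simp add: L2fun_def)
  have "integrable D (\<lambda>x. indicator A x *\<^sub>R (f x)\<^sup>2)"
    using f by (intro integrable_mult_indicator) (auto simp: L2fun_def)
  then have "integrable D (\<lambda>x. (indicator A x / measure D A) *\<^sub>R (f x)\<^sup>2)"
    by simp
  then show ?thesis by (simp add: L2fun_def integrable_density measure_nonneg)
qed

lemma var_cond:
  assumes A[measurable]: "A \<in> sets D" and pos: "measure D A > 0" and f: "f \<in> L2fun (cond A)"
  shows "ennreal (measure D A * var_mu (cond A) f)
      = (\<integral>\<^sup>+x. indicator A x * ennreal ((f x - (\<integral>x. indicator A x * f x \<partial>D) / measure D A)\<^sup>2) \<partial>D)"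
    and var_cond_nonneg: "0 \<le> var_mu (cond A) f"
proof -
  have [measurable]: "f \<in> borel_measurable D" using f by (simp add: L2fun_def)
  let ?m = "(\<integral>x. indicator A x * f x \<partial>D) / measure D A"
  let ?g = "\<lambda>x. indicator A x * f x"
  have g: "?g \<in> L2fun D" by (rule L2fun_cond[OF assms])
  have ii: "indicator A x * (indicator A x * f x) = indicator A x * f x"
    "indicator A x * (indicator A x * f x)\<^sup>2 = indicator A x * (f x)\<^sup>2"
    "indicator A x * (indicator A x * f x - c)\<^sup>2 = indicator A x * (f x - c)\<^sup>2" for x c
    by (auto simp: indicator_def)
  have eq: "(\<integral>x. indicator A x * (f x - ?m)\<^sup>2 \<partial>D) = measure D A * var_mu (cond A) f"
    using integral_square_shift(2)[OF g A, of ?m] pos unfolding ii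
    by (simp add: var_mu_def inner_mu_def integral_cond power2_eq_square field_simps)
  have "(\<integral>\<^sup>+x. indicator A x * ennreal ((f x - ?m)\<^sup>2) \<partial>D) = ennreal (\<integral>x. indicator A x * (f x - ?m)\<^sup>2 \<partial>D)"
    using integral_square_shift(1)[OF g A, of ?m] unfolding ii ennreal_indicator_mult
    by (intro nn_integral_eq_integral) auto
  then show "ennreal (measure D A * var_mu (cond A) f)
      = (\<integral>\<^sup>+x. indicator A x * ennreal ((f x - ?m)\<^sup>2) \<partial>D)"
    unfolding eq ..
  have "0 \<le> (\<integral>x. indicator A x * (f x - ?m)\<^sup>2 \<partial>D)" by simp
  then show "0 \<le> var_mu (cond A) f" unfolding eq using pos by (simp add: zero_le_mult_iff)
qed

text \<open>The holding term of the restriction compensates the escaping mass: on \<open>A\<close>,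
  the difference of \<open>f x\<close> and \<open>restr_op K A f x\<close> is
  \<open>f x * measure (K x) A\<close> minus the integral of \<open>f\<close> over \<open>A\<close>
  under \<open>K x\<close>, the expression treated by \<open>jump_eq\<close>. For the upper bound,
  \<open>jump\<close> ignores constants, so \<open>jump_le\<close> may be applied to the centred
  function.\<close>

lemma dirichlet_cond:
  assumes A[measurable]: "A \<in> sets D" and pos: "measure D A > 0" and f: "f \<in> L2fun (cond A)"
  shows "jump A f = ennreal (2 * (measure D A * dirichlet (cond A) (restr_op K A) f))"
    and dirichlet_cond_nonneg: "0 \<le> dirichlet (cond A) (restr_op K A) f"
    and dirichlet_cond_le: "dirichlet (cond A) (restr_op K A) f \<le> 2 * var_mu (cond A) f"
proof -
  have [measurable]: "f \<in> borel_measurable D" using f by (simp add: L2fun_def)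
  let ?g = "\<lambda>x. indicator A x * f x"
  have g: "?g \<in> L2fun D" by (rule L2fun_cond[OF assms])
  have [measurable]: "(\<lambda>x. measure (K x) A) \<in> borel_measurable D"
    by (rule measurable_compose[OF kernel measurable_measure_prob_algebra]) fact
  have [measurable]: "(\<lambda>x. \<integral>y. indicator A y * f y \<partial>K x) \<in> borel_measurable D"
    by (intro borel_measurable_kernel_integral[OF _ kernel]) measurable
  have *: "indicator A x * (?g x * (?g x * measure (K x) A - (\<integral>y. indicator A y * ?g y \<partial>K x)))
      = indicator A x * (f x * (f x - restr_op K A f x))" if x: "x \<in> space D" for x
  proof -
    interpret P: prob_space "K x" using x by (rule prob_K)
    have c: "measure (K x) (space (K x) - A) = 1 - measure (K x) A"
      using x by (intro P.prob_compl) (simp add: sets_K)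
    have i: "(\<integral>y. indicator A y * ?g y \<partial>K x) = (\<integral>y. indicator A y * f y \<partial>K x)"
      by (intro Bochner_Integration.integral_cong) (auto simp: indicator_def)
    show ?thesis
      unfolding restr_op_def c i by (cases "x \<in> A") (simp_all add: algebra_simps)
  qed
  have restr[measurable]: "restr_op K A f \<in> borel_measurable D"
  proof -
    have "restr_op K A f x = (\<integral>y. indicator A y * f y \<partial>K x) + f x * (1 - measure (K x) A)" if x: "x \<in> space D" for x
    proof -
      interpret P: prob_space "K x" using x by (rule prob_K)
      have "measure (K x) (space (K x) - A) = 1 - measure (K x) A"
        using x by (intro P.prob_compl) (simp add: sets_K)
      then show ?thesis by (simp add: restr_op_def)
    qed
    then show ?thesis by (subst measurable_cong) measurable
  qed
  have eq: "(\<integral>x. indicator A x * (?g x * (?g x * measure (K x) A - (\<integral>y. indicator A y * ?g y \<partial>K x))) \<partial>D)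
      = measure D A * dirichlet (cond A) (restr_op K A) f"
    using pos by (simp add: * dirichlet_def inner_mu_def integral_cond cong: Bochner_Integration.integral_cong)
  have jg: "jump A ?g = jump A f"
    unfolding jump_def
  proof (intro nn_integral_cong)
    fix x
    show "indicator A x * (\<integral>\<^sup>+y. indicator A y * ennreal ((?g x - ?g y)\<^sup>2) \<partial>K x)
        = indicator A x * (\<integral>\<^sup>+y. indicator A y * ennreal ((f x - f y)\<^sup>2) \<partial>K x)"
      by (cases "x \<in> A") (auto intro!: nn_integral_cong simp: indicator_def)
  qed
  show j: "jump A f = ennreal (2 * (measure D A * dirichlet (cond A) (restr_op K A) f))"
    using jump_eq[OF g A] unfolding jg eq .
  show nn: "0 \<le> dirichlet (cond A) (restr_op K A) f"
    using restricted_form_nonneg[OF g A] pos unfolding eq by (simp add: zero_le_mult_iff)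
  let ?m = "(\<integral>x. indicator A x * f x \<partial>D) / measure D A"
  have "jump A f = jump A (\<lambda>x. f x - ?m)" by (simp add: jump_def)
  also have "\<dots> \<le> 4 * ennreal (measure D A * var_mu (cond A) f)"
    unfolding var_cond[OF assms] by (rule jump_le) measurable
  also have "\<dots> = ennreal (4 * (measure D A * var_mu (cond A) f))"
    by (simp add: ennreal_mult' )
  finally have "2 * (measure D A * dirichlet (cond A) (restr_op K A) f) \<le> 4 * (measure D A * var_mu (cond A) f)"
    unfolding j using var_cond_nonneg[OF assms] pos by (subst (asm) ennreal_le_iff) auto
  then have "measure D A * dirichlet (cond A) (restr_op K A) f \<le> measure D A * (2 * var_mu (cond A) f)"
    by simp
  then show "dirichlet (cond A) (restr_op K A) f \<le> 2 * var_mu (cond A) f"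
    using pos by simp
qed

end

text \<open>The bound by \<open>2 * var_mu\<close> serves twice: together with nonnegativity of the
  form it makes the variance nonnegative, and it keeps the gap below 2. The value 1 given to a space
  without positive variances respects the same bounds.\<close>

lemma
  assumes "\<And>f. f \<in> L2fun M \<Longrightarrow> 0 \<le> dirichlet M P f"
    and "\<And>f. f \<in> L2fun M \<Longrightarrow> dirichlet M P f \<le> 2 * var_mu M f"
  shows gap_nonneg: "0 \<le> gap M P"
    and gap_le_2: "gap M P \<le> 2"
    and gap_times_var: "f \<in> L2fun M \<Longrightarrow> gap M P * var_mu M f \<le> dirichlet M P f"
proof -
  let ?S = "{dirichlet M P f / var_mu M f | f. f \<in> L2fun M \<and> var_mu M f > 0}"
  have bdd: "bdd_below ?S"
    using assms(1) by (intro bdd_belowI[of _ 0]) auto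
  show "0 \<le> gap M P" using assms(1) by (auto simp: gap_def intro!: cInf_greatest)
  have low: "gap M P \<le> dirichlet M P f / var_mu M f" if "f \<in> L2fun M" "var_mu M f > 0" for f
    using that bdd by (auto simp: gap_def intro!: cInf_lower)
  show "gap M P \<le> 2"
  proof (cases "\<exists>f\<in>L2fun M. var_mu M f > 0")
    case True
    then obtain f where f: "f \<in> L2fun M" "var_mu M f > 0" by auto
    have "gap M P \<le> dirichlet M P f / var_mu M f" by (rule low) fact+
    also have "\<dots> \<le> 2" using assms(2)[OF f(1)] f(2) by (simp add: divide_le_eq)
    finally show ?thesis .
  qed (simp add: gap_def)
  show "gap M P * var_mu M f \<le> dirichlet M P f" if f: "f \<in> L2fun M"
  proof -
    have "0 \<le> var_mu M f" using assms(1,2)[OF f] by simp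
    then show ?thesis
      using assms(1)[OF f] low[OF f] by (cases "var_mu M f = 0") (auto simp: pos_le_divide_eq)
  qed
qed

text \<open>The condition \<open>c \<le> 1\<close> takes care of the value 1 that \<open>gap\<close>
  has when no function has positive variance.\<close>

lemma gap_geI:
  assumes "c \<le> 1" "\<And>f. f \<in> L2fun Q \<Longrightarrow> var_mu Q f > 0 \<Longrightarrow> c * var_mu Q f \<le> dirichlet Q P f"
  shows "c \<le> gap Q P"
  unfolding gap_def using assms by (auto intro!: cInf_greatest simp: pos_le_divide_eq)

subsection \<open>Cells of a partition\<close>

context reversible_kernel begin

lemma dirichlet_le:
  assumes f: "f \<in> L2fun D"
  shows "dirichlet D (kop K) f \<le> 2 * var_mu D f"
proof -
  have [measurable]: "f \<in> borel_measurable D" using f by (simp add: L2fun_def)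
  let ?m = "\<integral>x. f x \<partial>D"
  have ind: "(\<integral>x. indicator (space D) x * g x \<partial>D) = (\<integral>x. g x \<partial>D)" for g :: "'a \<Rightarrow> real"
    by (intro Bochner_Integration.integral_cong) auto
  have var: "(\<integral>\<^sup>+x. indicator (space D) x * ennreal ((f x - ?m)\<^sup>2) \<partial>D) = ennreal (var_mu D f)"
    unfolding nn_integral_square_shift[OF f sets.top, of ?m] ind
    by (simp add: var_mu_def inner_mu_def power2_eq_square prob_space)
  have "0 \<le> (\<integral>x. indicator (space D) x * (f x - ?m)\<^sup>2 \<partial>D)" by simp
  then have var0: "0 \<le> var_mu D f"
    unfolding integral_square_shift(2)[OF f sets.top, of ?m] ind
    by (simp add: var_mu_def inner_mu_def power2_eq_square prob_space)
  have "energy f = energy (\<lambda>x. f x - ?m)" by (simp add: energy_def)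
  also have "\<dots> \<le> 4 * ennreal (var_mu D f)"
    unfolding energy_eq_jump var[symmetric] by (rule jump_le) measurable
  also have "\<dots> = ennreal (4 * var_mu D f)" by (simp add: ennreal_mult')
  finally show ?thesis
    using var0 by (simp add: energy_eq[OF f])
qed

end

locale cell_partition = prob_space D
  for D :: "'a measure" and A :: "nat \<Rightarrow> 'a set" and J :: nat +
  assumes cell_meas[measurable]: "\<And>j. j \<in> {1..J} \<Longrightarrow> A j \<in> sets D"
    and cell_disj: "\<And>i j. i \<in> {1..J} \<Longrightarrow> j \<in> {1..J} \<Longrightarrow> i \<noteq> j \<Longrightarrow> A i \<inter> A j = {}"
    and cell_cover: "(\<Union>j\<in>{1..J}. A j) = space D"
    and cell_pos: "\<And>j. j \<in> {1..J} \<Longrightarrow> measure D (A j) > 0"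
begin

definition avg :: "('a \<Rightarrow> real) \<Rightarrow> 'a \<Rightarrow> real" where
  "avg f x = (\<Sum>j\<in>{1..J}. indicator (A j) x * ((\<integral>y. indicator (A j) y * f y \<partial>D) / measure D (A j)))"

text \<open>Meaningful on the space only, where the partition makes the label unique. It depends on
  \<open>A\<close> and \<open>J\<close> but not on the law, so all levels share one
  labelling.\<close>

definition cell :: "'a \<Rightarrow> nat" where
  "cell x = (THE j. j \<in> {1..J} \<and> x \<in> A j)"

lemma cell_eq: "j \<in> {1..J} \<Longrightarrow> x \<in> A j \<Longrightarrow> cell x = j"
  unfolding cell_def using cell_disj by (intro the_equality) blast+

lemma
  assumes "x \<in> space D"
  shows cell_mem: "cell x \<in> {1..J}"
    and mem_cell: "x \<in> A (cell x)"
proof -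
  have "x \<in> (\<Union>j\<in>{1..J}. A j)" using assms by (simp only: cell_cover)
  then obtain j where j: "j \<in> {1..J}" "x \<in> A j" by (rule UN_E)
  show "cell x \<in> {1..J}" "x \<in> A (cell x)" unfolding cell_eq[OF j] by (fact j)+
qed

lemma indicator_cell: "j \<in> {1..J} \<Longrightarrow> x \<in> space D \<Longrightarrow> indicator (A j) x = (of_bool (j = cell x) :: 'b::zero_neq_one)"
  by (cases "x \<in> A j") (use cell_eq[of j x] mem_cell[of x] in \<open>force simp: indicator_def\<close>)+

lemma sum_indicator_cell:
  fixes g :: "nat \<Rightarrow> 'b::semiring_1"
  assumes "x \<in> space D"
  shows "(\<Sum>j\<in>{1..J}. indicator (A j) x * g j) = g (cell x)"
proof -
  have "(\<Sum>j\<in>{1..J}. indicator (A j) x * g j) = (\<Sum>j\<in>{1..J}. if j = cell x then g j else 0)"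
    by (intro sum.cong refl) (auto simp: indicator_cell[OF _ assms] simp del: atLeastAtMost_iff)
  then show ?thesis using cell_mem[OF assms] by simp
qed

lemma avg_cell: "x \<in> space D \<Longrightarrow> avg f x = (\<integral>y. indicator (A (cell x)) y * f y \<partial>D) / measure D (A (cell x))"
  unfolding avg_def by (rule sum_indicator_cell)

lemma measurable_cell[measurable]: "(\<lambda>x. g (cell x)) \<in> borel_measurable D"
  for g :: "nat \<Rightarrow> 'b::{second_countable_topology, real_normed_algebra_1}"
proof -
  have "(\<lambda>x. \<Sum>j\<in>{1..J}. indicator (A j) x * g j) \<in> borel_measurable D" by measurable
  then show ?thesis
    by (rule measurable_cong[THEN iffD1, rotated]) (simp only: sum_indicator_cell)
qed

lemma measurable_cell_ennreal[measurable]: "(\<lambda>x. g (cell x)) \<in> borel_measurable D" for g :: "nat \<Rightarrow> ennreal"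
proof -
  have "(\<lambda>x. \<Sum>j\<in>{1..J}. indicator (A j) x * g j) \<in> borel_measurable D" by measurable
  then show ?thesis
    by (rule measurable_cong[THEN iffD1, rotated]) (simp only: sum_indicator_cell)
qed

lemma nn_integral_split:
  assumes [measurable]: "g \<in> borel_measurable D"
  shows "(\<integral>\<^sup>+x. g x \<partial>D) = (\<Sum>j\<in>{1..J}. \<integral>\<^sup>+x. indicator (A j) x * g x \<partial>D)"
proof -
  have "(\<integral>\<^sup>+x. g x \<partial>D) = (\<integral>\<^sup>+x. (\<Sum>j\<in>{1..J}. indicator (A j) x * g x) \<partial>D)"
    by (intro nn_integral_cong) (simp only: sum_indicator_cell)
  also have "\<dots> = (\<Sum>j\<in>{1..J}. \<integral>\<^sup>+x. indicator (A j) x * g x \<partial>D)"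
    by (rule nn_integral_sum) measurable
  finally show ?thesis .
qed

lemma nn_integral_cell:
  fixes g :: "nat \<Rightarrow> ennreal"
  shows "(\<integral>\<^sup>+x. g (cell x) \<partial>D) = (\<Sum>j\<in>{1..J}. ennreal (measure D (A j)) * g j)"
proof -
  have "(\<integral>\<^sup>+x. g (cell x) \<partial>D) = (\<integral>\<^sup>+x. (\<Sum>j\<in>{1..J}. g j * indicator (A j) x) \<partial>D)"
    by (intro nn_integral_cong) (simp only: sum_indicator_cell mult.commute[of "g _"])
  also have "\<dots> = (\<Sum>j\<in>{1..J}. \<integral>\<^sup>+x. g j * indicator (A j) x \<partial>D)"
    by (rule nn_integral_sum) measurable
  also have "\<dots> = (\<Sum>j\<in>{1..J}. ennreal (measure D (A j)) * g j)"
    by (intro sum.cong refl) (simp add: nn_integral_cmult_indicator emeasure_eq_measure mult.commute del: atLeastAtMost_iff)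
  finally show ?thesis .
qed

lemma integral_cell:
  fixes g :: "nat \<Rightarrow> real"
  shows "(\<integral>x. g (cell x) \<partial>D) = (\<Sum>j\<in>{1..J}. measure D (A j) * g j)"
proof -
  have "(\<integral>x. g (cell x) \<partial>D) = (\<integral>x. (\<Sum>j\<in>{1..J}. indicator (A j) x * g j) \<partial>D)"
    by (intro Bochner_Integration.integral_cong) (simp_all only: sum_indicator_cell)
  also have "\<dots> = (\<Sum>j\<in>{1..J}. \<integral>x. indicator (A j) x * g j \<partial>D)"
    by (rule Bochner_Integration.integral_sum)
      (auto intro!: integrable_mult_left integrable_real_indicator simp: less_top[symmetric] simp del: atLeastAtMost_iff)
  also have "\<dots> = (\<Sum>j\<in>{1..J}. measure D (A j) * g j)"
  proof (intro sum.cong refl)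
    fix j assume "j \<in> {1..J}"
    then have "A j \<inter> space D = A j" by (intro Int_absorb2 sets.sets_into_space cell_meas)
    then show "(\<integral>x. indicator (A j) x * g j \<partial>D) = measure D (A j) * g j" by simp
  qed
  finally show ?thesis .
qed

text \<open>On each cell \<open>avg f - avg h\<close> is constant, hence orthogonal to
  \<open>f - avg f\<close>, and averaging is a contraction. Both terms have coefficient 1, so that
  iterating the inequality accumulates no constants.\<close>

lemma avg_pythagoras:
  assumes f: "f \<in> L2fun D" and h: "h \<in> L2fun D"
  shows "(\<integral>\<^sup>+x. ennreal ((f x - avg h x)\<^sup>2) \<partial>D)
     \<le> (\<integral>\<^sup>+x. ennreal ((f x - avg f x)\<^sup>2) \<partial>D) + (\<integral>\<^sup>+x. ennreal ((f x - h x)\<^sup>2) \<partial>D)"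
proof -
  have [measurable]: "f \<in> borel_measurable D" "h \<in> borel_measurable D" using f h by (auto simp: L2fun_def)
  have [measurable]: "avg g \<in> borel_measurable D" for g unfolding avg_def by measurable
  have cellwise: "(\<integral>\<^sup>+x. indicator (A j) x * ennreal ((f x - avg h x)\<^sup>2) \<partial>D)
     \<le> (\<integral>\<^sup>+x. indicator (A j) x * ennreal ((f x - avg f x)\<^sup>2) \<partial>D) + (\<integral>\<^sup>+x. indicator (A j) x * ennreal ((f x - h x)\<^sup>2) \<partial>D)"
    if j: "j \<in> {1..J}" for j
  proof -
    let ?B = "A j" and ?w = "measure D (A j)"
    have B[measurable]: "?B \<in> sets D" and w: "?w > 0" using j cell_meas cell_pos by auto
    have ibf: "integrable D (\<lambda>x. indicator ?B x * f x)" and ibh: "integrable D (\<lambda>x. indicator ?B x * h x)"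
      using integrable_mult_indicator[OF B L2fun_integrable[OF f]]
        integrable_mult_indicator[OF B L2fun_integrable[OF h]] by auto
    define F2 F H where "F2 = (\<integral>x. indicator ?B x * (f x)\<^sup>2 \<partial>D)"
      and "F = (\<integral>x. indicator ?B x * f x \<partial>D)" and "H = (\<integral>x. indicator ?B x * h x \<partial>D)"
    \<comment> \<open>Kept general in \<open>g\<close>, since it is needed both for
      \<open>avg f\<close> and for \<open>avg h\<close>.\<close>
    have eq: "(\<integral>\<^sup>+x. indicator ?B x * ennreal ((f x - avg g x)\<^sup>2) \<partial>D)
      = ennreal (F2 - 2 * (G / ?w) * F + (G / ?w)\<^sup>2 * ?w)" and
      nn: "0 \<le> F2 - 2 * (G / ?w) * F + (G / ?w)\<^sup>2 * ?w"
      if G: "G = (\<integral>x. indicator ?B x * g x \<partial>D)" for g G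
    proof -
      have "avg g x = G / ?w" if "x \<in> ?B" for x
        using that cell_eq[OF j that] sets.sets_into_space[OF B] avg_cell[of x g] G by auto
      then have "(\<integral>\<^sup>+x. indicator ?B x * ennreal ((f x - avg g x)\<^sup>2) \<partial>D)
          = (\<integral>\<^sup>+x. indicator ?B x * ennreal ((f x - G / ?w)\<^sup>2) \<partial>D)"
        by (intro nn_integral_cong) (auto simp: indicator_def)
      then show "(\<integral>\<^sup>+x. indicator ?B x * ennreal ((f x - avg g x)\<^sup>2) \<partial>D)
        = ennreal (F2 - 2 * (G / ?w) * F + (G / ?w)\<^sup>2 * ?w)"
        using nn_integral_square_shift[OF f B, of "G / ?w"] by (simp add: F2_def F_def)
      have "0 \<le> (\<integral>x. indicator ?B x * (f x - G / ?w)\<^sup>2 \<partial>D)" by simp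
      then show "0 \<le> F2 - 2 * (G / ?w) * F + (G / ?w)\<^sup>2 * ?w"
        using integral_square_shift(2)[OF f B, of "G / ?w"] by (simp add: F2_def F_def)
    qed
    have fh: "(\<lambda>x. f x - h x) \<in> L2fun D" using f h by (rule L2fun_diff)
    define E where "E = (\<integral>x. indicator ?B x * (f x - h x)\<^sup>2 \<partial>D)"
    have E: "(\<integral>\<^sup>+x. indicator ?B x * ennreal ((f x - h x)\<^sup>2) \<partial>D) = ennreal E"
      using nn_integral_square_shift[OF fh B, of 0] by (simp add: E_def)
    have FH: "(\<integral>x. indicator ?B x * (f x - h x) \<partial>D) = F - H"
      using ibf ibh by (simp add: F_def H_def right_diff_distrib)
    \<comment> \<open>Nonnegative variance of \<open>f - h\<close> on the cell: the contraction
      property of averaging.\<close>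
    have "0 \<le> (\<integral>x. indicator ?B x * (f x - h x - (F - H) / ?w)\<^sup>2 \<partial>D)" by simp
    then have "0 \<le> E - 2 * ((F - H) / ?w) * (F - H) + ((F - H) / ?w)\<^sup>2 * ?w"
      using integral_square_shift(2)[OF fh B, of "(F - H) / ?w"] by (simp add: E_def FH)
    also have "\<dots> = E - (F - H)\<^sup>2 / ?w"
      using w by (simp add: field_simps power2_eq_square)
    finally have "(F - H)\<^sup>2 / ?w \<le> E" by simp
    moreover have "F2 - 2 * (H / ?w) * F + (H / ?w)\<^sup>2 * ?w = (F2 - 2 * (F / ?w) * F + (F / ?w)\<^sup>2 * ?w) + (F - H)\<^sup>2 / ?w"
      using w by (simp add: field_simps power2_eq_square)
    moreover have "0 \<le> (F - H)\<^sup>2 / ?w" using w by simp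
    ultimately have le: "F2 - 2 * (H / ?w) * F + (H / ?w)\<^sup>2 * ?w \<le> (F2 - 2 * (F / ?w) * F + (F / ?w)\<^sup>2 * ?w) + E"
      by linarith
    have E0: "0 \<le> E" by (simp add: E_def)
    show ?thesis
      unfolding eq[OF F_def] eq[OF H_def] E ennreal_plus[OF nn[OF F_def] E0, symmetric]
      by (rule ennreal_leI) (rule le)
  qed
  show ?thesis
    by (subst (1 2 3) nn_integral_split) (auto simp: sum.distrib[symmetric] intro!: sum_mono cellwise simp del: atLeastAtMost_iff)
qed

end

section \<open>Local and projected Poincare inequalities\<close>

locale partitioned_kernel = reversible_kernel D K + cell_partition D A J
  for D :: "'a measure" and K A J
begin

text \<open>The inequalities of the single cells are added, and the jumps between different cells
  are dropped from the energy. The factor 2 is that between \<open>jump\<close> and the Dirichlet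
  form.\<close>

lemma poincare_cells:
  assumes f: "f \<in> L2fun D" and c: "c \<ge> 0"
    and gap: "\<And>j. j \<in> {1..J} \<Longrightarrow> c * var_mu (cond (A j)) f \<le> dirichlet (cond (A j)) (restr_op K (A j)) f"
  shows "ennreal (2 * c) * (\<integral>\<^sup>+x. ennreal ((f x - avg f x)\<^sup>2) \<partial>D) \<le> energy f"
proof -
  have [measurable]: "f \<in> borel_measurable D" using f by (auto simp: L2fun_def)
  have [measurable]: "avg g \<in> borel_measurable D" for g unfolding avg_def by measurable
  have "ennreal (2 * c) * (\<integral>\<^sup>+x. ennreal ((f x - avg f x)\<^sup>2) \<partial>D)
      = (\<Sum>j\<in>{1..J}. ennreal (2 * c) * (\<integral>\<^sup>+x. indicator (A j) x * ennreal ((f x - avg f x)\<^sup>2) \<partial>D))"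
    by (subst nn_integral_split) (auto simp: sum_distrib_left)
  also have "\<dots> \<le> (\<Sum>j\<in>{1..J}. jump (A j) f)"
  proof (intro sum_mono)
    fix j assume j: "j \<in> {1..J}"
    have w: "measure D (A j) > 0" by (rule cell_pos[OF j])
    have fc: "f \<in> L2fun (cond (A j))" using cond_L2fun[OF cell_meas[OF j] w f] .
    have "(\<integral>\<^sup>+x. indicator (A j) x * ennreal ((f x - avg f x)\<^sup>2) \<partial>D)
       = (\<integral>\<^sup>+x. indicator (A j) x * ennreal ((f x - (\<integral>x. indicator (A j) x * f x \<partial>D) / measure D (A j))\<^sup>2) \<partial>D)"
      using cell_eq[OF j] by (intro nn_integral_cong) (auto simp: avg_cell indicator_def simp del: atLeastAtMost_iff)
    also have "\<dots> = ennreal (measure D (A j) * var_mu (cond (A j)) f)"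
      using var_cond[OF cell_meas[OF j] w fc] by simp
    finally have "ennreal (2 * c) * (\<integral>\<^sup>+x. indicator (A j) x * ennreal ((f x - avg f x)\<^sup>2) \<partial>D)
       = ennreal (2 * c * (measure D (A j) * var_mu (cond (A j)) f))"
      using c by (simp add: ennreal_mult')
    also have "2 * c * (measure D (A j) * var_mu (cond (A j)) f) = 2 * (measure D (A j) * (c * var_mu (cond (A j)) f))"
      by simp
    also have "ennreal \<dots> \<le> ennreal (2 * (measure D (A j) * dirichlet (cond (A j)) (restr_op K (A j)) f))"
      using gap[OF j] w by (intro ennreal_leI mult_left_mono) auto
    also have "\<dots> = jump (A j) f" using dirichlet_cond[OF cell_meas[OF j] w fc] by simp
    finally show "ennreal (2 * c) * (\<integral>\<^sup>+x. indicator (A j) x * ennreal ((f x - avg f x)\<^sup>2) \<partial>D) \<le> jump (A j) f" .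
  qed
  also have "\<dots> = (\<integral>\<^sup>+x. (\<Sum>j\<in>{1..J}. indicator (A j) x * (\<integral>\<^sup>+y. indicator (A j) y * ennreal ((f x - f y)\<^sup>2) \<partial>K x)) \<partial>D)"
    unfolding jump_def
  proof (intro nn_integral_sum[symmetric])
    fix j assume "j \<in> {1..J}"
    note [measurable] = cell_meas[OF this]
    have [measurable]: "(\<lambda>x. \<integral>\<^sup>+y. indicator (A j) y * ennreal ((f x - f y)\<^sup>2) \<partial>K x) \<in> borel_measurable D"
      by (rule nn_integral_measurable_subprob_algebra2[where N=D]) measurable
    show "(\<lambda>x. indicator (A j) x * (\<integral>\<^sup>+y. indicator (A j) y * ennreal ((f x - f y)\<^sup>2) \<partial>K x)) \<in> borel_measurable D"
      by measurable
  qed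
  also have "\<dots> \<le> energy f"
    unfolding energy_def
  proof (intro nn_integral_mono)
    fix x assume x: "x \<in> space D"
    show "(\<Sum>j\<in>{1..J}. indicator (A j) x * (\<integral>\<^sup>+y. indicator (A j) y * ennreal ((f x - f y)\<^sup>2) \<partial>K x))
        \<le> (\<integral>\<^sup>+y. ennreal ((f x - f y)\<^sup>2) \<partial>K x)"
      unfolding sum_indicator_cell[OF x] by (intro nn_integral_mono) (auto simp: indicator_def)
  qed
  finally show ?thesis .
qed

abbreviation proj :: "nat \<Rightarrow> nat \<Rightarrow> real" where
  "proj i j \<equiv> (1 / measure D (A i)) * (\<integral>x. indicator (A i) x * measure (K x) (A j) \<partial>D)"

lemma cell_L2fun: "(\<lambda>x. g (cell x)) \<in> L2fun D" for g :: "nat \<Rightarrow> real"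
proof -
  have "\<bar>g (cell x)\<bar> \<le> Max ((\<lambda>j. \<bar>g j\<bar>) ` {1..J})" if "x \<in> space D" for x
    using cell_mem[OF that] by (intro Max_ge) auto
  then have "(g (cell x))\<^sup>2 \<le> (Max ((\<lambda>j. \<bar>g j\<bar>) ` {1..J}))\<^sup>2" if "x \<in> space D" for x
    using that by (intro abs_le_square_iff[THEN iffD1]) fastforce
  then show ?thesis
    unfolding L2fun_def
    by (auto intro!: integrable_const_bound[where B="(Max ((\<lambda>j. \<bar>g j\<bar>) ` {1..J}))\<^sup>2"])
qed

lemma fin_var_cell: "fin_var {1..J} (\<lambda>j. measure D (A j)) g = var_mu D (\<lambda>x. g (cell x))"
  unfolding fin_var_def fin_inner_def var_mu_def inner_mu_def
  using integral_cell[of "\<lambda>j. g j * g j"] integral_cell[of "\<lambda>j. g j * 1"] by (simp add: mult.assoc)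

text \<open>Multiplied by the mass of cell \<open>i\<close>, the entry \<open>proj i j\<close> is
  the flow from cell \<open>i\<close> to cell \<open>j\<close>; on functions constant on cells the
  projected chain and the kernel therefore have the same form.\<close>

lemma fin_dirichlet_cell:
  "fin_dirichlet {1..J} (\<lambda>j. measure D (A j)) proj g = dirichlet D (kop K) (\<lambda>x. g (cell x))"
proof -
  let ?t = "\<lambda>j x. measure (K x) (A j)"
  have tm: "?t j \<in> borel_measurable D" if "j \<in> {1..J}" for j
    by (rule measurable_compose[OF kernel measurable_measure_prob_algebra]) (rule cell_meas[OF that])
  have ti: "integrable D (\<lambda>x. indicator (A i) x * ?t j x)" if "i \<in> {1..J}" "j \<in> {1..J}" for i j
  proof (rule integrable_const_bound[of _ 1])
    show "(\<lambda>x. indicator (A i) x * ?t j x) \<in> borel_measurable D"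
      using tm[OF that(2)] cell_meas[OF that(1)] by measurable
    show "AE x in D. norm (indicator (A i) x * ?t j x) \<le> 1"
      by (intro AE_I2) (auto simp: indicator_def prob_space.prob_le_1[OF prob_K])
  qed
  have ii: "integrable D (indicator (A i) :: 'a \<Rightarrow> real)" if "i \<in> {1..J}" for i
    using cell_meas[OF that] by (intro integrable_real_indicator) (auto simp: less_top[symmetric])
  have kop: "kop K (\<lambda>x. g (cell x)) x = (\<Sum>j\<in>{1..J}. g j * ?t j x)" if x: "x \<in> space D" for x
  proof -
    interpret P: prob_space "K x" using x by (rule prob_K)
    have Am: "A j \<in> sets (K x)" if "j \<in> {1..J}" for j using cell_meas[OF that] sets_K[OF x] by simp
    have "kop K (\<lambda>x. g (cell x)) x = (\<integral>y. (\<Sum>j\<in>{1..J}. indicator (A j) y * g j) \<partial>K x)"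
      unfolding kop_def by (intro Bochner_Integration.integral_cong) (simp_all only: sum_indicator_cell space_K[OF x])
    also have "\<dots> = (\<Sum>j\<in>{1..J}. \<integral>y. indicator (A j) y * g j \<partial>K x)"
      using Am by (intro Bochner_Integration.integral_sum integrable_mult_left integrable_real_indicator)
        (auto simp: less_top[symmetric])
    also have "\<dots> = (\<Sum>j\<in>{1..J}. g j * ?t j x)"
    proof (intro sum.cong refl)
      fix j assume "j \<in> {1..J}"
      then have "A j \<inter> space (K x) = A j" by (intro Int_absorb2 sets.sets_into_space Am)
      then show "(\<integral>y. indicator (A j) y * g j \<partial>K x) = g j * ?t j x" by simp
    qed
    finally show ?thesis .
  qed
  have "dirichlet D (kop K) (\<lambda>x. g (cell x))
     = (\<integral>x. (\<Sum>i\<in>{1..J}. indicator (A i) x * (g i * (g i - (\<Sum>j\<in>{1..J}. g j * ?t j x)))) \<partial>D)"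
    unfolding dirichlet_def inner_mu_def
    by (intro Bochner_Integration.integral_cong) (simp_all only: sum_indicator_cell kop)
  also have "\<dots> = (\<integral>x. (\<Sum>i\<in>{1..J}. g i * g i * indicator (A i) x - (\<Sum>j\<in>{1..J}. g i * g j * (indicator (A i) x * ?t j x))) \<partial>D)"
    by (intro Bochner_Integration.integral_cong refl sum.cong)
      (simp add: algebra_simps sum_distrib_left)
  also have "\<dots> = (\<Sum>i\<in>{1..J}. g i * g i * measure D (A i) - (\<Sum>j\<in>{1..J}. g i * g j * (\<integral>x. indicator (A i) x * ?t j x \<partial>D)))"
  proof (subst Bochner_Integration.integral_sum)
    fix i assume i: "i \<in> {1..J}"
    show "integrable D (\<lambda>x. g i * g i * indicator (A i) x - (\<Sum>j\<in>{1..J}. g i * g j * (indicator (A i) x * ?t j x)))"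
      using ii[OF i] ti[OF i]
      by (intro Bochner_Integration.integrable_diff Bochner_Integration.integrable_sum integrable_mult_right) auto
  next
    show "(\<Sum>i\<in>{1..J}. \<integral>x. g i * g i * indicator (A i) x - (\<Sum>j\<in>{1..J}. g i * g j * (indicator (A i) x * ?t j x)) \<partial>D)
      = (\<Sum>i\<in>{1..J}. g i * g i * measure D (A i) - (\<Sum>j\<in>{1..J}. g i * g j * (\<integral>x. indicator (A i) x * ?t j x \<partial>D)))"
    proof (intro sum.cong refl)
      fix i assume i: "i \<in> {1..J}"
      have sub: "A i \<inter> space D = A i" using cell_meas[OF i] by (intro Int_absorb2 sets.sets_into_space)
      have "(\<integral>x. g i * g i * indicator (A i) x - (\<Sum>j\<in>{1..J}. g i * g j * (indicator (A i) x * ?t j x)) \<partial>D)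
        = (\<integral>x. g i * g i * indicator (A i) x \<partial>D) - (\<integral>x. (\<Sum>j\<in>{1..J}. g i * g j * (indicator (A i) x * ?t j x)) \<partial>D)"
        using ii[OF i] ti[OF i]
        by (intro Bochner_Integration.integral_diff Bochner_Integration.integrable_sum integrable_mult_right) auto
      also have "(\<integral>x. (\<Sum>j\<in>{1..J}. g i * g j * (indicator (A i) x * ?t j x)) \<partial>D)
        = (\<Sum>j\<in>{1..J}. \<integral>x. g i * g j * (indicator (A i) x * ?t j x) \<partial>D)"
        using ti[OF i] by (intro Bochner_Integration.integral_sum integrable_mult_right) auto
      finally show "(\<integral>x. g i * g i * indicator (A i) x - (\<Sum>j\<in>{1..J}. g i * g j * (indicator (A i) x * ?t j x)) \<partial>D)
        = g i * g i * measure D (A i) - (\<Sum>j\<in>{1..J}. g i * g j * (\<integral>x. indicator (A i) x * ?t j x \<partial>D))"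
        by (simp only: integral_mult_right_zero Bochner_Integration.integral_indicator sub)
    qed
  qed
  also have "\<dots> = fin_dirichlet {1..J} (\<lambda>j. measure D (A j)) proj g"
    unfolding fin_dirichlet_def fin_inner_def
  proof (intro sum.cong refl)
    fix i assume i: "i \<in> {1..J}"
    have "measure D (A i) * (\<Sum>j\<in>{1..J}. proj i j * g j) = (\<Sum>j\<in>{1..J}. g j * (\<integral>x. indicator (A i) x * ?t j x \<partial>D))"
      unfolding sum_distrib_left using cell_pos[OF i] by (intro sum.cong refl) simp
    moreover have "(\<Sum>j\<in>{1..J}. g i * g j * (\<integral>x. indicator (A i) x * ?t j x \<partial>D))
      = g i * (\<Sum>j\<in>{1..J}. g j * (\<integral>x. indicator (A i) x * ?t j x \<partial>D))"
      by (simp only: sum_distrib_left mult.assoc)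
    ultimately have "(\<Sum>j\<in>{1..J}. g i * g j * (\<integral>x. indicator (A i) x * ?t j x \<partial>D))
      = g i * (measure D (A i) * (\<Sum>j\<in>{1..J}. proj i j * g j))" by (simp only:)
    then show "g i * g i * measure D (A i) - (\<Sum>j\<in>{1..J}. g i * g j * (\<integral>x. indicator (A i) x * ?t j x \<partial>D))
      = measure D (A i) * g i * (g i - (\<Sum>j\<in>{1..J}. proj i j * g j))"
      by (simp only:) (simp only: right_diff_distrib mult_ac)
  qed
  finally show ?thesis ..
qed

text \<open>Variance and form are carried over to \<open>D\<close> by the two preceding identities,
  after which the reasoning is that for \<open>gap\<close>.\<close>

lemma
  defines "c \<equiv> gap_fin {1..J} (\<lambda>j. measure D (A j)) proj"
  shows gap_fin_nonneg: "0 \<le> c"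
    and gap_fin_le_2: "c \<le> 2"
    and gap_fin_times_var: "c * fin_var {1..J} (\<lambda>j. measure D (A j)) g \<le> dirichlet D (kop K) (\<lambda>x. g (cell x))"
proof -
  let ?V = "\<lambda>g. fin_var {1..J} (\<lambda>j. measure D (A j)) g" and ?E = "\<lambda>g. fin_dirichlet {1..J} (\<lambda>j. measure D (A j)) proj g"
  let ?S = "{?E f / ?V f | f. ?V f > 0}"
  have E: "0 \<le> ?E f" "?E f \<le> 2 * ?V f" for f
    unfolding fin_var_cell fin_dirichlet_cell by (intro dirichlet_nonneg dirichlet_le cell_L2fun)+
  have bdd: "bdd_below ?S" using E(1) by (intro bdd_belowI[of _ 0]) auto
  show "0 \<le> c" using E(1) by (auto simp: c_def gap_fin_def intro!: cInf_greatest)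
  have low: "c \<le> ?E f / ?V f" if "?V f > 0" for f
    using that bdd by (auto simp: c_def gap_fin_def intro!: cInf_lower)
  show "c \<le> 2"
  proof (cases "\<exists>f. ?V f > 0")
    case True
    then obtain f where f: "?V f > 0" by auto
    have "c \<le> ?E f / ?V f" by (rule low) fact
    also have "\<dots> \<le> 2" using E(2)[of f] f by (simp add: divide_le_eq)
    finally show ?thesis .
  qed (simp add: gap_fin_def c_def)
  have "0 \<le> ?V g" using E[of g] by simp
  then show "c * ?V g \<le> dirichlet D (kop K) (\<lambda>x. g (cell x))"
    unfolding fin_dirichlet_cell[symmetric]
    using E(1)[of g] low[of g] by (cases "?V g = 0") (auto simp: pos_le_divide_eq)
qed

text \<open>Both sides carry the same factor 2: the double sum is twice the variance, and
  \<open>energy\<close> twice the Dirichlet form.\<close>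

lemma gap_fin_energy:
  "ennreal (gap_fin {1..J} (\<lambda>j. measure D (A j)) proj)
     * (\<Sum>i\<in>{1..J}. \<Sum>j\<in>{1..J}. ennreal (measure D (A i) * measure D (A j) * (g i - g j)\<^sup>2))
   \<le> energy (\<lambda>x. g (cell x))"
proof -
  let ?w = "\<lambda>j. measure D (A j)"
  have w1: "(\<Sum>j\<in>{1..J}. ?w j) = 1" using integral_cell[of "\<lambda>_. 1"] by (simp add: prob_space)
  have eq: "?w i * ?w j * (g i - g j)\<^sup>2 = ?w i * (g i * g i) * ?w j - 2 * (?w i * g i) * (?w j * g j) + ?w i * (?w j * (g j * g j))" for i j
    by (simp add: power2_eq_square algebra_simps)
  have "(\<Sum>i\<in>{1..J}. \<Sum>j\<in>{1..J}. ?w i * ?w j * (g i - g j)\<^sup>2) = 2 * fin_var {1..J} ?w g"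
    unfolding eq sum.distrib sum_subtractf sum_distrib_left[symmetric] w1 sum_distrib_right[symmetric]
    by (simp add: fin_var_def fin_inner_def power2_eq_square mult.assoc)
  moreover have "(\<Sum>i\<in>{1..J}. \<Sum>j\<in>{1..J}. ennreal (?w i * ?w j * (g i - g j)\<^sup>2))
      = ennreal (\<Sum>i\<in>{1..J}. \<Sum>j\<in>{1..J}. ?w i * ?w j * (g i - g j)\<^sup>2)"
    by (simp add: sum_ennreal sum_nonneg)
  ultimately show ?thesis
    using gap_fin_times_var[of g] gap_fin_nonneg
    by (simp add: energy_eq[OF cell_L2fun] ennreal_mult'[symmetric] ennreal_leI mult.left_commute)
qed

end

subsection \<open>Product spaces\<close>

text \<open>The laws of the coordinates may differ but live on one sigma-algebra, so that
  coordinates can be exchanged. The family runs over all naturals to make the one-coordinate theory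
  available as \<open>Co\<close> for every \<open>k\<close>.\<close>

locale product_chain =
  fixes D :: "nat \<Rightarrow> 'a measure" and K :: "nat \<Rightarrow> 'a \<Rightarrow> 'a measure" and A :: "nat \<Rightarrow> 'a set"
    and J :: nat and N :: nat
  assumes partitioned: "\<And>k. partitioned_kernel (D k) (K k) A J"
    and sets_D: "\<And>k. sets (D k) = sets (D 0)"

sublocale product_chain \<subseteq> Co: partitioned_kernel "D k" "K k" A J for k
  by (rule partitioned)

sublocale product_chain \<subseteq> finite_product_prob_space D "{..N}"
  by unfold_locales auto

context product_chain begin

abbreviation M :: "(nat \<Rightarrow> 'a) measure" where "M \<equiv> PiM {..N} D"

definition sig :: "(nat \<Rightarrow> 'a) \<Rightarrow> nat \<Rightarrow> nat" where
  "sig x = (\<lambda>k\<in>{..N}. Co.cell (x k))"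

lemma space_D: "space (D k) = space (D 0)"
  by (rule sets_eq_imp_space_eq) (rule sets_D)

lemma space_M_coord: "x \<in> space M \<Longrightarrow> k \<le> N \<Longrightarrow> x k \<in> space (D k)"
  by (auto simp: space_PiM)

lemma space_M_upd: "x \<in> space M \<Longrightarrow> k \<le> N \<Longrightarrow> y \<in> space (D k) \<Longrightarrow> x(k := y) \<in> space M"
  by (auto simp: space_PiM PiE_iff extensional_def)

lemma measurable_coord: "k \<le> N \<Longrightarrow> (\<lambda>x. x k) \<in> M \<rightarrow>\<^sub>M D k"
  by (rule measurable_component_singleton) simp

lemma measurable_upd: "k \<le> N \<Longrightarrow> (\<lambda>(x, y). x(k := y)) \<in> M \<Otimes>\<^sub>M D k \<rightarrow>\<^sub>M M"
  unfolding split_beta by (rule measurable_fun_upd[where J="{..N}"]) auto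

lemma measurable_upd': "k \<le> N \<Longrightarrow> x \<in> space M \<Longrightarrow> (\<lambda>y. x(k := y)) \<in> D k \<rightarrow>\<^sub>M M"
  using measurable_compose[OF measurable_Pair1' measurable_upd] by (auto simp: o_def)

text \<open>The image law has the right mass on rectangles. This plays the role of Fubini in
  coordinate \<open>k\<close>: the product is not split into two factors, the old value of the
  coordinate is merely overwritten by an independent one.\<close>

lemma distr_resample:
  assumes k: "k \<le> N"
  shows "distr (M \<Otimes>\<^sub>M D k) M (\<lambda>(x, y). x(k := y)) = M"
proof (rule PiM_eqI)
  fix X assume X: "\<And>i. i \<in> {..N} \<Longrightarrow> X i \<in> sets (D i)"
  let ?X = "X(k := space (D k))"
  interpret pair_sigma_finite M "D k" by unfold_locales
  have sub: "X i \<subseteq> space (D i)" if "i \<le> N" for i using X[of i] that by (auto dest: sets.sets_into_space)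
  have XM: "Pi\<^sub>E {..N} X \<in> sets M" using X by (intro sets_PiM_I_finite) auto
  have X'M: "Pi\<^sub>E {..N} ?X \<in> sets M" using X by (intro sets_PiM_I_finite) auto
  have vim: "(\<lambda>(x, y). x(k := y)) -` Pi\<^sub>E {..N} X \<inter> space (M \<Otimes>\<^sub>M D k) = Pi\<^sub>E {..N} ?X \<times> X k"
    (is "?L = ?R")
  proof (intro equalityI subsetI)
    fix z assume z: "z \<in> ?L"
    then obtain x y where xy: "z = (x, y)" "x \<in> space M" "y \<in> space (D k)" "x(k := y) \<in> Pi\<^sub>E {..N} X"
      by (auto simp: space_pair_measure)
    have "y \<in> X k" using PiE_mem[OF xy(4), of k] k by simp
    moreover have "x i \<in> ?X i" if "i \<le> N" for i
      using PiE_mem[OF xy(4), of i] that space_M_coord[OF xy(2), of i] by (auto split: if_splits)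
    moreover have "x \<in> extensional {..N}" using xy(2) by (auto simp: space_PiM PiE_iff)
    ultimately show "z \<in> ?R" using xy(1) by (auto simp: PiE_iff)
  next
    fix z assume "z \<in> ?R"
    then obtain x y where xy: "z = (x, y)" "x \<in> Pi\<^sub>E {..N} ?X" "y \<in> X k" by auto
    have mem: "x i \<in> (if i = k then space (D k) else X i)" if "i \<le> N" for i
      using PiE_mem[OF xy(2), of i] that by auto
    have ext: "x \<in> extensional {..N}" using xy(2) by (auto simp: PiE_iff)
    have "x i \<in> space (D i)" if "i \<le> N" for i using mem[OF that] sub[OF that] by (auto split: if_splits)
    then have "x \<in> space M" using ext by (auto simp: space_PiM PiE_iff)
    moreover have "(x(k := y)) i \<in> X i" if "i \<le> N" for i
      using mem[OF that] xy(3) by auto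
    then have "x(k := y) \<in> Pi\<^sub>E {..N} X"
      using ext k by (simp add: PiE_iff extensional_def)
    ultimately show "z \<in> ?L" using xy sub[OF k] by (auto simp: space_pair_measure)
  qed
  have "emeasure (distr (M \<Otimes>\<^sub>M D k) M (\<lambda>(x, y). x(k := y))) (Pi\<^sub>E {..N} X) = emeasure M (Pi\<^sub>E {..N} ?X) * emeasure (D k) (X k)"
    using XM X'M X[of k] k measurable_upd[OF k] by (simp add: emeasure_distr vim Co.emeasure_pair_measure_Times)
  also have "emeasure M (Pi\<^sub>E {..N} ?X) = (\<Prod>i\<le>N. emeasure (D i) (?X i))"
    using X by (intro emeasure_PiM) auto
  also have "\<dots> = emeasure (D k) (?X k) * (\<Prod>i\<in>{..N}-{k}. emeasure (D i) (?X i))"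
    using k by (intro prod.remove) auto
  also have "(\<Prod>i\<in>{..N}-{k}. emeasure (D i) (?X i)) = (\<Prod>i\<in>{..N}-{k}. emeasure (D i) (X i))"
    by (intro prod.cong) auto
  also have "emeasure (D k) (?X k) * \<dots> * emeasure (D k) (X k) = emeasure (D k) (X k) * (\<Prod>i\<in>{..N}-{k}. emeasure (D i) (X i))"
    by (simp add: Co.emeasure_space_1 mult.commute)
  also have "\<dots> = (\<Prod>i\<le>N. emeasure (D i) (X i))"
    using k by (intro prod.remove[symmetric]) auto
  finally show "emeasure (distr (M \<Otimes>\<^sub>M D k) M (\<lambda>(x, y). x(k := y))) (Pi\<^sub>E {..N} X) = (\<Prod>i\<le>N. emeasure (D i) (X i))" .
qed auto

lemma nn_integral_resample:
  assumes k: "k \<le> N" and G[measurable]: "G \<in> borel_measurable M"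
  shows "(\<integral>\<^sup>+x. G x \<partial>M) = (\<integral>\<^sup>+x. \<integral>\<^sup>+y. G (x(k := y)) \<partial>D k \<partial>M)"
proof -
  note [measurable] = measurable_upd[OF k]
  have "(\<integral>\<^sup>+x. G x \<partial>M) = (\<integral>\<^sup>+x. G x \<partial>distr (M \<Otimes>\<^sub>M D k) M (\<lambda>(x, y). x(k := y)))"
    by (simp only: distr_resample[OF k])
  also have "\<dots> = (\<integral>\<^sup>+z. G ((\<lambda>(x, y). x(k := y)) z) \<partial>(M \<Otimes>\<^sub>M D k))"
    by (rule nn_integral_distr) measurable
  also have "\<dots> = (\<integral>\<^sup>+x. \<integral>\<^sup>+y. G (x(k := y)) \<partial>D k \<partial>M)"
    by (subst Co.nn_integral_fst[symmetric]) (use measurable_compose[OF measurable_upd[OF k] G] in simp_all)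
  finally show ?thesis .
qed

lemma integral_resample:
  fixes G :: "(nat \<Rightarrow> 'a) \<Rightarrow> real"
  assumes k: "k \<le> N" and G: "integrable M G"
  shows "(\<integral>x. G x \<partial>M) = (\<integral>x. \<integral>y. G (x(k := y)) \<partial>D k \<partial>M)"
    and "integrable M (\<lambda>x. \<integral>y. G (x(k := y)) \<partial>D k)"
proof -
  note [measurable] = measurable_upd[OF k]
  interpret pair_sigma_finite M "D k" by unfold_locales
  have i: "integrable (M \<Otimes>\<^sub>M D k) (\<lambda>z. G ((\<lambda>(x, y). x(k := y)) z))"
    by (rule integrable_distr[OF measurable_upd[OF k]]) (simp only: distr_resample[OF k] G)
  have [measurable]: "G \<in> borel_measurable M" using G by auto
  have "(\<integral>x. G x \<partial>M) = (\<integral>x. G x \<partial>distr (M \<Otimes>\<^sub>M D k) M (\<lambda>(x, y). x(k := y)))"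
    by (simp only: distr_resample[OF k])
  also have "\<dots> = (\<integral>z. G ((\<lambda>(x, y). x(k := y)) z) \<partial>(M \<Otimes>\<^sub>M D k))"
    by (rule integral_distr) measurable
  also have "\<dots> = (\<integral>x. \<integral>y. G (x(k := y)) \<partial>D k \<partial>M)"
    using integral_fst'[OF i] by simp
  finally show "(\<integral>x. G x \<partial>M) = (\<integral>x. \<integral>y. G (x(k := y)) \<partial>D k \<partial>M)" .
  show "integrable M (\<lambda>x. \<integral>y. G (x(k := y)) \<partial>D k)"
    using integrable_fst'[OF i] by simp
qed

lemma measurable_slice:
  assumes "k \<le> N" "x \<in> space M" "f \<in> M \<rightarrow>\<^sub>M R"
  shows "(\<lambda>u. f (x(k := u))) \<in> D k \<rightarrow>\<^sub>M R"
  by (rule measurable_compose[OF measurable_upd'[OF assms(1,2)] assms(3)])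

text \<open>The slices have integrable second moments by \<open>nn_integral_resample\<close>. Only
  almost every slice is square-integrable, hence the almost-everywhere arguments below.\<close>

lemma AE_slice_L2:
  assumes k: "k \<le> N" and f: "f \<in> L2fun M"
  shows "AE x in M. (\<lambda>u. f (x(k := u))) \<in> L2fun (D k)"
proof -
  note [measurable] = measurable_upd[OF k]
  have fm[measurable]: "f \<in> borel_measurable M" using f by (simp add: L2fun_def)
  have "(\<integral>\<^sup>+x. \<integral>\<^sup>+y. ennreal ((f (x(k := y)))\<^sup>2) \<partial>D k \<partial>M) < \<infinity>"
    using f by (subst nn_integral_resample[OF k, symmetric]) (auto simp: L2fun_iff_nn)
  moreover have [measurable]: "(\<lambda>(x, y). ennreal ((f (x(k := y)))\<^sup>2)) \<in> borel_measurable (M \<Otimes>\<^sub>M D k)"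
    using measurable_compose[OF measurable_upd[OF k], of "\<lambda>x. ennreal ((f x)\<^sup>2)" borel] by (simp add: split_beta')
  ultimately have "AE x in M. (\<integral>\<^sup>+y. ennreal ((f (x(k := y)))\<^sup>2) \<partial>D k) \<noteq> \<infinity>"
    by (intro nn_integral_PInf_AE) (auto simp: less_top)
  then show ?thesis
    by (rule AE_mp) (auto intro!: AE_I2 measurable_slice[OF k] simp: L2fun_iff_nn less_top[symmetric])
qed

section \<open>Averaging over cells, one coordinate at a time\<close>

definition avgc :: "nat \<Rightarrow> ((nat \<Rightarrow> 'a) \<Rightarrow> real) \<Rightarrow> (nat \<Rightarrow> 'a) \<Rightarrow> real" where
  "avgc k f x = Co.avg k (\<lambda>u. f (x(k := u))) (x k)"

definition energyc :: "nat \<Rightarrow> ((nat \<Rightarrow> 'a) \<Rightarrow> real) \<Rightarrow> ennreal" where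
  "energyc k f = (\<integral>\<^sup>+x. \<integral>\<^sup>+y. ennreal ((f x - f (x(k := y)))\<^sup>2) \<partial>K k (x k) \<partial>M)"

lemma avgc_upd: "avgc k f (x(k := u)) = Co.avg k (\<lambda>u. f (x(k := u))) u"
  by (simp add: avgc_def)

lemma measurable_avgc:
  assumes k: "k \<le> N" and f: "f \<in> borel_measurable M"
  shows "avgc k f \<in> borel_measurable M"
proof -
  have [measurable]: "(\<lambda>(x, u). f (x(k := u))) \<in> borel_measurable (M \<Otimes>\<^sub>M D k)"
    using measurable_compose[OF measurable_upd[OF k] f] by (simp add: split_beta')
  note [measurable] = measurable_coord[OF k]
  show ?thesis unfolding avgc_def[abs_def] Co.avg_def by measurable
qed

lemma measurable_energyc:
  assumes k: "k \<le> N" and f[measurable]: "f \<in> borel_measurable M"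
  shows "(\<lambda>x. \<integral>\<^sup>+y. ennreal ((f x - f (x(k := y)))\<^sup>2) \<partial>K k (x k)) \<in> borel_measurable M"
proof -
  have [measurable]: "(\<lambda>z. f ((fst z)(k := snd z))) \<in> borel_measurable (M \<Otimes>\<^sub>M D k)"
    using measurable_compose[OF measurable_upd[OF k] f] by (simp add: split_beta')
  show ?thesis
  proof (rule nn_integral_measurable_subprob_algebra2[where N="D k"])
    show "(\<lambda>(x, y). ennreal ((f x - f (x(k := y)))\<^sup>2)) \<in> borel_measurable (M \<Otimes>\<^sub>M D k)"
      unfolding split_beta' by measurable
    show "(\<lambda>x. K k (x k)) \<in> M \<rightarrow>\<^sub>M subprob_algebra (D k)"
      by (rule measurable_compose[OF measurable_coord[OF k] Co.kernel_subprob])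
  qed
qed

lemma energyc_slice:
  assumes k: "k \<le> N" and f: "f \<in> borel_measurable M"
  shows "energyc k f = (\<integral>\<^sup>+x. Co.energy k (\<lambda>u. f (x(k := u))) \<partial>M)"
  unfolding energyc_def Co.energy_def
  by (subst nn_integral_resample[OF k measurable_energyc[OF k f]]) simp

text \<open>The inequality for one coordinate holds on almost every slice and is integrated over the
  other coordinates.\<close>

lemma poincare_coord:
  assumes k: "k \<le> N" and f: "f \<in> L2fun M" and c: "c \<ge> 0"
    and gap: "\<And>j g. j \<in> {1..J} \<Longrightarrow> g \<in> L2fun (Co.cond k (A j)) \<Longrightarrow>
        c * var_mu (Co.cond k (A j)) g \<le> dirichlet (Co.cond k (A j)) (restr_op (K k) (A j)) g"
  shows "ennreal (2 * c) * (\<integral>\<^sup>+x. ennreal ((f x - avgc k f x)\<^sup>2) \<partial>M) \<le> energyc k f"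
proof -
  have fm[measurable]: "f \<in> borel_measurable M" using f by (simp add: L2fun_def)
  note [measurable] = measurable_avgc[OF k fm]
  have pm: "(\<lambda>(x, y). ennreal ((f (x(k := y)) - avgc k f (x(k := y)))\<^sup>2)) \<in> borel_measurable (M \<Otimes>\<^sub>M D k)"
    using measurable_compose[OF measurable_upd[OF k], of "\<lambda>x. ennreal ((f x - avgc k f x)\<^sup>2)" borel] by (simp add: split_beta')
  have "ennreal (2 * c) * (\<integral>\<^sup>+x. ennreal ((f x - avgc k f x)\<^sup>2) \<partial>M)
     = (\<integral>\<^sup>+x. ennreal (2 * c) * (\<integral>\<^sup>+y. ennreal ((f (x(k := y)) - avgc k f (x(k := y)))\<^sup>2) \<partial>D k) \<partial>M)"
    using pm by (subst nn_integral_resample[OF k]) (auto simp: nn_integral_cmult Co.borel_measurable_nn_integral)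
  also have "\<dots> \<le> (\<integral>\<^sup>+x. Co.energy k (\<lambda>u. f (x(k := u))) \<partial>M)"
  proof (rule nn_integral_mono_AE, use AE_slice_L2[OF k f] in eventually_elim)
    case (elim x)
    show ?case unfolding avgc_upd
      by (intro Co.poincare_cells[OF elim c] gap Co.cond_L2fun Co.cell_meas Co.cell_pos elim)
  qed
  finally show ?thesis by (simp only: energyc_slice[OF k fm])
qed

lemma avgc_pythagoras:
  assumes k: "k \<le> N" and f: "f \<in> L2fun M" and h: "h \<in> L2fun M"
  shows "(\<integral>\<^sup>+x. ennreal ((f x - avgc k h x)\<^sup>2) \<partial>M)
     \<le> (\<integral>\<^sup>+x. ennreal ((f x - avgc k f x)\<^sup>2) \<partial>M) + (\<integral>\<^sup>+x. ennreal ((f x - h x)\<^sup>2) \<partial>M)"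
proof -
  have fm[measurable]: "f \<in> borel_measurable M" and hm[measurable]: "h \<in> borel_measurable M"
    using f h by (auto simp: L2fun_def)
  note [measurable] = measurable_avgc[OF k fm] measurable_avgc[OF k hm]
  have pm: "(\<lambda>x. \<integral>\<^sup>+y. G (x(k := y)) \<partial>D k) \<in> borel_measurable M" if "G \<in> borel_measurable M" for G :: "_ \<Rightarrow> ennreal"
    using measurable_compose[OF measurable_upd[OF k] that]
    by (intro Co.borel_measurable_nn_integral) (simp add: split_beta')
  have "(\<integral>\<^sup>+x. ennreal ((f x - avgc k h x)\<^sup>2) \<partial>M) = (\<integral>\<^sup>+x. \<integral>\<^sup>+y. ennreal ((f (x(k := y)) - avgc k h (x(k := y)))\<^sup>2) \<partial>D k \<partial>M)"
    by (rule nn_integral_resample[OF k]) measurable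
  also have "\<dots> \<le> (\<integral>\<^sup>+x. (\<integral>\<^sup>+y. ennreal ((f (x(k := y)) - avgc k f (x(k := y)))\<^sup>2) \<partial>D k)
       + (\<integral>\<^sup>+y. ennreal ((f (x(k := y)) - h (x(k := y)))\<^sup>2) \<partial>D k) \<partial>M)"
    using AE_slice_L2[OF k f] AE_slice_L2[OF k h]
    by (intro nn_integral_mono_AE, eventually_elim) (unfold avgc_upd, rule Co.avg_pythagoras)
  also have "\<dots> = (\<integral>\<^sup>+x. \<integral>\<^sup>+y. ennreal ((f (x(k := y)) - avgc k f (x(k := y)))\<^sup>2) \<partial>D k \<partial>M)
       + (\<integral>\<^sup>+x. \<integral>\<^sup>+y. ennreal ((f (x(k := y)) - h (x(k := y)))\<^sup>2) \<partial>D k \<partial>M)"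
    by (intro nn_integral_add pm[of "\<lambda>x. ennreal ((f x - avgc k f x)\<^sup>2)"] pm[of "\<lambda>x. ennreal ((f x - h x)\<^sup>2)"]) measurable
  also have "\<dots> = (\<integral>\<^sup>+x. ennreal ((f x - avgc k f x)\<^sup>2) \<partial>M) + (\<integral>\<^sup>+x. ennreal ((f x - h x)\<^sup>2) \<partial>M)"
    by (subst (1 2) nn_integral_resample[OF k, symmetric]) measurable
  finally show ?thesis .
qed

text \<open>\<open>avgc_pythagoras\<close> with 0 in the place of \<open>f\<close>: averaging does
  not increase the norm.\<close>

lemma avgc_L2fun:
  assumes k: "k \<le> N" and h: "h \<in> L2fun M"
  shows "avgc k h \<in> L2fun M"
proof -
  have z: "(\<lambda>x. 0) \<in> L2fun M" by (simp add: L2fun_def)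
  have "avgc k (\<lambda>x. 0) x = 0" for x by (simp add: avgc_def Co.avg_def)
  then have "(\<integral>\<^sup>+x. ennreal ((avgc k h x)\<^sup>2) \<partial>M) \<le> (\<integral>\<^sup>+x. ennreal ((h x)\<^sup>2) \<partial>M)"
    using avgc_pythagoras[OF k z h] by simp
  then show ?thesis using h measurable_avgc[OF k] by (auto simp: L2fun_iff_nn intro: le_less_trans)
qed

primrec avgs :: "nat \<Rightarrow> ((nat \<Rightarrow> 'a) \<Rightarrow> real) \<Rightarrow> (nat \<Rightarrow> 'a) \<Rightarrow> real" where
  "avgs 0 f = f"
| "avgs (Suc k) f = avgc k (avgs k f)"

lemma avgs_L2fun: "f \<in> L2fun M \<Longrightarrow> k \<le> Suc N \<Longrightarrow> avgs k f \<in> L2fun M"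
  by (induction k) (auto intro: avgc_L2fun)

text \<open>With \<open>avgs k f\<close> in the role of \<open>h\<close>, a further averaging adds
  the error of averaging \<open>f\<close> itself and not that of an already averaged function. So
  the local gaps are only ever applied to \<open>f\<close>.\<close>

lemma avgs_le:
  assumes f: "f \<in> L2fun M"
  shows "k \<le> Suc N \<Longrightarrow> (\<integral>\<^sup>+x. ennreal ((f x - avgs k f x)\<^sup>2) \<partial>M) \<le> (\<Sum>i<k. \<integral>\<^sup>+x. ennreal ((f x - avgc i f x)\<^sup>2) \<partial>M)"
proof (induction k)
  case (Suc k)
  have "(\<integral>\<^sup>+x. ennreal ((f x - avgs (Suc k) f x)\<^sup>2) \<partial>M)
    \<le> (\<integral>\<^sup>+x. ennreal ((f x - avgc k f x)\<^sup>2) \<partial>M) + (\<integral>\<^sup>+x. ennreal ((f x - avgs k f x)\<^sup>2) \<partial>M)"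
    using Suc.prems f by (auto intro!: avgc_pythagoras avgs_L2fun)
  also have "\<dots> \<le> (\<integral>\<^sup>+x. ennreal ((f x - avgc k f x)\<^sup>2) \<partial>M) + (\<Sum>i<k. \<integral>\<^sup>+x. ennreal ((f x - avgc i f x)\<^sup>2) \<partial>M)"
    using Suc by (intro add_left_mono) auto
  finally show ?case by (simp add: add.commute)
qed simp

text \<open>Demanded at every point, not almost everywhere, so that a function may be evaluated at
  chosen representatives of the cells. All coordinates have the same underlying space, here written
  \<open>space (D 0)\<close>.\<close>

definition cell_inv :: "nat \<Rightarrow> ((nat \<Rightarrow> 'a) \<Rightarrow> real) \<Rightarrow> bool" where
  "cell_inv m h \<longleftrightarrow> (\<forall>x\<in>space M. \<forall>u\<in>space (D 0). Co.cell u = Co.cell (x m) \<longrightarrow> h (x(m := u)) = h x)"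

lemma avgc_eq:
  assumes "x \<in> space M" "k \<le> N"
  shows "avgc k h x = (\<integral>y. indicator (A (Co.cell (x k))) y * h (x(k := y)) \<partial>D k) / measure (D k) (A (Co.cell (x k)))"
  unfolding avgc_def using space_M_coord[OF assms] by (rule Co.avg_cell)

lemma cell_inv_avgc: "k \<le> N \<Longrightarrow> cell_inv k (avgc k h)"
  unfolding cell_inv_def
proof (intro ballI impI)
  fix x u assume k: "k \<le> N" and x: "x \<in> space M" and u: "u \<in> space (D 0)" "Co.cell u = Co.cell (x k)"
  have "x(k := u) \<in> space M" using x k u space_D[of k] by (intro space_M_upd) auto
  then show "avgc k h (x(k := u)) = avgc k h x"
    using x k u by (simp add: avgc_eq)
qed

text \<open>Every function value under the integral over coordinate \<open>k\<close> ignores moves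
  of coordinate \<open>m\<close> within its cell; a later averaging thus keeps what the earlier ones
  achieved.\<close>

lemma cell_inv_avgc_other:
  assumes k: "k \<le> N" and m: "m \<le> N" "m \<noteq> k" and inv: "cell_inv m h"
  shows "cell_inv m (avgc k h)"
  unfolding cell_inv_def
proof (intro ballI impI)
  fix x u assume x: "x \<in> space M" and u: "u \<in> space (D 0)" "Co.cell u = Co.cell (x m)"
  have xu: "x(m := u) \<in> space M" using x m u space_D[of m] by (intro space_M_upd) auto
  have "(\<integral>y. indicator (A (Co.cell (x k))) y * h ((x(m := u))(k := y)) \<partial>D k)
      = (\<integral>y. indicator (A (Co.cell (x k))) y * h (x(k := y)) \<partial>D k)"
  proof (intro Bochner_Integration.integral_cong refl)
    fix y assume y: "y \<in> space (D k)"
    have "h ((x(k := y))(m := u)) = h (x(k := y))"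
      using inv[unfolded cell_inv_def, rule_format, of "x(k := y)" u] space_M_upd[OF x k y] u m by simp
    then show "indicator (A (Co.cell (x k))) y * h ((x(m := u))(k := y)) = indicator (A (Co.cell (x k))) y * h (x(k := y))"
      using m by (simp add: fun_upd_twist)
  qed
  then show "avgc k h (x(m := u)) = avgc k h x"
    using x xu k m by (simp add: avgc_eq)
qed

lemma cell_inv_avgs: "m < k \<Longrightarrow> k \<le> Suc N \<Longrightarrow> cell_inv m (avgs k f)"
proof (induction k)
  case (Suc k)
  then show ?case
    by (cases "m = k") (auto intro: cell_inv_avgc cell_inv_avgc_other)
qed simp

text \<open>\<open>F\<close> evaluates \<open>h\<close> at a fixed representative of each cell,
  which exists because cells have positive mass and so are not empty.\<close>

lemma cell_inv_factor:
  assumes inv: "\<And>m. m \<le> N \<Longrightarrow> cell_inv m h"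
  obtains F where "\<And>x. x \<in> space M \<Longrightarrow> h x = F (sig x)"
proof -
  have "\<exists>y. y \<in> A j" if "j \<in> {1..J}" for j
    using Co.cell_pos[OF that, of 0] by (cases "A j = {}") auto
  then obtain a where a: "\<And>j. j \<in> {1..J} \<Longrightarrow> a j \<in> A j" by metis
  define F where "F s = h (\<lambda>k\<in>{..N}. a (s k))" for s
  have "h x = F (sig x)" if x: "x \<in> space M" for x
  proof -
    \<comment> \<open>In \<open>z m\<close> the coordinates below \<open>m\<close> have already been
      moved to representatives; \<open>z 0\<close> is \<open>x\<close> and \<open>z (Suc N)\<close>
      depends on the labels only.\<close>
    define z where "z m = (\<lambda>k\<in>{..N}. if k < m then a (Co.cell (x k)) else x k)" for m
    have ax: "a (Co.cell (x k)) \<in> space (D 0)" "Co.cell (a (Co.cell (x k))) = Co.cell (x k)" if k: "k \<le> N" for k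
    proof -
      have c: "Co.cell (x k) \<in> {1..J}" using space_M_coord[OF x k] by (rule Co.cell_mem)
      show "Co.cell (a (Co.cell (x k))) = Co.cell (x k)" by (rule Co.cell_eq[OF c a[OF c]])
      show "a (Co.cell (x k)) \<in> space (D 0)" using a[OF c] sets.sets_into_space[OF Co.cell_meas[OF c, of 0]] by auto
    qed
    have zM: "z m \<in> space M" for m
      using ax(1) space_M_coord[OF x] space_D by (auto simp: z_def space_PiM PiE_iff)
    have "h (z m) = h x" if "m \<le> Suc N" for m
      using that
    proof (induction m)
      case 0
      have "z 0 = x" using x by (auto simp: z_def space_PiM PiE_iff extensional_def fun_eq_iff)
      then show ?case by simp
    next
      case (Suc m)
      then have m: "m \<le> N" by simp
      have "z (Suc m) = (z m)(m := a (Co.cell (x m)))" using m by (auto simp: z_def fun_eq_iff less_Suc_eq)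
      moreover have "Co.cell (a (Co.cell (x m))) = Co.cell (z m m)" using ax(2)[OF m] m by (simp add: z_def)
      ultimately have "h (z (Suc m)) = h (z m)"
        using inv[OF m, unfolded cell_inv_def] zM ax(1)[OF m] by simp
      then show ?case using Suc by simp
    qed
    from this[of "Suc N"] have "h x = h (z (Suc N))" by simp
    also have "z (Suc N) = (\<lambda>k\<in>{..N}. a (sig x k))" by (auto simp: z_def sig_def fun_eq_iff)
    finally show ?thesis unfolding F_def .
  qed
  then show thesis by (rule that)
qed

lemma sig_upd: "k \<le> N \<Longrightarrow> sig (x(k := y)) = (sig x)(k := Co.cell y)"
  by (auto simp: sig_def fun_eq_iff)

lemma sig_mem: "x \<in> space M \<Longrightarrow> sig x \<in> {..N} \<rightarrow>\<^sub>E {1..J}"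
proof (rule PiE_I)
  fix k assume "x \<in> space M" "k \<in> {..N}"
  then show "sig x k \<in> {1..J}"
    using Co.cell_mem[OF space_M_coord[of x k]] by (simp add: sig_def)
qed (simp add: sig_def)

end

lemma ennreal_square_add_le:
  "ennreal ((a + b)\<^sup>2) \<le> 2 * ennreal (a\<^sup>2) + 2 * ennreal (b\<^sup>2)" for a b :: real
proof -
  have "(a + b)\<^sup>2 \<le> 2 * a\<^sup>2 + 2 * b\<^sup>2" using square_diff_le[of a "- b"] by simp
  then have "ennreal ((a + b)\<^sup>2) \<le> ennreal (2 * a\<^sup>2 + 2 * b\<^sup>2)" by (rule ennreal_leI)
  also have "\<dots> = 2 * ennreal (a\<^sup>2) + 2 * ennreal (b\<^sup>2)" by (simp add: ennreal_mult')
  finally show ?thesis .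
qed

lemma ennreal_mult_weighted_sum:
  assumes "0 \<le> c" "\<And>i. 0 \<le> b i" "\<And>i. 0 \<le> f i"
  shows "ennreal (c * (\<Sum>i\<in>I. b i * f i)) = (\<Sum>i\<in>I. ennreal (b i) * (ennreal c * ennreal (f i)))"
proof -
  have "(\<Sum>i\<in>I. ennreal (b i) * (ennreal c * ennreal (f i))) = (\<Sum>i\<in>I. ennreal (c * (b i * f i)))"
    using assms by (intro sum.cong refl) (simp add: ennreal_mult[symmetric] mult.left_commute)
  also have "\<dots> = ennreal (\<Sum>i\<in>I. c * (b i * f i))"
    using assms by (intro sum_ennreal) simp
  finally show ?thesis by (simp add: sum_distrib_left)
qed

context product_chain begin

section \<open>Label functions and their boxes\<close>

definition box_mass :: "(nat \<Rightarrow> nat) \<Rightarrow> real" where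
  "box_mass s = (\<Prod>k\<le>N. measure (D k) (A (s k)))"

lemma box_mass_nonneg: "0 \<le> box_mass s"
  unfolding box_mass_def by (intro prod_nonneg) auto

lemma sig_eq_iff:
  assumes s: "s \<in> {..N} \<rightarrow>\<^sub>E {1..J}" and x: "x \<in> space M"
  shows "sig x = s \<longleftrightarrow> x \<in> Pi\<^sub>E {..N} (\<lambda>k. A (s k))"
proof -
  have cell: "x k \<in> A (s k) \<longleftrightarrow> Co.cell (x k) = s k" if k: "k \<le> N" for k
  proof
    have sk: "s k \<in> {1..J}" using PiE_mem[OF s, of k] k by simp
    show "Co.cell (x k) = s k" if "x k \<in> A (s k)" by (rule Co.cell_eq[OF sk that])
    show "x k \<in> A (s k)" if "Co.cell (x k) = s k"
      using Co.mem_cell[OF space_M_coord[OF x k]] that by simp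
  qed
  have "sig x = s \<longleftrightarrow> (\<forall>k\<le>N. Co.cell (x k) = s k)"
  proof
    assume eq: "sig x = s"
    show "\<forall>k\<le>N. Co.cell (x k) = s k" unfolding eq[symmetric] by (simp add: sig_def)
  next
    assume "\<forall>k\<le>N. Co.cell (x k) = s k"
    then show "sig x = s"
      by (intro extensionalityI[of _ "{..N}"]) (use s in \<open>auto simp: sig_def PiE_iff\<close>)
  qed
  moreover have "x \<in> extensional {..N}" using x by (auto simp: space_PiM PiE_iff)
  ultimately show ?thesis using cell by (simp add: PiE_iff Ball_def)
qed

lemma sets_box: "s \<in> {..N} \<rightarrow>\<^sub>E {1..J} \<Longrightarrow> Pi\<^sub>E {..N} (\<lambda>k. A (s k)) \<in> sets M"
  by (rule sets_PiM_I_finite, simp, rule Co.cell_meas, erule PiE_mem)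

lemma sum_box:
  fixes \<Phi> :: "(nat \<Rightarrow> nat) \<Rightarrow> 'b::semiring_1"
  assumes x: "x \<in> space M"
  shows "(\<Sum>s\<in>{..N} \<rightarrow>\<^sub>E {1..J}. \<Phi> s * indicator (Pi\<^sub>E {..N} (\<lambda>k. A (s k))) x) = \<Phi> (sig x)"
proof -
  have "(\<Sum>s\<in>{..N} \<rightarrow>\<^sub>E {1..J}. \<Phi> s * indicator (Pi\<^sub>E {..N} (\<lambda>k. A (s k))) x)
      = (\<Sum>s\<in>{..N} \<rightarrow>\<^sub>E {1..J}. if s = sig x then \<Phi> s else 0)"
    using sig_eq_iff[OF _ x] by (intro sum.cong refl) (auto simp: indicator_def)
  then show ?thesis using sig_mem[OF x] by (simp add: finite_PiE)
qed

lemma measurable_sig_real: "(\<lambda>x. F (sig x)) \<in> borel_measurable M" for F :: "_ \<Rightarrow> real"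
proof -
  have "(\<lambda>x. \<Sum>s\<in>{..N} \<rightarrow>\<^sub>E {1..J}. F s * indicator (Pi\<^sub>E {..N} (\<lambda>k. A (s k))) x) \<in> borel_measurable M"
    using sets_box by (intro borel_measurable_sum borel_measurable_times borel_measurable_indicator) auto
  then show ?thesis by (rule measurable_cong[THEN iffD1, rotated]) (simp only: sum_box)
qed

lemma nn_integral_sig_weighted:
  fixes \<Phi> :: "(nat \<Rightarrow> nat) \<Rightarrow> ennreal"
  assumes q: "q \<in> borel_measurable M"
  shows "(\<integral>\<^sup>+x. q x * \<Phi> (sig x) \<partial>M)
    = (\<Sum>s\<in>{..N} \<rightarrow>\<^sub>E {1..J}. \<Phi> s * (\<integral>\<^sup>+x. q x * indicator (Pi\<^sub>E {..N} (\<lambda>k. A (s k))) x \<partial>M))"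
proof -
  have "(\<integral>\<^sup>+x. q x * \<Phi> (sig x) \<partial>M)
     = (\<integral>\<^sup>+x. (\<Sum>s\<in>{..N} \<rightarrow>\<^sub>E {1..J}. \<Phi> s * (q x * indicator (Pi\<^sub>E {..N} (\<lambda>k. A (s k))) x)) \<partial>M)"
  proof (intro nn_integral_cong)
    fix x assume x: "x \<in> space M"
    show "q x * \<Phi> (sig x) = (\<Sum>s\<in>{..N} \<rightarrow>\<^sub>E {1..J}. \<Phi> s * (q x * indicator (Pi\<^sub>E {..N} (\<lambda>k. A (s k))) x))"
      unfolding sum_box[OF x, of \<Phi>, symmetric] sum_distrib_left by (simp only: mult_ac)
  qed
  also have "\<dots> = (\<Sum>s\<in>{..N} \<rightarrow>\<^sub>E {1..J}. \<integral>\<^sup>+x. \<Phi> s * (q x * indicator (Pi\<^sub>E {..N} (\<lambda>k. A (s k))) x) \<partial>M)"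
    using sets_box q by (intro nn_integral_sum borel_measurable_times borel_measurable_indicator) auto
  also have "\<dots> = (\<Sum>s\<in>{..N} \<rightarrow>\<^sub>E {1..J}. \<Phi> s * (\<integral>\<^sup>+x. q x * indicator (Pi\<^sub>E {..N} (\<lambda>k. A (s k))) x \<partial>M))"
    using sets_box q by (intro sum.cong refl nn_integral_cmult borel_measurable_times borel_measurable_indicator) auto
  finally show ?thesis .
qed

lemma nn_integral_sig:
  fixes \<Phi> :: "(nat \<Rightarrow> nat) \<Rightarrow> ennreal"
  shows "(\<integral>\<^sup>+x. \<Phi> (sig x) \<partial>M) = (\<Sum>s\<in>{..N} \<rightarrow>\<^sub>E {1..J}. ennreal (box_mass s) * \<Phi> s)"
proof -
  have "(\<integral>\<^sup>+x. indicator (Pi\<^sub>E {..N} (\<lambda>k. A (s k))) x \<partial>M) = ennreal (box_mass s)" if s: "s \<in> {..N} \<rightarrow>\<^sub>E {1..J}" for s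
  proof -
    have "(\<integral>\<^sup>+x. indicator (Pi\<^sub>E {..N} (\<lambda>k. A (s k))) x \<partial>M) = emeasure M (Pi\<^sub>E {..N} (\<lambda>k. A (s k)))"
      using sets_box[OF s] by simp
    also have "\<dots> = (\<Prod>k\<le>N. emeasure (D k) (A (s k)))"
      by (rule emeasure_PiM, simp, rule Co.cell_meas, rule PiE_mem[OF s])
    also have "\<dots> = ennreal (box_mass s)"
      unfolding box_mass_def by (simp add: Co.emeasure_eq_measure prod_ennreal)
    finally show ?thesis .
  qed
  then show ?thesis
    using nn_integral_sig_weighted[of "\<lambda>_. 1" \<Phi>] by (simp add: mult.commute)
qed

lemma sig_L2fun: "(\<lambda>x. F (sig x)) \<in> L2fun M" for F :: "_ \<Rightarrow> real"
proof -
  have "(\<integral>\<^sup>+x. ennreal ((F (sig x))\<^sup>2) \<partial>M) < \<infinity>"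
    unfolding nn_integral_sig[of "\<lambda>s. ennreal ((F s)\<^sup>2)"]
    by (simp add: ennreal_mult'[symmetric] box_mass_nonneg sum_ennreal less_top[symmetric])
  then show ?thesis by (simp add: L2fun_iff_nn measurable_sig_real)
qed

section \<open>Updates of a single coordinate as operators\<close>

definition coord_op :: "nat \<Rightarrow> ((nat \<Rightarrow> 'a) \<Rightarrow> real) \<Rightarrow> (nat \<Rightarrow> 'a) \<Rightarrow> real" where
  "coord_op k f x = (\<integral>y. f (x(k := y)) \<partial>K k (x k))"

lemma coord_op_slice: "coord_op k f (x(k := u)) = kop (K k) (\<lambda>u. f (x(k := u))) u"
  by (simp add: coord_op_def kop_def)

lemma measurable_upd_pair:
  assumes k: "k \<le> N" and f: "f \<in> M \<rightarrow>\<^sub>M R"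
  shows "(\<lambda>(x, y). f (x(k := y))) \<in> M \<Otimes>\<^sub>M D k \<rightarrow>\<^sub>M R"
  using measurable_compose[OF measurable_upd[OF k] f] by (simp add: split_beta')

lemma coord_kernel:
  assumes k: "k \<le> N"
  shows "(\<lambda>x. K k (x k)) \<in> M \<rightarrow>\<^sub>M prob_algebra (D k)"
  by (rule measurable_compose[OF measurable_coord[OF k] Co.kernel])

lemma measurable_coord_op:
  assumes k: "k \<le> N" and f: "f \<in> borel_measurable M"
  shows "coord_op k f \<in> borel_measurable M"
  unfolding coord_op_def[abs_def]
  by (rule borel_measurable_kernel_integral[OF measurable_upd_pair[OF k f] coord_kernel[OF k]])

text \<open>Jensen under \<open>K k (x k)\<close>, followed by invariance of \<open>D k\<close> in
  that coordinate.\<close>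

lemma coord_op_L2fun:
  assumes k: "k \<le> N" and f: "f \<in> L2fun M"
  shows "coord_op k f \<in> L2fun M"
proof -
  have fm: "f \<in> borel_measurable M" using f by (simp add: L2fun_def)
  then have f2: "(\<lambda>x. ennreal ((f x)\<^sup>2)) \<in> borel_measurable M" by measurable
  have meas: "(\<lambda>x. \<integral>\<^sup>+y. ennreal ((f (x(k := y)))\<^sup>2) \<partial>K k (x k)) \<in> borel_measurable M"
    by (rule nn_integral_measurable_subprob_algebra2[OF measurable_upd_pair[OF k f2] measurable_prob_algebraD[OF coord_kernel[OF k]]])
  have "(\<integral>\<^sup>+x. ennreal ((coord_op k f x)\<^sup>2) \<partial>M) \<le> (\<integral>\<^sup>+x. \<integral>\<^sup>+y. ennreal ((f (x(k := y)))\<^sup>2) \<partial>K k (x k) \<partial>M)"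
    unfolding coord_op_def
  proof (intro nn_integral_mono prob_space.square_integral_le)
    fix x assume x: "x \<in> space M"
    show "prob_space (K k (x k))" using space_M_coord[OF x k] by (rule Co.prob_K)
    show "(\<lambda>y. f (x(k := y))) \<in> borel_measurable (K k (x k))"
      using space_M_coord[OF x k] measurable_slice[OF k x fm] by (rule Co.measurable_K)
  qed
  also have "\<dots> = (\<integral>\<^sup>+x. \<integral>\<^sup>+u. \<integral>\<^sup>+y. ennreal ((f (x(k := y)))\<^sup>2) \<partial>K k u \<partial>D k \<partial>M)"
    by (subst nn_integral_resample[OF k meas]) simp
  also have "\<dots> = (\<integral>\<^sup>+x. \<integral>\<^sup>+y. ennreal ((f (x(k := y)))\<^sup>2) \<partial>D k \<partial>M)"
    by (intro nn_integral_cong Co.kernel_invariant measurable_slice[OF k _ f2])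
  also have "\<dots> = (\<integral>\<^sup>+x. ennreal ((f x)\<^sup>2) \<partial>M)"
    by (rule nn_integral_resample[OF k f2, symmetric])
  finally show ?thesis
    using f measurable_coord_op[OF k fm] by (auto simp: L2fun_iff_nn intro: le_less_trans)
qed

text \<open>On almost every slice this is \<open>Co.energy_eq\<close> together with
  \<open>Co.dirichlet_nonneg\<close>; \<open>integral_resample\<close> puts the slices
  together.\<close>

lemma
  assumes k: "k \<le> N" and f: "f \<in> L2fun M"
  shows energyc_eq: "energyc k f = ennreal (2 * inner_mu M f (\<lambda>x. f x - coord_op k f x))"
    and coord_op_nonneg: "0 \<le> inner_mu M f (\<lambda>x. f x - coord_op k f x)"
proof -
  have fm: "f \<in> borel_measurable M" using f by (simp add: L2fun_def)
  let ?G = "\<lambda>x. f x * (f x - coord_op k f x)"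
  let ?E = "\<lambda>x. dirichlet (D k) (kop (K k)) (\<lambda>u. f (x(k := u)))"
  have G: "integrable M ?G"
    by (rule L2fun_integrable_mult[OF f L2fun_diff[OF f coord_op_L2fun[OF k f]]])
  have E: "(\<integral>u. ?G (x(k := u)) \<partial>D k) = ?E x" for x
    by (simp add: dirichlet_def inner_mu_def coord_op_slice)
  have I: "inner_mu M f (\<lambda>x. f x - coord_op k f x) = (\<integral>x. ?E x \<partial>M)" and iE: "integrable M ?E"
    using integral_resample[OF k G] unfolding E by (simp_all add: inner_mu_def)
  have pos: "AE x in M. 0 \<le> ?E x"
    using AE_slice_L2[OF k f] by eventually_elim (rule Co.dirichlet_nonneg)
  show "0 \<le> inner_mu M f (\<lambda>x. f x - coord_op k f x)"
    unfolding I using pos by (rule integral_nonneg_AE)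
  have "energyc k f = (\<integral>\<^sup>+x. ennreal (2 * ?E x) \<partial>M)"
    unfolding energyc_slice[OF k fm]
    by (rule nn_integral_cong_AE, use AE_slice_L2[OF k f] in eventually_elim) (rule Co.energy_eq)
  also have "\<dots> = ennreal (\<integral>x. 2 * ?E x \<partial>M)"
    using iE pos by (intro nn_integral_eq_integral) auto
  finally show "energyc k f = ennreal (2 * inner_mu M f (\<lambda>x. f x - coord_op k f x))"
    unfolding I by simp
qed

lemma energyc_le:
  assumes k: "k \<le> N" and f: "f \<in> borel_measurable M"
  shows "energyc k f \<le> 4 * (\<integral>\<^sup>+x. ennreal ((f x)\<^sup>2) \<partial>M)"
proof -
  have f2: "(\<lambda>x. ennreal ((f x)\<^sup>2)) \<in> borel_measurable M" using f by measurable
  have "energyc k f \<le> (\<integral>\<^sup>+x. 4 * (\<integral>\<^sup>+u. ennreal ((f (x(k := u)))\<^sup>2) \<partial>D k) \<partial>M)"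
    unfolding energyc_slice[OF k f]
  proof (rule nn_integral_mono)
    fix x assume x: "x \<in> space M"
    have "Co.energy k (\<lambda>u. f (x(k := u))) \<le> 4 * (\<integral>\<^sup>+u. indicator (space (D k)) u * ennreal ((f (x(k := u)))\<^sup>2) \<partial>D k)"
      unfolding Co.energy_eq_jump by (rule Co.jump_le[OF measurable_slice[OF k x f] sets.top])
    also have "\<dots> = 4 * (\<integral>\<^sup>+u. ennreal ((f (x(k := u)))\<^sup>2) \<partial>D k)"
      by (intro arg_cong2[where f="(*)"] refl nn_integral_cong) simp
    finally show "Co.energy k (\<lambda>u. f (x(k := u))) \<le> 4 * (\<integral>\<^sup>+u. ennreal ((f (x(k := u)))\<^sup>2) \<partial>D k)" .
  qed
  also have "\<dots> = 4 * (\<integral>\<^sup>+x. \<integral>\<^sup>+u. ennreal ((f (x(k := u)))\<^sup>2) \<partial>D k \<partial>M)"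
    using measurable_upd_pair[OF k f2] by (intro nn_integral_cmult Co.borel_measurable_nn_integral)
  finally show ?thesis by (simp only: nn_integral_resample[OF k f2, symmetric])
qed

lemma energyc_add_le:
  assumes k: "k \<le> N" and f: "f \<in> borel_measurable M" and g: "g \<in> borel_measurable M"
  shows "energyc k (\<lambda>x. f x + g x) \<le> 2 * energyc k f + 2 * energyc k g"
proof -
  have "energyc k (\<lambda>x. f x + g x) \<le> (\<integral>\<^sup>+x. 2 * (\<integral>\<^sup>+y. ennreal ((f x - f (x(k := y)))\<^sup>2) \<partial>K k (x k))
      + 2 * (\<integral>\<^sup>+y. ennreal ((g x - g (x(k := y)))\<^sup>2) \<partial>K k (x k)) \<partial>M)"
    unfolding energyc_def
  proof (rule nn_integral_mono)
    fix x assume x: "x \<in> space M"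
    have m: "(\<lambda>y. ennreal ((h x - h (x(k := y)))\<^sup>2)) \<in> borel_measurable (K k (x k))" if "h \<in> borel_measurable M" for h
      using Co.measurable_K[OF space_M_coord[OF x k] measurable_slice[OF k x that]] by measurable
    have "(\<integral>\<^sup>+y. ennreal ((f x + g x - (f (x(k := y)) + g (x(k := y))))\<^sup>2) \<partial>K k (x k))
        \<le> (\<integral>\<^sup>+y. 2 * ennreal ((f x - f (x(k := y)))\<^sup>2) + 2 * ennreal ((g x - g (x(k := y)))\<^sup>2) \<partial>K k (x k))"
    proof (rule nn_integral_mono)
      fix y
      show "ennreal ((f x + g x - (f (x(k := y)) + g (x(k := y))))\<^sup>2)
         \<le> 2 * ennreal ((f x - f (x(k := y)))\<^sup>2) + 2 * ennreal ((g x - g (x(k := y)))\<^sup>2)"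
        using ennreal_square_add_le[of "f x - f (x(k := y))" "g x - g (x(k := y))"] by (simp only: add_diff_add)
    qed
    also have "\<dots> = 2 * (\<integral>\<^sup>+y. ennreal ((f x - f (x(k := y)))\<^sup>2) \<partial>K k (x k))
      + 2 * (\<integral>\<^sup>+y. ennreal ((g x - g (x(k := y)))\<^sup>2) \<partial>K k (x k))"
      unfolding nn_integral_cmult[OF m[OF f], symmetric] nn_integral_cmult[OF m[OF g], symmetric]
      by (intro nn_integral_add borel_measurable_times_ennreal borel_measurable_const m f g)
    finally show "(\<integral>\<^sup>+y. ennreal ((f x + g x - (f (x(k := y)) + g (x(k := y))))\<^sup>2) \<partial>K k (x k))
      \<le> 2 * (\<integral>\<^sup>+y. ennreal ((f x - f (x(k := y)))\<^sup>2) \<partial>K k (x k))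
      + 2 * (\<integral>\<^sup>+y. ennreal ((g x - g (x(k := y)))\<^sup>2) \<partial>K k (x k))" .
  qed
  also have "\<dots> = 2 * energyc k f + 2 * energyc k g"
    unfolding energyc_def nn_integral_cmult[OF measurable_energyc[OF k f], symmetric]
      nn_integral_cmult[OF measurable_energyc[OF k g], symmetric]
    by (intro nn_integral_add borel_measurable_times_ennreal borel_measurable_const measurable_energyc k f g)
  finally show ?thesis .
qed

lemma cell_weights_cells:
  assumes "\<gamma> > 0" "\<And>j. j \<in> {1..J} \<Longrightarrow> \<gamma> \<le> (\<Prod>k\<in>{1..N}. min 1 (measure (D (k - 1)) (A j) / measure (D k) (A j)))"
  shows "cell_weights (\<lambda>k j. measure (D k) (A j)) N J \<gamma>"
proof
  show "(\<Sum>j\<in>{1..J}. measure (D k) (A j)) = 1" for k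
    using Co.integral_cell[of k "\<lambda>_. 1"] by (simp add: Co.prob_space)
qed (use assms Co.cell_pos in auto)

text \<open>This is \<open>resample_form\<close> for the masses of the cells, defined without fixing
  a number \<gamma>.\<close>

definition coord_form :: "nat \<Rightarrow> ((nat \<Rightarrow> nat) \<Rightarrow> real) \<Rightarrow> real" where
  "coord_form k F = (\<Sum>s\<in>{..N} \<rightarrow>\<^sub>E {1..J}. \<Sum>j\<in>{1..J}. box_mass s * measure (D k) (A j) * (F s - F (s(k := j)))\<^sup>2)"

lemma coord_form_nonneg: "0 \<le> coord_form k F"
  unfolding coord_form_def by (intro sum_nonneg mult_nonneg_nonneg box_mass_nonneg) auto

lemma nn_integral_coord_form:
  assumes k: "k \<le> N"
  shows "(\<integral>\<^sup>+x. \<integral>\<^sup>+y. ennreal ((F (sig x) - F (sig (x(k := y))))\<^sup>2) \<partial>D k \<partial>M) = ennreal (coord_form k F)"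
proof -
  have "(\<integral>\<^sup>+x. \<integral>\<^sup>+y. ennreal ((F (sig x) - F (sig (x(k := y))))\<^sup>2) \<partial>D k \<partial>M)
     = (\<integral>\<^sup>+x. \<integral>\<^sup>+y. ennreal ((F (sig x) - F ((sig x)(k := Co.cell y)))\<^sup>2) \<partial>D k \<partial>M)"
    by (simp only: sig_upd[OF k])
  also have "\<dots> = (\<integral>\<^sup>+x. (\<Sum>j\<in>{1..J}. ennreal (measure (D k) (A j)) * ennreal ((F (sig x) - F ((sig x)(k := j)))\<^sup>2)) \<partial>M)"
    by (intro nn_integral_cong
        Co.nn_integral_cell[where g="\<lambda>j. ennreal ((F (sig x) - F ((sig x)(k := j)))\<^sup>2)" for x])
  also have "\<dots> = (\<Sum>s\<in>{..N} \<rightarrow>\<^sub>E {1..J}. ennreal (box_mass s)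
      * (\<Sum>j\<in>{1..J}. ennreal (measure (D k) (A j)) * ennreal ((F s - F (s(k := j)))\<^sup>2)))"
    by (rule nn_integral_sig[of "\<lambda>s. \<Sum>j\<in>{1..J}. ennreal (measure (D k) (A j)) * ennreal ((F s - F (s(k := j)))\<^sup>2)"])
  also have "\<dots> = ennreal (coord_form k F)"
    unfolding coord_form_def
    by (simp add: ennreal_mult'[symmetric] sum_ennreal sum_nonneg box_mass_nonneg sum_distrib_left mult.assoc)
  finally show ?thesis .
qed

text \<open>Coordinate 0 has law \<open>D 0\<close> already, so it may be redrawn before the
  comparison. This turns the difference of \<open>F s\<close> and \<open>F (s(0 := j))\<close> into
  a difference over two independent labels \<open>i\<close> and \<open>j\<close>, and for fixed
  other labels their sum is the one in \<open>gap_fin_energy\<close>.\<close>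

lemma gap_fin_coord:
  assumes \<gamma>: "cell_weights (\<lambda>k j. measure (D k) (A j)) N J \<gamma>"
  shows "ennreal (gap_fin {1..J} (\<lambda>j. measure (D 0) (A j)) (Co.proj 0) * coord_form 0 F) \<le> energyc 0 (\<lambda>x. F (sig x))"
proof -
  interpret W: cell_weights "\<lambda>k j. measure (D k) (A j)" N J \<gamma> by fact
  let ?g = "gap_fin {1..J} (\<lambda>j. measure (D 0) (A j)) (Co.proj 0)" and ?w = "\<lambda>j. measure (D 0) (A j)"
  define \<Psi> where "\<Psi> s = (\<Sum>j\<in>{1..J}. ?w j * (F s - F (s(0 := j)))\<^sup>2)" for s
  have Wb: "W.weight = box_mass" by (simp add: fun_eq_iff W.weight_def box_mass_def)
  let ?\<Phi> = "\<lambda>s. \<Sum>i\<in>{1..J}. \<Sum>j\<in>{1..J}. ?w i * ?w j * (F (s(0 := i)) - F (s(0 := j)))\<^sup>2"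
  have "coord_form 0 F = (\<Sum>s\<in>{..N} \<rightarrow>\<^sub>E {1..J}. box_mass s * \<Psi> s * (\<Sum>i\<in>{1..J}. ?w i))"
    unfolding coord_form_def W.w_sum[OF le0] \<Psi>_def by (simp add: sum_distrib_left mult.assoc)
  also have "\<dots> = (\<Sum>s\<in>{..N} \<rightarrow>\<^sub>E {1..J}. \<Sum>i\<in>{1..J}. box_mass s * ?w i * \<Psi> s)"
    by (simp only: sum_distrib_left mult_ac)
  also have "\<dots> = (\<Sum>s\<in>{..N} \<rightarrow>\<^sub>E {1..J}. \<Sum>i\<in>{1..J}. box_mass s * ?w i * \<Psi> (s(0 := i)))"
    using W.sum_resample[of 0 "\<lambda>s _. \<Psi> s"] unfolding Wb by simp
  also have "\<dots> = (\<Sum>s\<in>{..N} \<rightarrow>\<^sub>E {1..J}. box_mass s * ?\<Phi> s)"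
    by (simp add: \<Psi>_def sum_distrib_left mult.assoc)
  finally have cf: "coord_form 0 F = (\<Sum>s\<in>{..N} \<rightarrow>\<^sub>E {1..J}. box_mass s * ?\<Phi> s)" .
  have \<Phi>0: "0 \<le> ?\<Phi> s" for s by (intro sum_nonneg mult_nonneg_nonneg) auto
  have "ennreal (?g * coord_form 0 F) = (\<Sum>s\<in>{..N} \<rightarrow>\<^sub>E {1..J}. ennreal (box_mass s) * (ennreal ?g * ennreal (?\<Phi> s)))"
    unfolding cf by (rule ennreal_mult_weighted_sum[OF Co.gap_fin_nonneg box_mass_nonneg \<Phi>0])
  also have "\<dots> = (\<integral>\<^sup>+x. ennreal ?g * ennreal (?\<Phi> (sig x)) \<partial>M)"
    by (rule nn_integral_sig[of "\<lambda>s. ennreal ?g * ennreal (?\<Phi> s)", symmetric])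
  also have "\<dots> \<le> (\<integral>\<^sup>+x. Co.energy 0 (\<lambda>u. F (sig (x(0 := u)))) \<partial>M)"
  proof (rule nn_integral_mono)
    fix x
    have "ennreal (?\<Phi> (sig x)) = (\<Sum>i\<in>{1..J}. \<Sum>j\<in>{1..J}. ennreal (?w i * ?w j * (F ((sig x)(0 := i)) - F ((sig x)(0 := j)))\<^sup>2))"
      by (simp add: sum_ennreal sum_nonneg)
    then show "ennreal ?g * ennreal (?\<Phi> (sig x)) \<le> Co.energy 0 (\<lambda>u. F (sig (x(0 := u))))"
      using Co.gap_fin_energy[of 0 "\<lambda>i. F ((sig x)(0 := i))"] by (simp only: sig_upd[OF le0])
  qed
  also have "\<dots> = energyc 0 (\<lambda>x. F (sig x))"
    by (rule energyc_slice[OF le0 measurable_sig_real, symmetric])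
  finally show ?thesis .
qed

text \<open>With the whole space as its only cell, \<open>avgc\<close> integrates a coordinate out
  and \<open>avgs_le\<close> becomes tensorisation of the variance.\<close>

lemma trivial_partition: "product_chain D K (\<lambda>_. space (D 0)) 1"
proof
  fix k
  show "(\<lambda>_. space (D 0)) j \<in> sets (D k)" for j :: nat by (simp add: space_D[of k, symmetric])
  show "measure (D k) (space (D 0)) > 0" for j :: nat
    by (simp add: space_D[of k, symmetric] Co.prob_space)
  show "(\<Union>j\<in>{1..1::nat}. space (D 0)) = space (D k)" by (simp add: space_D[of k])
  show "sets (D k) = sets (D 0)" by (rule sets_D)
qed auto

text \<open>Under the trivial partition the fully averaged function factors through a label vector
  that never changes, hence is the constant sought. What averaging a single coordinate costs is
  bounded by \<open>coord_form\<close> through Jensen, with the mean over an independent copy of the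
  coordinate.\<close>

proposition efron_stein_sig:
  "\<exists>c. (\<integral>\<^sup>+x. ennreal ((F (sig x) - c)\<^sup>2) \<partial>M) \<le> ennreal (\<Sum>k\<le>N. coord_form k F)"
proof -
  interpret Tr: product_chain D K "\<lambda>_. space (D 0)" 1 N by (rule trivial_partition)
  let ?h = "\<lambda>x. F (sig x)"
  have hm: "?h \<in> borel_measurable M" by (rule measurable_sig_real)
  obtain G where G: "\<And>x. x \<in> space M \<Longrightarrow> Tr.avgs (Suc N) ?h x = G (Tr.sig x)"
    using Tr.cell_inv_factor[OF Tr.cell_inv_avgs[OF le_imp_less_Suc order_refl]] by blast
  have sig1: "Tr.sig x = (\<lambda>k\<in>{..N}. 1)" if x: "x \<in> space M" for x
  proof (rule extensionalityI[of _ "{..N}"])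
    show "Tr.sig x \<in> extensional {..N}" using Tr.sig_mem[OF x] by (simp add: PiE_iff)
    show "Tr.sig x k = (\<lambda>k\<in>{..N}. 1) k" if "k \<in> {..N}" for k
      using PiE_mem[OF Tr.sig_mem[OF x] that] that by simp
  qed simp
  let ?c = "G (\<lambda>k\<in>{..N}. 1)"
  have "(\<integral>\<^sup>+x. ennreal ((?h x - ?c)\<^sup>2) \<partial>M) = (\<integral>\<^sup>+x. ennreal ((?h x - Tr.avgs (Suc N) ?h x)\<^sup>2) \<partial>M)"
    by (intro nn_integral_cong) (simp only: G sig1)
  also have "\<dots> \<le> (\<Sum>k<Suc N. \<integral>\<^sup>+x. ennreal ((?h x - Tr.avgc k ?h x)\<^sup>2) \<partial>M)"
    by (rule Tr.avgs_le[OF sig_L2fun order_refl])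
  also have "\<dots> \<le> (\<Sum>k<Suc N. ennreal (coord_form k F))"
  proof (intro sum_mono)
    fix k assume "k \<in> {..<Suc N}"
    then have k: "k \<le> N" by simp
    have "(\<integral>\<^sup>+x. ennreal ((?h x - Tr.avgc k ?h x)\<^sup>2) \<partial>M)
       \<le> (\<integral>\<^sup>+x. \<integral>\<^sup>+y. ennreal ((?h x - ?h (x(k := y)))\<^sup>2) \<partial>D k \<partial>M)"
    proof (rule nn_integral_mono)
      fix x assume x: "x \<in> space M"
      have m: "(\<lambda>y. ?h (x(k := y))) \<in> borel_measurable (D k)" by (rule measurable_slice[OF k x hm])
      have i: "integrable (D k) (\<lambda>y. ?h (x(k := y)))"
        using Co.L2fun_integrable[OF Co.cell_L2fun[of "\<lambda>j. F ((sig x)(k := j))" k]] by (simp add: sig_upd[OF k])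
      have "Tr.avgc k ?h x = (\<integral>y. ?h (x(k := y)) \<partial>D k)"
      proof -
        have "Tr.avgc k ?h x = (\<integral>y. indicator (space (D 0)) y * ?h (x(k := y)) \<partial>D k) / measure (D k) (space (D 0))"
          by (rule Tr.avgc_eq[OF x k])
        also have "\<dots> = (\<integral>y. ?h (x(k := y)) \<partial>D k)"
          unfolding space_D[of k, symmetric] Co.prob_space div_by_1
          by (intro Bochner_Integration.integral_cong) simp_all
        finally show ?thesis .
      qed
      then have "?h x - Tr.avgc k ?h x = (\<integral>y. ?h x - ?h (x(k := y)) \<partial>D k)"
        using i by (simp add: Co.prob_space)
      then show "ennreal ((?h x - Tr.avgc k ?h x)\<^sup>2) \<le> (\<integral>\<^sup>+y. ennreal ((?h x - ?h (x(k := y)))\<^sup>2) \<partial>D k)"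
        using Co.square_integral_le[of "\<lambda>y. ?h x - ?h (x(k := y))" k] m by simp
    qed
    also have "\<dots> = ennreal (coord_form k F)" by (rule nn_integral_coord_form[OF k])
    finally show "(\<integral>\<^sup>+x. ennreal ((?h x - Tr.avgc k ?h x)\<^sup>2) \<partial>M) \<le> ennreal (coord_form k F)" .
  qed
  also have "\<dots> = ennreal (\<Sum>k\<le>N. coord_form k F)"
    using coord_form_nonneg by (simp add: sum_ennreal lessThan_Suc_atMost)
  finally show ?thesis by (rule exI[of _ ?c])
qed

end

subsection \<open>The swap moves\<close>

lemma L2fun_mult_le_1:
  assumes f: "f \<in> L2fun M" and u: "u \<in> borel_measurable M" and le: "\<And>x. x \<in> space M \<Longrightarrow> \<bar>u x\<bar> \<le> 1"
  shows "(\<lambda>x. u x * f x) \<in> L2fun M"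
proof -
  have fm: "f \<in> borel_measurable M" using f by (simp add: L2fun_def)
  have "(\<integral>\<^sup>+x. ennreal ((u x * f x)\<^sup>2) \<partial>M) \<le> (\<integral>\<^sup>+x. ennreal ((f x)\<^sup>2) \<partial>M)"
  proof (intro nn_integral_mono ennreal_leI)
    fix x assume "x \<in> space M"
    then have "(u x)\<^sup>2 \<le> 1" using le abs_le_square_iff[of "u x" 1] by simp
    then have "(u x)\<^sup>2 * (f x)\<^sup>2 \<le> 1 * (f x)\<^sup>2" by (intro mult_right_mono) auto
    then show "(u x * f x)\<^sup>2 \<le> (f x)\<^sup>2" by (simp add: power_mult_distrib)
  qed
  then show ?thesis using f u fm by (auto simp: L2fun_iff_nn intro: le_less_trans)
qed

lemma inner_mu_commute: "inner_mu M f g = inner_mu M g f"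
  by (simp add: inner_mu_def mult.commute)

lemma inner_mu_add_right:
  assumes "f \<in> L2fun M" "g \<in> L2fun M" "h \<in> L2fun M"
  shows "inner_mu M f (\<lambda>x. g x + h x) = inner_mu M f g + inner_mu M f h"
  using L2fun_integrable_mult[OF assms(1,2)] L2fun_integrable_mult[OF assms(1,3)]
  by (simp add: inner_mu_def distrib_left)

lemma inner_mu_diff_right:
  assumes "f \<in> L2fun M" "g \<in> L2fun M" "h \<in> L2fun M"
  shows "inner_mu M f (\<lambda>x. g x - h x) = inner_mu M f g - inner_mu M f h"
  using L2fun_integrable_mult[OF assms(1,2)] L2fun_integrable_mult[OF assms(1,3)]
  by (simp add: inner_mu_def right_diff_distrib)

lemma inner_mu_cmult_right: "inner_mu M f (\<lambda>x. c * g x) = c * inner_mu M f g"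
  by (simp add: inner_mu_def mult.left_commute)

lemma inner_mu_sum_right:
  assumes "finite I" "f \<in> L2fun M" "\<And>i. i \<in> I \<Longrightarrow> g i \<in> L2fun M"
  shows "inner_mu M f (\<lambda>x. \<Sum>i\<in>I. g i x) = (\<Sum>i\<in>I. inner_mu M f (g i))"
  unfolding inner_mu_def sum_distrib_left
  by (intro Bochner_Integration.integral_sum L2fun_integrable_mult assms)

lemma nn_integral_square:
  assumes "f \<in> L2fun M"
  shows "(\<integral>\<^sup>+x. ennreal ((f x)\<^sup>2) \<partial>M) = ennreal (inner_mu M f f)"
  unfolding inner_mu_def power2_eq_square[symmetric]
  using assms by (intro nn_integral_eq_integral) (auto simp: L2fun_def)

lemma inner_mu_self_nonneg: "0 \<le> inner_mu M f f"
  by (simp add: inner_mu_def)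

lemma (in product_chain) measurable_swp:
  assumes l: "l < N"
  shows "swp l \<in> M \<rightarrow>\<^sub>M M"
proof (rule measurable_PiM_single')
  have "(\<lambda>x. swp l x i) \<in> M \<rightarrow>\<^sub>M D i" if i: "i \<le> N" for i
  proof -
    define i' where "i' = (if i = l then Suc l else if i = Suc l then l else i)"
    have "(\<lambda>x. x i') \<in> M \<rightarrow>\<^sub>M D i'" using l i by (intro measurable_coord) (simp add: i'_def)
    moreover have "sets (D i') = sets (D i)" using sets_D[of i] sets_D[of i'] by simp
    moreover have "swp l x i = x i'" for x :: "nat \<Rightarrow> 'a" by (simp add: swp_def i'_def)
    ultimately show ?thesis using measurable_cong_sets[OF refl, of "D i'" "D i" M] by simp
  qed
  then show "(\<lambda>x. swp l x i) \<in> M \<rightarrow>\<^sub>M D i" if "i \<in> {..N}" for i using that by simp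
  show "swp l \<in> space M \<rightarrow> (\<Pi>\<^sub>E i\<in>{..N}. space (D i))"
  proof
    fix x assume x: "x \<in> space M"
    have "swp l x i \<in> space (D i)" if "i \<le> N" for i
      using space_M_coord[OF x, of i] space_M_coord[OF x, of l] space_M_coord[OF x, of "Suc l"] l that
        space_D[of i] space_D[of l] space_D[of "Suc l"] by (auto simp: swp_def)
    moreover have "swp l x \<in> extensional {..N}"
      using x l by (auto simp: space_PiM PiE_iff extensional_def swp_def)
    ultimately show "swp l x \<in> (\<Pi>\<^sub>E i\<in>{..N}. space (D i))" by (simp add: PiE_iff)
  qed
qed

text \<open>Besides measurability, three facts about the acceptance probability \<open>q\<close> are
  kept: its range; detailed balance, in the form that the measure with density \<open>q l\<close> is
  invariant under the swap; and a lower bound for the accepted mass starting in each box.\<close>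

locale swap_chain = product_chain D K A J N
  for D :: "nat \<Rightarrow> 'a measure" and K A J N +
  fixes q :: "nat \<Rightarrow> (nat \<Rightarrow> 'a) \<Rightarrow> real" and \<delta> :: real
  assumes N_pos: "N \<ge> 1"
    and q_meas: "\<And>l. l < N \<Longrightarrow> q l \<in> borel_measurable M"
    and q_range: "\<And>l x. l < N \<Longrightarrow> x \<in> space M \<Longrightarrow> 0 \<le> q l x \<and> q l x \<le> 1"
    and q_inv: "\<And>l G. l < N \<Longrightarrow> G \<in> borel_measurable M \<Longrightarrow>
        (\<integral>\<^sup>+x. ennreal (q l x) * G (swp l x) \<partial>M) = (\<integral>\<^sup>+x. ennreal (q l x) * G x \<partial>M)"
    and q_flow: "\<And>l s. l < N \<Longrightarrow> s \<in> {..N} \<rightarrow>\<^sub>E {1..J} \<Longrightarrow>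
        ennreal (\<delta>\<^sup>2 * box_mass s) \<le> (\<integral>\<^sup>+x. ennreal (q l x) * indicator (Pi\<^sub>E {..N} (\<lambda>k. A (s k))) x \<partial>M)"
begin

lemma sig_swp: "l < N \<Longrightarrow> sig (swp l x) = swp l (sig x)"
  by (auto simp: sig_def swp_def fun_eq_iff)

lemma q_abs: "l < N \<Longrightarrow> x \<in> space M \<Longrightarrow> \<bar>q l x\<bar> \<le> 1"
  using q_range[of l x] by simp

lemma measurable_comp_swp: "l < N \<Longrightarrow> f \<in> M \<rightarrow>\<^sub>M R \<Longrightarrow> (\<lambda>x. f (swp l x)) \<in> M \<rightarrow>\<^sub>M R"
  by (rule measurable_compose[OF measurable_swp])

text \<open>Invariance is assumed for nonnegative integrands. Read as the equality of a measure with
  its image, it carries over to Bochner integrals with no integrability condition.\<close>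

lemma q_integral_swp:
  fixes G :: "(nat \<Rightarrow> 'a) \<Rightarrow> real"
  assumes l: "l < N" and G: "G \<in> borel_measurable M"
  shows "(\<integral>x. q l x * G (swp l x) \<partial>M) = (\<integral>x. q l x * G x \<partial>M)"
proof -
  let ?\<mu> = "density M (\<lambda>x. ennreal (q l x))"
  note [measurable] = q_meas[OF l]
  have qn: "AE x in M. 0 \<le> q l x" using q_range[OF l] by (intro AE_I2) simp
  have s: "swp l \<in> ?\<mu> \<rightarrow>\<^sub>M M" using measurable_swp[OF l] by simp
  have "distr ?\<mu> M (swp l) = ?\<mu>"
  proof (rule measure_eqI)
    fix B assume "B \<in> sets (distr ?\<mu> M (swp l))"
    then have B: "B \<in> sets M" by simp
    have "emeasure (distr ?\<mu> M (swp l)) B = (\<integral>\<^sup>+x. indicator B x \<partial>distr ?\<mu> M (swp l))"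
      using B by simp
    also have "\<dots> = (\<integral>\<^sup>+x. indicator B (swp l x) \<partial>?\<mu>)"
      using B by (intro nn_integral_distr s) simp
    also have "\<dots> = (\<integral>\<^sup>+x. ennreal (q l x) * indicator B (swp l x) \<partial>M)"
      using measurable_comp_swp[OF l borel_measurable_indicator[OF B]] by (intro nn_integral_density) simp_all
    also have "\<dots> = (\<integral>\<^sup>+x. ennreal (q l x) * indicator B x \<partial>M)"
      using B by (intro q_inv l) simp
    also have "\<dots> = emeasure ?\<mu> B" using B by (simp add: emeasure_density)
    finally show "emeasure (distr ?\<mu> M (swp l)) B = emeasure ?\<mu> B" .
  qed simp
  then have "(\<integral>x. G x \<partial>?\<mu>) = (\<integral>x. G x \<partial>distr ?\<mu> M (swp l))" by simp
  also have "\<dots> = (\<integral>x. G (swp l x) \<partial>?\<mu>)" by (rule integral_distr[OF s G])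
  finally show ?thesis
    using integral_density[OF G q_meas[OF l] qn] integral_density[OF measurable_comp_swp[OF l G] q_meas[OF l] qn]
    by simp
qed

text \<open>Since the swap need not preserve \<open>M\<close>, \<open>f (swp l x)\<close> alone may
  fail to be square-integrable. With the weight \<open>q l\<close>, the inequality
  \<open>q\<^sup>2 \<le> q\<close> and invariance bound its norm by that of
  \<open>f\<close>.\<close>

lemma q_swp_L2fun:
  assumes l: "l < N" and f: "f \<in> L2fun M"
  shows "(\<lambda>x. q l x * f (swp l x)) \<in> L2fun M"
proof -
  have fm: "f \<in> borel_measurable M" using f by (simp add: L2fun_def)
  note [measurable] = q_meas[OF l] fm measurable_comp_swp[OF l fm]
  have "(\<integral>\<^sup>+x. ennreal ((q l x * f (swp l x))\<^sup>2) \<partial>M) \<le> (\<integral>\<^sup>+x. ennreal (q l x) * ennreal ((f (swp l x))\<^sup>2) \<partial>M)"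
  proof (rule nn_integral_mono)
    fix x assume "x \<in> space M"
    then have q: "0 \<le> q l x" "q l x \<le> 1" using q_range[OF l] by auto
    have "(q l x)\<^sup>2 \<le> q l x" using q by (simp add: power2_eq_square mult_left_le)
    then have "(q l x)\<^sup>2 * (f (swp l x))\<^sup>2 \<le> q l x * (f (swp l x))\<^sup>2" by (rule mult_right_mono) simp
    then show "ennreal ((q l x * f (swp l x))\<^sup>2) \<le> ennreal (q l x) * ennreal ((f (swp l x))\<^sup>2)"
      using q by (simp add: power_mult_distrib ennreal_mult[symmetric] ennreal_leI)
  qed
  also have "\<dots> = (\<integral>\<^sup>+x. ennreal (q l x) * ennreal ((f x)\<^sup>2) \<partial>M)"
    by (rule q_inv[OF l, of "\<lambda>x. ennreal ((f x)\<^sup>2)"]) measurable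
  also have "\<dots> \<le> (\<integral>\<^sup>+x. ennreal ((f x)\<^sup>2) \<partial>M)"
  proof (rule nn_integral_mono)
    fix x assume "x \<in> space M"
    then have "0 \<le> q l x" "q l x \<le> 1" using q_range[OF l] by auto
    then show "ennreal (q l x) * ennreal ((f x)\<^sup>2) \<le> ennreal ((f x)\<^sup>2)"
      by (simp add: ennreal_mult[symmetric] ennreal_leI mult_right_le_one_le mult_left_le_one_le)
  qed
  finally show ?thesis using f by (auto simp: L2fun_iff_nn intro: le_less_trans)
qed

definition swap_op :: "nat \<Rightarrow> ((nat \<Rightarrow> 'a) \<Rightarrow> real) \<Rightarrow> (nat \<Rightarrow> 'a) \<Rightarrow> real" where
  "swap_op l f x = q l x * f (swp l x) + (1 - q l x) * f x"

definition swap_energy :: "nat \<Rightarrow> ((nat \<Rightarrow> 'a) \<Rightarrow> real) \<Rightarrow> real" where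
  "swap_energy l f = (\<integral>x. q l x * (f x - f (swp l x))\<^sup>2 \<partial>M)"

lemma swap_op_L2fun:
  assumes l: "l < N" and f: "f \<in> L2fun M"
  shows "swap_op l f \<in> L2fun M"
proof -
  have "(\<lambda>x. (1 - q l x) * f x) \<in> L2fun M"
    using q_meas[OF l] q_range[OF l] by (intro L2fun_mult_le_1[OF f]) auto
  from L2fun_add[OF q_swp_L2fun[OF l f] this] show ?thesis
    unfolding swap_op_def[abs_def] .
qed

text \<open>The accepted part is symmetric by invariance applied to
  \<open>f x * g (swp l x)\<close>, and the rejected part is multiplication by a function.\<close>

lemma swap_op_selfadjoint:
  assumes l: "l < N" and f: "f \<in> L2fun M" and g: "g \<in> L2fun M"
  shows "inner_mu M f (swap_op l g) = inner_mu M (swap_op l f) g"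
proof -
  have fm: "f \<in> borel_measurable M" and gm: "g \<in> borel_measurable M" using f g by (auto simp: L2fun_def)
  have qf: "(\<lambda>x. (1 - q l x) * u x) \<in> L2fun M" if "u \<in> L2fun M" for u
    using q_meas[OF l] q_range[OF l] by (intro L2fun_mult_le_1[OF that]) auto
  have "(\<integral>x. q l x * (f (swp l x) * g (swp l (swp l x))) \<partial>M) = (\<integral>x. q l x * (f x * g (swp l x)) \<partial>M)"
    using fm measurable_comp_swp[OF l gm]
    by (intro q_integral_swp[OF l, of "\<lambda>x. f x * g (swp l x)"] borel_measurable_times)
  then have sw: "inner_mu M f (\<lambda>x. q l x * g (swp l x)) = inner_mu M g (\<lambda>x. q l x * f (swp l x))"
    by (simp add: inner_mu_def swp_swp mult_ac)
  have "inner_mu M f (swap_op l g) = inner_mu M f (\<lambda>x. q l x * g (swp l x)) + inner_mu M f (\<lambda>x. (1 - q l x) * g x)"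
    unfolding swap_op_def[abs_def] by (rule inner_mu_add_right[OF f q_swp_L2fun[OF l g] qf[OF g]])
  also have "inner_mu M f (\<lambda>x. (1 - q l x) * g x) = inner_mu M g (\<lambda>x. (1 - q l x) * f x)"
    by (simp add: inner_mu_def mult_ac)
  also have "inner_mu M f (\<lambda>x. q l x * g (swp l x)) + inner_mu M g (\<lambda>x. (1 - q l x) * f x) = inner_mu M g (swap_op l f)"
    unfolding swap_op_def[abs_def] sw by (rule inner_mu_add_right[OF g q_swp_L2fun[OF l f] qf[OF f], symmetric])
  finally show ?thesis by (simp only: inner_mu_commute)
qed

text \<open>By invariance the two square terms of the energy have equal integrals, which gives the
  inner product. Further, \<open>f - swap_op l f\<close> is \<open>q l\<close> times the increment
  of \<open>f\<close> along the swap, and \<open>q\<^sup>2 \<le> q\<close> bounds its squared norm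
  by the energy.\<close>

lemma
  assumes l: "l < N" and f: "f \<in> L2fun M"
  shows swap_energy_eq: "swap_energy l f = 2 * inner_mu M f (\<lambda>x. f x - swap_op l f x)"
    and swap_energy_ge: "inner_mu M (\<lambda>x. f x - swap_op l f x) (\<lambda>x. f x - swap_op l f x) \<le> swap_energy l f"
    and swap_energy_nonneg: "0 \<le> swap_energy l f"
    and nn_swap_energy: "(\<integral>\<^sup>+x. ennreal (q l x) * ennreal ((f x - f (swp l x))\<^sup>2) \<partial>M) = ennreal (swap_energy l f)"
proof -
  have fm: "f \<in> borel_measurable M" using f by (simp add: L2fun_def)
  note [measurable] = fm measurable_comp_swp[OF l fm] q_meas[OF l]
  have q0: "x \<in> space M \<Longrightarrow> 0 \<le> q l x" and q1: "x \<in> space M \<Longrightarrow> q l x \<le> 1" for x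
    using q_range[OF l] by auto
  have i1: "integrable M (\<lambda>x. q l x * (f x)\<^sup>2)"
    using L2fun_integrable_mult[OF f L2fun_mult_le_1[OF f q_meas[OF l] q_abs[OF l]]]
    by (simp add: power2_eq_square mult_ac)
  have i2: "integrable M (\<lambda>x. q l x * (f x * f (swp l x)))"
    using L2fun_integrable_mult[OF f q_swp_L2fun[OF l f]] by (simp add: mult_ac)
  have nn: "(\<integral>\<^sup>+x. ennreal (q l x * (f (swp l x))\<^sup>2) \<partial>M) = (\<integral>\<^sup>+x. ennreal (q l x * (f x)\<^sup>2) \<partial>M)"
  proof -
    have "(\<integral>\<^sup>+x. ennreal (q l x) * ennreal ((f (swp l x))\<^sup>2) \<partial>M) = (\<integral>\<^sup>+x. ennreal (q l x) * ennreal ((f x)\<^sup>2) \<partial>M)"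
      by (rule q_inv[OF l, of "\<lambda>x. ennreal ((f x)\<^sup>2)"]) measurable
    then show ?thesis by (simp add: ennreal_mult'')
  qed
  have i3: "integrable M (\<lambda>x. q l x * (f (swp l x))\<^sup>2)"
  proof (rule integrableI_nonneg)
    show "AE x in M. 0 \<le> q l x * (f (swp l x))\<^sup>2" using q0 by (intro AE_I2) simp
    have "(\<integral>\<^sup>+x. ennreal (q l x * (f x)\<^sup>2) \<partial>M) = ennreal (\<integral>x. q l x * (f x)\<^sup>2 \<partial>M)"
      using i1 q0 by (intro nn_integral_eq_integral AE_I2) auto
    then show "(\<integral>\<^sup>+x. ennreal (q l x * (f (swp l x))\<^sup>2) \<partial>M) < \<infinity>" unfolding nn by simp
  qed measurable
  have I3: "(\<integral>x. q l x * (f (swp l x))\<^sup>2 \<partial>M) = (\<integral>x. q l x * (f x)\<^sup>2 \<partial>M)"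
    by (rule q_integral_swp[OF l, of "\<lambda>x. (f x)\<^sup>2"]) measurable
  have ex: "q l x * (f x - f (swp l x))\<^sup>2 = q l x * (f x)\<^sup>2 - 2 * (q l x * (f x * f (swp l x))) + q l x * (f (swp l x))\<^sup>2" for x
    by (simp add: power2_eq_square algebra_simps)
  have int: "integrable M (\<lambda>x. q l x * (f x - f (swp l x))\<^sup>2)"
    unfolding ex using i1 i2 i3 by simp
  have "swap_energy l f = 2 * (\<integral>x. q l x * (f x)\<^sup>2 \<partial>M) - 2 * (\<integral>x. q l x * (f x * f (swp l x)) \<partial>M)"
    unfolding swap_energy_def ex using i1 i2 i3 I3 by simp
  also have "\<dots> = 2 * (\<integral>x. q l x * (f x)\<^sup>2 - q l x * (f x * f (swp l x)) \<partial>M)"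
    using i1 i2 by simp
  also have "(\<lambda>x. q l x * (f x)\<^sup>2 - q l x * (f x * f (swp l x))) = (\<lambda>x. f x * (f x - swap_op l f x))"
    by (auto simp: swap_op_def power2_eq_square algebra_simps)
  finally show "swap_energy l f = 2 * inner_mu M f (\<lambda>x. f x - swap_op l f x)"
    by (simp only: inner_mu_def)
  have d: "(\<lambda>x. f x - swap_op l f x) \<in> L2fun M" by (rule L2fun_diff[OF f swap_op_L2fun[OF l f]])
  show "inner_mu M (\<lambda>x. f x - swap_op l f x) (\<lambda>x. f x - swap_op l f x) \<le> swap_energy l f"
    unfolding inner_mu_def swap_energy_def
  proof (rule integral_mono[OF L2fun_integrable_mult[OF d d] int])
    fix x assume x: "x \<in> space M"
    have "(f x - swap_op l f x) * (f x - swap_op l f x) = (q l x)\<^sup>2 * (f x - f (swp l x))\<^sup>2"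
      by (simp add: swap_op_def power2_eq_square algebra_simps)
    also have "\<dots> \<le> q l x * (f x - f (swp l x))\<^sup>2"
      using q0[OF x] q1[OF x] by (intro mult_right_mono) (auto simp: power2_eq_square mult_left_le)
    finally show "(f x - swap_op l f x) * (f x - swap_op l f x) \<le> q l x * (f x - f (swp l x))\<^sup>2" .
  qed
  show "0 \<le> swap_energy l f"
    unfolding swap_energy_def using q0 by (intro Bochner_Integration.integral_nonneg) auto
  have "(\<integral>\<^sup>+x. ennreal (q l x) * ennreal ((f x - f (swp l x))\<^sup>2) \<partial>M) = (\<integral>\<^sup>+x. ennreal (q l x * (f x - f (swp l x))\<^sup>2) \<partial>M)"
    by (simp add: ennreal_mult'')
  also have "\<dots> = ennreal (swap_energy l f)"
    unfolding swap_energy_def using q0 int by (intro nn_integral_eq_integral AE_I2) auto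
  finally show "(\<integral>\<^sup>+x. ennreal (q l x) * ennreal ((f x - f (swp l x))\<^sup>2) \<partial>M) = ennreal (swap_energy l f)" .
qed

text \<open>Splitting the square of the sum gives the factor 2; the energy of \<open>r\<close> is at
  most four times its squared norm, which gives 8.\<close>

lemma swap_energy_add_le:
  assumes l: "l < N" and f: "f \<in> L2fun M" and r: "r \<in> L2fun M"
  shows "swap_energy l (\<lambda>x. f x + r x) \<le> 2 * swap_energy l f + 8 * inner_mu M r r"
proof -
  have fm: "f \<in> borel_measurable M" and rm: "r \<in> borel_measurable M" using f r by (auto simp: L2fun_def)
  note [measurable] = fm rm measurable_comp_swp[OF l fm] measurable_comp_swp[OF l rm] q_meas[OF l]
  let ?q = "\<lambda>x. ennreal (q l x)"
  have "(\<integral>\<^sup>+x. ?q x * ennreal ((f x + r x - (f (swp l x) + r (swp l x)))\<^sup>2) \<partial>M)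
    \<le> (\<integral>\<^sup>+x. 2 * (?q x * ennreal ((f x - f (swp l x))\<^sup>2)) + (4 * (?q x * ennreal ((r x)\<^sup>2)) + 4 * (?q x * ennreal ((r (swp l x))\<^sup>2))) \<partial>M)"
  proof (rule nn_integral_mono)
    fix x assume x: "x \<in> space M"
    have q: "0 \<le> q l x" using q_range[OF l x] by simp
    have 1: "(f x + r x - (f (swp l x) + r (swp l x)))\<^sup>2 \<le> 2 * (f x - f (swp l x))\<^sup>2 + 2 * (r x - r (swp l x))\<^sup>2"
      using square_diff_le[of "f x - f (swp l x)" "r (swp l x) - r x"]
      by (simp add: power2_commute[of "r (swp l x)"] algebra_simps)
    have 2: "2 * (r x - r (swp l x))\<^sup>2 \<le> 4 * (r x)\<^sup>2 + 4 * (r (swp l x))\<^sup>2"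
      using square_diff_le[of "r x" "r (swp l x)"] by simp
    have "(f x + r x - (f (swp l x) + r (swp l x)))\<^sup>2 \<le> 2 * (f x - f (swp l x))\<^sup>2 + (4 * (r x)\<^sup>2 + 4 * (r (swp l x))\<^sup>2)"
      using 1 2 by linarith
    from mult_left_mono[OF this q]
    have "ennreal (q l x * (f x + r x - (f (swp l x) + r (swp l x)))\<^sup>2)
       \<le> ennreal (2 * (q l x * (f x - f (swp l x))\<^sup>2) + (4 * (q l x * (r x)\<^sup>2) + 4 * (q l x * (r (swp l x))\<^sup>2)))"
      by (intro ennreal_leI) (simp add: algebra_simps)
    then show "?q x * ennreal ((f x + r x - (f (swp l x) + r (swp l x)))\<^sup>2)
      \<le> 2 * (?q x * ennreal ((f x - f (swp l x))\<^sup>2)) + (4 * (?q x * ennreal ((r x)\<^sup>2)) + 4 * (?q x * ennreal ((r (swp l x))\<^sup>2)))"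
      using q by (simp add: ennreal_mult)
  qed
  also have "\<dots> = 2 * (\<integral>\<^sup>+x. ?q x * ennreal ((f x - f (swp l x))\<^sup>2) \<partial>M)
    + (4 * (\<integral>\<^sup>+x. ?q x * ennreal ((r x)\<^sup>2) \<partial>M) + 4 * (\<integral>\<^sup>+x. ?q x * ennreal ((r (swp l x))\<^sup>2) \<partial>M))"
    by (subst nn_integral_add, measurable, subst nn_integral_add, measurable)
      (subst (1 2 3) nn_integral_cmult, measurable)
  also have "(\<integral>\<^sup>+x. ?q x * ennreal ((r (swp l x))\<^sup>2) \<partial>M) = (\<integral>\<^sup>+x. ?q x * ennreal ((r x)\<^sup>2) \<partial>M)"
    by (rule q_inv[OF l, of "\<lambda>x. ennreal ((r x)\<^sup>2)"]) measurable
  also have "2 * (\<integral>\<^sup>+x. ?q x * ennreal ((f x - f (swp l x))\<^sup>2) \<partial>M)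
    + (4 * (\<integral>\<^sup>+x. ?q x * ennreal ((r x)\<^sup>2) \<partial>M) + 4 * (\<integral>\<^sup>+x. ?q x * ennreal ((r x)\<^sup>2) \<partial>M))
    \<le> 2 * ennreal (swap_energy l f) + (4 * ennreal (inner_mu M r r) + 4 * ennreal (inner_mu M r r))"
  proof -
    have "(\<integral>\<^sup>+x. ?q x * ennreal ((r x)\<^sup>2) \<partial>M) \<le> ennreal (inner_mu M r r)"
      unfolding nn_integral_square[OF r, symmetric]
    proof (rule nn_integral_mono)
      fix x assume "x \<in> space M"
      then have "0 \<le> q l x" "q l x \<le> 1" using q_range[OF l] by auto
      then show "?q x * ennreal ((r x)\<^sup>2) \<le> ennreal ((r x)\<^sup>2)"
        by (simp add: ennreal_mult[symmetric] ennreal_leI mult_left_le_one_le)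
    qed
    then show ?thesis unfolding nn_swap_energy[OF l f] by (intro add_mono mult_left_mono) auto
  qed
  also have "\<dots> = ennreal (2 * swap_energy l f + 8 * inner_mu M r r)"
  proof -
    have "2 * ennreal (swap_energy l f) = ennreal (2 * swap_energy l f)"
      "4 * ennreal (inner_mu M r r) = ennreal (4 * inner_mu M r r)"
      by (simp_all add: ennreal_mult')
    then show ?thesis
      using swap_energy_nonneg[OF l f] inner_mu_self_nonneg[of M r]
      by (simp add: ennreal_plus[symmetric] del: ennreal_plus)
  qed
  finally have "ennreal (swap_energy l (\<lambda>x. f x + r x)) \<le> ennreal (2 * swap_energy l f + 8 * inner_mu M r r)"
    unfolding nn_swap_energy[OF l L2fun_add[OF f r]] .
  then show ?thesis
    using swap_energy_nonneg[OF l f] inner_mu_self_nonneg[of M r] by (subst (asm) ennreal_le_iff) auto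
qed

text \<open>On the box of \<open>s\<close> the squared increment of a label function is constant, so
  the accepted mass of the box can be replaced by its lower bound
  \<open>\<delta>\<^sup>2 * box_mass s\<close>.\<close>

lemma swap_energy_sig_ge:
  assumes l: "l < N"
  shows "\<delta>\<^sup>2 * (\<Sum>s\<in>{..N} \<rightarrow>\<^sub>E {1..J}. box_mass s * (F s - F (swp l s))\<^sup>2) \<le> swap_energy l (\<lambda>x. F (sig x))"
proof -
  let ?\<Phi> = "\<lambda>s. ennreal ((F s - F (swp l s))\<^sup>2)"
  have "ennreal (\<delta>\<^sup>2 * (\<Sum>s\<in>{..N} \<rightarrow>\<^sub>E {1..J}. box_mass s * (F s - F (swp l s))\<^sup>2))
    = (\<Sum>s\<in>{..N} \<rightarrow>\<^sub>E {1..J}. ?\<Phi> s * ennreal (\<delta>\<^sup>2 * box_mass s))"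
    unfolding sum_distrib_left
    by (simp add: ennreal_mult[symmetric] box_mass_nonneg sum_ennreal mult_ac)
  also have "\<dots> \<le> (\<Sum>s\<in>{..N} \<rightarrow>\<^sub>E {1..J}. ?\<Phi> s * (\<integral>\<^sup>+x. ennreal (q l x) * indicator (Pi\<^sub>E {..N} (\<lambda>k. A (s k))) x \<partial>M))"
    by (intro sum_mono mult_left_mono q_flow l) auto
  also have "\<dots> = (\<integral>\<^sup>+x. ennreal (q l x) * ?\<Phi> (sig x) \<partial>M)"
    using q_meas[OF l] by (intro nn_integral_sig_weighted[symmetric]) measurable
  also have "\<dots> = ennreal (swap_energy l (\<lambda>x. F (sig x)))"
    unfolding nn_swap_energy[OF l sig_L2fun, symmetric] by (simp only: sig_swp[OF l])
  finally show ?thesis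
    using swap_energy_nonneg[OF l sig_L2fun] by (subst (asm) ennreal_le_iff) auto
qed

section \<open>The Dirichlet form of the composed chain\<close>

definition swap_mix :: "((nat \<Rightarrow> 'a) \<Rightarrow> real) \<Rightarrow> (nat \<Rightarrow> 'a) \<Rightarrow> real" where
  "swap_mix f x = f x / 2 + (\<Sum>l<N. (1 / (2 * real N)) * swap_op l f x)"

definition update_mix :: "((nat \<Rightarrow> 'a) \<Rightarrow> real) \<Rightarrow> (nat \<Rightarrow> 'a) \<Rightarrow> real" where
  "update_mix f x = f x / 2 + (1 / (2 * real (N + 1))) * (\<Sum>k\<le>N. coord_op k f x)"

lemma half_L2fun: "f \<in> L2fun M \<Longrightarrow> (\<lambda>x. f x / 2) \<in> L2fun M"
  using L2fun_cmult[of f M "1/2"] by simp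

lemma swap_mix_L2fun: "f \<in> L2fun M \<Longrightarrow> swap_mix f \<in> L2fun M"
  unfolding swap_mix_def[abs_def] by (intro L2fun_add L2fun_sum L2fun_cmult swap_op_L2fun half_L2fun) auto

lemma update_mix_L2fun: "f \<in> L2fun M \<Longrightarrow> update_mix f \<in> L2fun M"
  unfolding update_mix_def[abs_def] by (intro L2fun_add L2fun_sum L2fun_cmult coord_op_L2fun half_L2fun) auto

lemma swap_mix_diff: "f x - swap_mix f x = (1 / (2 * real N)) * (\<Sum>l<N. f x - swap_op l f x)"
  using N_pos unfolding swap_mix_def sum_distrib_left[symmetric]
  by (simp add: sum_subtractf field_simps)

lemma update_mix_diff: "f x - update_mix f x = (1 / (2 * real (N + 1))) * (\<Sum>k\<le>N. f x - coord_op k f x)"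
  unfolding update_mix_def by (simp add: sum_subtractf field_simps)

lemma swap_mix_selfadjoint:
  assumes f: "f \<in> L2fun M" and g: "g \<in> L2fun M"
  shows "inner_mu M f (swap_mix g) = inner_mu M (swap_mix f) g"
proof -
  have ex: "inner_mu M u (swap_mix v) = (1/2) * inner_mu M u v + (\<Sum>l<N. (1 / (2 * real N)) * inner_mu M u (swap_op l v))"
    if u: "u \<in> L2fun M" and v: "v \<in> L2fun M" for u v
  proof -
    have sv: "\<And>l. l \<in> {..<N} \<Longrightarrow> (\<lambda>x. (1 / (2 * real N)) * swap_op l v x) \<in> L2fun M"
      by (intro L2fun_cmult swap_op_L2fun v) simp
    have "inner_mu M u (swap_mix v) = inner_mu M u (\<lambda>x. (1/2) * v x + (\<Sum>l<N. (1 / (2 * real N)) * swap_op l v x))"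
      unfolding swap_mix_def[abs_def] by simp
    also have "\<dots> = inner_mu M u (\<lambda>x. (1/2) * v x) + inner_mu M u (\<lambda>x. \<Sum>l<N. (1 / (2 * real N)) * swap_op l v x)"
      by (intro inner_mu_add_right u L2fun_cmult v L2fun_sum sv) simp
    also have "inner_mu M u (\<lambda>x. \<Sum>l<N. (1 / (2 * real N)) * swap_op l v x)
        = (\<Sum>l<N. inner_mu M u (\<lambda>x. (1 / (2 * real N)) * swap_op l v x))"
      by (intro inner_mu_sum_right u sv) simp
    finally show ?thesis by (simp only: inner_mu_cmult_right)
  qed
  have "inner_mu M f (swap_op l g) = inner_mu M g (swap_op l f)" if "l < N" for l
    using swap_op_selfadjoint[OF that f g] by (simp only: inner_mu_commute)
  then have "inner_mu M f (swap_mix g) = inner_mu M g (swap_mix f)"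
    unfolding ex[OF f g] ex[OF g f] by (simp add: inner_mu_commute[of M f g])
  then show ?thesis by (simp only: inner_mu_commute)
qed

definition coord_energy :: "nat \<Rightarrow> ((nat \<Rightarrow> 'a) \<Rightarrow> real) \<Rightarrow> real" where
  "coord_energy k f = 2 * inner_mu M f (\<lambda>x. f x - coord_op k f x)"

lemma coord_energy_nonneg: "k \<le> N \<Longrightarrow> f \<in> L2fun M \<Longrightarrow> 0 \<le> coord_energy k f"
  unfolding coord_energy_def using coord_op_nonneg[of k f] by simp

lemma energyc_coord_energy: "k \<le> N \<Longrightarrow> f \<in> L2fun M \<Longrightarrow> energyc k f = ennreal (coord_energy k f)"
  unfolding coord_energy_def by (rule energyc_eq)

lemma coord_energy_add_le:
  assumes k: "k \<le> N" and f: "f \<in> L2fun M" and r: "r \<in> L2fun M"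
  shows "coord_energy k (\<lambda>x. f x + r x) \<le> 2 * coord_energy k f + 8 * inner_mu M r r"
proof -
  have fm: "f \<in> borel_measurable M" and rm: "r \<in> borel_measurable M" using f r by (auto simp: L2fun_def)
  have "ennreal (coord_energy k (\<lambda>x. f x + r x)) \<le> 2 * energyc k f + 2 * energyc k r"
    using energyc_add_le[OF k fm rm] by (simp only: energyc_coord_energy[OF k L2fun_add[OF f r]])
  also have "\<dots> \<le> 2 * energyc k f + 2 * (4 * ennreal (inner_mu M r r))"
    using energyc_le[OF k rm] unfolding nn_integral_square[OF r] by (intro add_mono mult_left_mono) auto
  also have "\<dots> = ennreal (2 * coord_energy k f + 8 * inner_mu M r r)"
  proof -
    have "2 * energyc k f = ennreal (2 * coord_energy k f)"
      by (simp add: energyc_coord_energy[OF k f] ennreal_mult')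
    moreover have "2 * (4 * ennreal (inner_mu M r r)) = ennreal (8 * inner_mu M r r)"
    proof -
      have "2 * (4 * ennreal (inner_mu M r r)) = 8 * ennreal (inner_mu M r r)"
        by (simp add: mult.assoc[symmetric])
      then show ?thesis by (simp add: ennreal_mult')
    qed
    ultimately show ?thesis
      using coord_energy_nonneg[OF k f] inner_mu_self_nonneg[of M r]
      by (simp add: ennreal_plus[symmetric] del: ennreal_plus)
  qed
  finally show ?thesis
    using coord_energy_nonneg[OF k f] inner_mu_self_nonneg[of M r] by (subst (asm) ennreal_le_iff) auto
qed

text \<open>With \<open>g = swap_mix f\<close> and \<open>e = f - g\<close>, selfadjointness makes
  \<open>Y\<close> equal to \<open>ET\<close> plus the difference of the squared norms of
  \<open>f\<close> and \<open>g\<close>. That difference is \<open>2 * EQ\<close> minus the squared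
  norm of \<open>e\<close>. As this norm is at most \<open>EQ\<close>, \<open>Y\<close> dominates
  \<open>EQ + ET\<close>, which controls the swaps at \<open>f\<close>, and also
  \<open>inner_mu M e e + ET\<close>, which controls the updates at
  \<open>f = g + e\<close>.\<close>

lemma
  assumes f: "f \<in> L2fun M"
  defines "Y \<equiv> dirichlet M (\<lambda>f. swap_mix (update_mix (swap_mix f))) f"
  shows coord_energy_sum_le: "(\<Sum>k\<le>N. coord_energy k f) \<le> 8 * real (N + 1) * Y"
    and swap_energy_sum_le: "(\<Sum>l<N. swap_energy l f) \<le> 4 * real N * Y"
    and dirichlet_mix_nonneg: "0 \<le> Y"
proof -
  define g where "g = swap_mix f"
  define e where "e = (\<lambda>x. f x - g x)"
  \<comment> \<open>The 4 combines the 2 in \<open>coord_energy\<close> with the probability 1/2 of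
    moving at all; likewise for \<open>EQ\<close>.\<close>
  define ET where "ET = (\<Sum>k\<le>N. coord_energy k g) / (4 * real (N + 1))"
  define EQ where "EQ = (\<Sum>l<N. swap_energy l f) / (4 * real N)"
  have g: "g \<in> L2fun M" unfolding g_def by (rule swap_mix_L2fun[OF f])
  have e: "e \<in> L2fun M" unfolding e_def by (rule L2fun_diff[OF f g])
  have Npos: "real N > 0" using N_pos by simp
  have T: "inner_mu M g (\<lambda>x. g x - update_mix g x) = ET"
  proof -
    have "inner_mu M g (\<lambda>x. g x - update_mix g x) = (1 / (2 * real (N + 1))) * (\<Sum>k\<le>N. inner_mu M g (\<lambda>x. g x - coord_op k g x))"
      unfolding update_mix_diff inner_mu_cmult_right
      by (subst inner_mu_sum_right) (auto intro!: L2fun_diff coord_op_L2fun g)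
    also have "\<dots> = (1 / (4 * real (N + 1))) * (\<Sum>k\<le>N. coord_energy k g)"
    proof -
      have "(1 / (2 * y)) * z = (1 / (4 * y)) * (2 * z)" for y z :: real by simp
      then show ?thesis unfolding coord_energy_def sum_distrib_left[symmetric] .
    qed
    finally show ?thesis unfolding ET_def by simp
  qed
  have Q: "inner_mu M f e = EQ"
  proof -
    have "inner_mu M f e = (1 / (2 * real N)) * (\<Sum>l<N. inner_mu M f (\<lambda>x. f x - swap_op l f x))"
      unfolding e_def g_def swap_mix_diff inner_mu_cmult_right
      by (subst inner_mu_sum_right) (auto intro!: L2fun_diff swap_op_L2fun f)
    also have "\<dots> = (1 / (4 * real N)) * (\<Sum>l<N. swap_energy l f)"
      using swap_energy_eq[OF _ f] by (simp add: sum_distrib_left[symmetric])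
    finally show ?thesis unfolding EQ_def by simp
  qed
  \<comment> \<open>Laziness of the swaps enters here: with weights \<open>1 / (2 * N)\<close>,
    Cauchy-Schwarz over the \<open>N\<close> swaps produces exactly the coefficient
    \<open>1 / (4 * N)\<close> of \<open>EQ\<close>.\<close>
  have ee: "inner_mu M e e \<le> EQ"
  proof -
    let ?d = "\<lambda>l x. f x - swap_op l f x"
    have d: "?d l \<in> L2fun M" if "l < N" for l by (intro L2fun_diff swap_op_L2fun f that)
    have "inner_mu M e e \<le> (\<integral>x. (1 / (4 * real N)) * (\<Sum>l<N. ?d l x * ?d l x) \<partial>M)"
      unfolding inner_mu_def
    proof (rule integral_mono)
      show "integrable M (\<lambda>x. e x * e x)" by (rule L2fun_integrable_mult[OF e e])
      show "integrable M (\<lambda>x. (1 / (4 * real N)) * (\<Sum>l<N. ?d l x * ?d l x))"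
        by (intro integrable_mult_right Bochner_Integration.integrable_sum L2fun_integrable_mult d) auto
      fix x
      have "(\<Sum>l<N. ?d l x)\<^sup>2 \<le> (\<Sum>l<N. (?d l x)\<^sup>2) * real N"
        using sum_squared_le_sum_of_squares[of "\<lambda>l. ?d l x" "{..<N}"] by simp
      then have "(1 / (2 * real N))\<^sup>2 * (\<Sum>l<N. ?d l x)\<^sup>2 \<le> (1 / (2 * real N))\<^sup>2 * ((\<Sum>l<N. (?d l x)\<^sup>2) * real N)"
        by (intro mult_left_mono) auto
      also have "\<dots> = (1 / (4 * real N)) * (\<Sum>l<N. (?d l x)\<^sup>2)"
        using Npos by (simp add: power2_eq_square field_simps)
      finally show "e x * e x \<le> (1 / (4 * real N)) * (\<Sum>l<N. ?d l x * ?d l x)"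
        unfolding e_def g_def swap_mix_diff by (simp add: power2_eq_square mult_ac)
    qed
    also have "\<dots> = (1 / (4 * real N)) * (\<Sum>l<N. inner_mu M (?d l) (?d l))"
    proof -
      have "(\<integral>x. (\<Sum>l<N. ?d l x * ?d l x) \<partial>M) = (\<Sum>l<N. inner_mu M (?d l) (?d l))"
        unfolding inner_mu_def by (intro Bochner_Integration.integral_sum L2fun_integrable_mult d) auto
      then show ?thesis by (simp only: integral_mult_right_zero)
    qed
    also have "\<dots> \<le> (1 / (4 * real N)) * (\<Sum>l<N. swap_energy l f)"
      using Npos by (intro mult_left_mono sum_mono swap_energy_ge f) auto
    finally show ?thesis unfolding EQ_def by simp
  qed
  have ug: "update_mix g \<in> L2fun M" by (rule update_mix_L2fun[OF g])
  have "Y = inner_mu M f f - inner_mu M f (swap_mix (update_mix g))"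
    unfolding Y_def dirichlet_def g_def[symmetric]
    by (rule inner_mu_diff_right[OF f f swap_mix_L2fun[OF ug]])
  also have "inner_mu M f (swap_mix (update_mix g)) = inner_mu M g (update_mix g)"
    unfolding g_def by (rule swap_mix_selfadjoint[OF f ug[unfolded g_def]])
  also have "inner_mu M g (update_mix g) = inner_mu M g g - ET"
    unfolding T[symmetric] inner_mu_diff_right[OF g g ug] by simp
  finally have Y: "Y = inner_mu M f f - inner_mu M g g + ET" by simp
  have "inner_mu M e e = inner_mu M e f - inner_mu M e g"
    using inner_mu_diff_right[OF e f g] by (simp only: e_def)
  also have "inner_mu M e f = EQ" using Q by (simp only: inner_mu_commute)
  also have "inner_mu M e g = inner_mu M g f - inner_mu M g g"
    unfolding inner_mu_commute[of M e g] using inner_mu_diff_right[OF g f g] by (simp only: e_def)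
  also have "inner_mu M g f = inner_mu M f f - EQ"
    unfolding inner_mu_commute[of M g f] using inner_mu_diff_right[OF f f g] Q unfolding e_def by linarith
  finally have "inner_mu M f f - inner_mu M g g = 2 * EQ - inner_mu M e e" by simp
  then have Y1: "EQ + ET \<le> Y" and Y2: "inner_mu M e e + ET \<le> Y" using Y ee by linarith+
  have ET0: "0 \<le> ET" unfolding ET_def by (intro divide_nonneg_nonneg sum_nonneg coord_energy_nonneg g) auto
  have EQ0: "0 \<le> EQ" unfolding EQ_def by (intro divide_nonneg_nonneg sum_nonneg swap_energy_nonneg f) auto
  show "0 \<le> Y" using Y1 ET0 EQ0 by linarith
  have "(\<Sum>l<N. swap_energy l f) = 4 * real N * EQ" unfolding EQ_def using Npos by simp
  also have "\<dots> \<le> 4 * real N * Y" using Y1 ET0 Npos by (intro mult_left_mono) auto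
  finally show "(\<Sum>l<N. swap_energy l f) \<le> 4 * real N * Y" .
  \<comment> \<open>The terms \<open>2 * coord_energy k g\<close> add up to
    \<open>8 * (N + 1) * ET\<close>, the same coefficient as that of the squared norm of
    \<open>e\<close>.\<close>
  have "(\<Sum>k\<le>N. coord_energy k f) \<le> (\<Sum>k\<le>N. 2 * coord_energy k g + 8 * inner_mu M e e)"
  proof (rule sum_mono)
    fix k assume "k \<in> {..N}"
    then show "coord_energy k f \<le> 2 * coord_energy k g + 8 * inner_mu M e e"
      using coord_energy_add_le[OF _ g e, of k] by (simp add: e_def)
  qed
  also have "\<dots> = 8 * real (N + 1) * (inner_mu M e e + ET)"
    unfolding ET_def by (simp add: sum.distrib sum_distrib_left[symmetric] field_simps)
  also have "\<dots> \<le> 8 * real (N + 1) * Y" using Y2 by (intro mult_left_mono) auto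
  finally show "(\<Sum>k\<le>N. coord_energy k f) \<le> 8 * real (N + 1) * Y" .
qed

text \<open>The second moment about \<open>c\<close> is the variance plus the squared distance from
  \<open>c\<close> to the mean.\<close>

lemma var_mu_le:
  assumes f: "f \<in> L2fun M"
  shows "var_mu M f \<le> inner_mu M (\<lambda>x. f x - c) (\<lambda>x. f x - c)"
proof -
  have one: "(\<lambda>_. d) \<in> L2fun M" for d by (rule P.L2fun_const)
  let ?m = "inner_mu M f (\<lambda>_. 1)"
  have fc: "(\<lambda>x. f x - c) \<in> L2fun M" by (rule L2fun_diff[OF f one])
  have c1: "inner_mu M g (\<lambda>_. c) = c * inner_mu M g (\<lambda>_. 1)" for g
    using inner_mu_cmult_right[of M g c "\<lambda>_. 1"] by simp
  have "inner_mu M (\<lambda>x. f x - c) (\<lambda>x. f x - c) = inner_mu M (\<lambda>x. f x - c) f - c * inner_mu M (\<lambda>x. f x - c) (\<lambda>_. 1)"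
    unfolding inner_mu_diff_right[OF fc f one] c1 ..
  also have "inner_mu M (\<lambda>x. f x - c) f = inner_mu M f f - c * ?m"
    unfolding inner_mu_commute[of M "\<lambda>x. f x - c" f] inner_mu_diff_right[OF f f one] c1 ..
  also have "inner_mu M (\<lambda>x. f x - c) (\<lambda>_. 1) = ?m - c"
    unfolding inner_mu_commute[of M "\<lambda>x. f x - c" "\<lambda>_. 1"] inner_mu_diff_right[OF one f one] c1
      inner_mu_commute[of M "\<lambda>_. 1" f]
    by (simp add: inner_mu_def P.prob_space)
  finally have "inner_mu M (\<lambda>x. f x - c) (\<lambda>x. f x - c) = var_mu M f + (?m - c)\<^sup>2"
    by (simp add: var_mu_def power2_eq_square algebra_simps)
  then show ?thesis by simp
qed

text \<open>The variance splits into \<open>R\<close>, the squared distance of \<open>f\<close> to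
  the label function, and the variance of the latter. Each resulting term is multiplied by both gaps
  \<open>c\<close> and \<open>d\<close>; where an estimate uses only one of them, the other is
  replaced by its bound 2.\<close>

proposition poincare_mix:
  assumes f: "f \<in> L2fun M"
    and \<delta>: "0 \<le> \<delta>" "\<delta> \<le> 1"
    and \<gamma>: "\<gamma> > 0" "\<And>j. j \<in> {1..J} \<Longrightarrow> \<gamma> \<le> (\<Prod>k\<in>{1..N}. min 1 (measure (D (k - 1)) (A j) / measure (D k) (A j)))"
    and c: "0 \<le> c" "c \<le> 2"
    and gap: "\<And>k j g. k \<le> N \<Longrightarrow> j \<in> {1..J} \<Longrightarrow> g \<in> L2fun (Co.cond k (A j)) \<Longrightarrow>
        c * var_mu (Co.cond k (A j)) g \<le> dirichlet (Co.cond k (A j)) (restr_op (K k) (A j)) g"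
  shows "\<gamma> ^ (J + 1) * \<delta>\<^sup>2 * gap_fin {1..J} (\<lambda>j. measure (D 0) (A j)) (Co.proj 0) * c * var_mu M f
     \<le> 2 ^ 12 * real (N + 1) ^ 4 * dirichlet M (\<lambda>f. swap_mix (update_mix (swap_mix f))) f"
proof -
  interpret W: cell_weights "\<lambda>k j. measure (D k) (A j)" N J \<gamma> by (rule cell_weights_cells) fact+
  define Y where "Y = dirichlet M (\<lambda>f. swap_mix (update_mix (swap_mix f))) f"
  define d where "d = gap_fin {1..J} (\<lambda>j. measure (D 0) (A j)) (Co.proj 0)"
  have d: "0 \<le> d" "d \<le> 2" unfolding d_def by (rule Co.gap_fin_nonneg Co.gap_fin_le_2)+
  obtain F where F: "\<And>x. x \<in> space M \<Longrightarrow> avgs (Suc N) f x = F (sig x)"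
    using cell_inv_factor[OF cell_inv_avgs[OF le_imp_less_Suc order_refl]] by blast
  define r where "r = (\<lambda>x. f x - F (sig x))"
  define r' where "r' = (\<lambda>x. F (sig x) - f x)"
  define R where "R = inner_mu M r r"
  have h: "(\<lambda>x. F (sig x)) \<in> L2fun M" by (rule sig_L2fun)
  have r: "r \<in> L2fun M" "r' \<in> L2fun M" unfolding r_def r'_def by (intro L2fun_diff f h)+
  have R': "inner_mu M r' r' = R" by (simp add: R_def r_def r'_def inner_mu_def algebra_simps)
  have R0: "0 \<le> R" unfolding R_def by (rule inner_mu_self_nonneg)
  have Y0: "0 \<le> Y" unfolding Y_def by (rule dirichlet_mix_nonneg[OF f])
  define a where "a = (\<Sum>k\<le>N. coord_energy k f)"
  define b where "b = (\<Sum>l<N. swap_energy l f)"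
  have aY: "a \<le> 8 * real (N + 1) * Y" unfolding a_def Y_def by (rule coord_energy_sum_le[OF f])
  have bY: "b \<le> 4 * real N * Y" unfolding b_def Y_def by (rule swap_energy_sum_le[OF f])
  have ab0: "0 \<le> a" "0 \<le> b"
    unfolding a_def b_def by (auto intro!: sum_nonneg coord_energy_nonneg swap_energy_nonneg f)
  have a0: "coord_energy 0 f \<le> a"
    unfolding a_def by (rule member_le_sum) (auto intro: coord_energy_nonneg f)

  \<comment> \<open>The local gaps give \<open>2 * c * R \<le> a\<close>, and \<open>a\<close> is at
    most \<open>8 * (N + 1) * Y\<close>.\<close>
  have cR: "c * R \<le> 4 * real (N + 1) * Y"
  proof -
    have "ennreal (2 * c * R) = ennreal (2 * c) * (\<integral>\<^sup>+x. ennreal ((f x - avgs (Suc N) f x)\<^sup>2) \<partial>M)"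
    proof -
      have "(\<integral>\<^sup>+x. ennreal ((f x - avgs (Suc N) f x)\<^sup>2) \<partial>M) = (\<integral>\<^sup>+x. ennreal ((r x)\<^sup>2) \<partial>M)"
        unfolding r_def by (intro nn_integral_cong) (simp only: F)
      then show ?thesis using c by (simp add: nn_integral_square[OF r(1)] R_def ennreal_mult')
    qed
    also have "\<dots> \<le> ennreal (2 * c) * (\<Sum>k<Suc N. \<integral>\<^sup>+x. ennreal ((f x - avgc k f x)\<^sup>2) \<partial>M)"
      by (intro mult_left_mono avgs_le f) auto
    also have "\<dots> \<le> (\<Sum>k<Suc N. ennreal (coord_energy k f))"
      unfolding sum_distrib_left
    proof (rule sum_mono)
      fix k assume "k \<in> {..<Suc N}"
      then have k: "k \<le> N" by simp
      show "ennreal (2 * c) * (\<integral>\<^sup>+x. ennreal ((f x - avgc k f x)\<^sup>2) \<partial>M) \<le> ennreal (coord_energy k f)"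
        unfolding energyc_coord_energy[OF k f, symmetric] by (rule poincare_coord[OF k f c(1) gap[OF k]])
    qed
    also have "\<dots> = ennreal a"
      unfolding a_def using coord_energy_nonneg[OF _ f] by (subst sum_ennreal) (auto simp: lessThan_Suc_atMost)
    finally have "2 * c * R \<le> a"
      using coord_energy_nonneg[OF _ f] unfolding a_def by (subst (asm) ennreal_le_iff) (auto intro!: sum_nonneg)
    then show ?thesis using aY by linarith
  qed

  define u where "u k = coord_form k F" for k
  define S where "S = (\<Sum>l<N. W.swap_form l F)"
  have Wb: "W.weight = box_mass" by (simp add: fun_eq_iff W.weight_def box_mass_def)
  have u_W: "u k = W.resample_form k F" for k by (simp add: u_def W.resample_form_def coord_form_def Wb)
  have u0: "0 \<le> u k" for k unfolding u_def by (rule coord_form_nonneg)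
  have S0: "0 \<le> S" unfolding S_def by (intro sum_nonneg W.swap_form_nonneg)

  have du: "d * u 0 \<le> 2 * a + 8 * R"
  proof -
    have "ennreal (d * u 0) \<le> ennreal (coord_energy 0 (\<lambda>x. F (sig x)))"
      unfolding energyc_coord_energy[OF le0 h, symmetric] u_def d_def
      by (rule gap_fin_coord[OF W.cell_weights_axioms])
    then have "d * u 0 \<le> coord_energy 0 (\<lambda>x. F (sig x))"
      using coord_energy_nonneg[OF le0 h] by (subst (asm) ennreal_le_iff) auto
    also have "(\<lambda>x. F (sig x)) = (\<lambda>x. f x + r' x)" by (simp add: r'_def)
    also have "coord_energy 0 (\<lambda>x. f x + r' x) \<le> 2 * coord_energy 0 f + 8 * inner_mu M r' r'"
      by (rule coord_energy_add_le[OF le0 f r(2)])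
    finally show ?thesis using a0 R' by linarith
  qed

  \<comment> \<open>Each of the \<open>N\<close> swap forms pays \<open>8 * R\<close> for the
    passage from \<open>f\<close> to the label function.\<close>
  have dS: "\<delta>\<^sup>2 * S \<le> 2 * b + 8 * real N * R"
  proof -
    have "\<delta>\<^sup>2 * S \<le> (\<Sum>l<N. 2 * swap_energy l f + 8 * R)"
      unfolding S_def sum_distrib_left
    proof (rule sum_mono)
      fix l assume "l \<in> {..<N}"
      then have l: "l < N" by simp
      have "\<delta>\<^sup>2 * W.swap_form l F \<le> swap_energy l (\<lambda>x. F (sig x))"
        unfolding W.swap_form_def Wb by (rule swap_energy_sig_ge[OF l])
      also have "(\<lambda>x. F (sig x)) = (\<lambda>x. f x + r' x)" by (simp add: r'_def)
      also have "swap_energy l (\<lambda>x. f x + r' x) \<le> 2 * swap_energy l f + 8 * inner_mu M r' r'"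
        by (rule swap_energy_add_le[OF l f r(2)])
      finally show "\<delta>\<^sup>2 * W.swap_form l F \<le> 2 * swap_energy l f + 8 * R" using R' by simp
    qed
    then show ?thesis by (simp add: sum.distrib sum_distrib_left[symmetric] b_def)
  qed

  define G where "G = \<gamma> ^ (J + 1)"
  have G: "0 \<le> G" "G \<le> 1" unfolding G_def using \<gamma>(1) W.gamma_le_1 by (auto intro!: power_le_one mult_le_one)
  have Gu: "G * (\<Sum>k\<le>N. u k) \<le> real (N + 1) * (6 * u 0 + 18 * real N * S)"
  proof -
    have "G * u k \<le> 6 * u 0 + 18 * real N * S" if k: "k \<le> N" for k
    proof (cases "k = 0")
      case True
      have "G * u 0 \<le> 1 * u 0" using G u0 by (intro mult_right_mono) auto
      moreover have "0 \<le> 18 * real N * S" using S0 by simp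
      ultimately show ?thesis using u0[of 0] unfolding True by linarith
    next
      case False
      have "G * u k \<le> 6 * u 0 + 18 * real k * S"
        unfolding G_def u_W S_def using W.resample_form_le[of k F] False k by simp
      also have "\<dots> \<le> 6 * u 0 + 18 * real N * S" using k S0 by (intro add_left_mono mult_right_mono) auto
      finally show ?thesis .
    qed
    then have "(\<Sum>k\<le>N. G * u k) \<le> (\<Sum>k\<le>N. 6 * u 0 + 18 * real N * S)" by (intro sum_mono) simp
    then show ?thesis by (simp add: sum_distrib_left)
  qed

  obtain m where m: "(\<integral>\<^sup>+x. ennreal ((F (sig x) - m)\<^sup>2) \<partial>M) \<le> ennreal (\<Sum>k\<le>N. u k)"
    using efron_stein_sig[of F] unfolding u_def by blast
  have hm: "(\<lambda>x. F (sig x) - m) \<in> L2fun M" by (intro L2fun_diff h P.L2fun_const)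
  define H where "H = inner_mu M (\<lambda>x. F (sig x) - m) (\<lambda>x. F (sig x) - m)"
  have H: "H \<le> (\<Sum>k\<le>N. u k)"
    using m unfolding nn_integral_square[OF hm] H_def by (subst (asm) ennreal_le_iff) (auto intro!: sum_nonneg u0)
  have var: "var_mu M f \<le> 2 * R + 2 * H"
  proof -
    have "var_mu M f \<le> inner_mu M (\<lambda>x. f x - m) (\<lambda>x. f x - m)" by (rule var_mu_le[OF f])
    also have "\<dots> \<le> (\<integral>x. 2 * (r x * r x) + 2 * ((F (sig x) - m) * (F (sig x) - m)) \<partial>M)"
      unfolding inner_mu_def
    proof (rule integral_mono)
      show "integrable M (\<lambda>x. (f x - m) * (f x - m))"
        by (intro L2fun_integrable_mult L2fun_diff f P.L2fun_const)
      show "integrable M (\<lambda>x. 2 * (r x * r x) + 2 * ((F (sig x) - m) * (F (sig x) - m)))"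
        using L2fun_integrable_mult[OF r(1) r(1)] L2fun_integrable_mult[OF hm hm] by simp
      fix x
      show "(f x - m) * (f x - m) \<le> 2 * (r x * r x) + 2 * ((F (sig x) - m) * (F (sig x) - m))"
        using square_diff_le[of "r x" "m - F (sig x)"]
        by (simp add: r_def power2_eq_square algebra_simps)
    qed
    also have "\<dots> = 2 * R + 2 * H"
      using L2fun_integrable_mult[OF r(1) r(1)] L2fun_integrable_mult[OF hm hm]
      by (simp add: R_def H_def inner_mu_def)
    finally show ?thesis .
  qed

  define n1 where "n1 = real (N + 1)"
  have n1: "1 \<le> n1" "real N = n1 - 1" by (simp_all add: n1_def)
  have d2: "0 \<le> \<delta>\<^sup>2" "\<delta>\<^sup>2 \<le> 1" using \<delta> by (auto simp: power_le_one)
  \<comment> \<open>The term \<open>a\<close> is already of order \<open>Y\<close>, so there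
    \<open>c \<le> 2\<close> is enough, while \<open>R\<close> needs the factor \<open>c\<close> to
    be bounded at all: 2 * 2 * 8 + 8 * 4 = 64.\<close>
  have cu: "c * (d * u 0) \<le> 64 * (n1 * Y)"
  proof -
    have "c * (d * u 0) \<le> c * (2 * a + 8 * R)" using du c by (intro mult_left_mono) auto
    also have "\<dots> = 2 * (c * a) + 8 * (c * R)" by (simp add: algebra_simps)
    also have "\<dots> \<le> 2 * (2 * (8 * n1 * Y)) + 8 * (4 * n1 * Y)"
    proof -
      have "c * a \<le> 2 * (8 * n1 * Y)" unfolding n1_def
        using c aY ab0 Y0 by (intro mult_mono) auto
      then show ?thesis using cR unfolding n1_def by linarith
    qed
    also have "\<dots> = 64 * (n1 * Y)" by simp
    finally show ?thesis .
  qed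
  have cS: "c * (\<delta>\<^sup>2 * S) \<le> 32 * (n1\<^sup>2 * Y)"
  proof -
    have "c * (\<delta>\<^sup>2 * S) \<le> c * (2 * b + 8 * real N * R)" using dS c by (intro mult_left_mono) auto
    also have "\<dots> = 2 * (c * b) + 8 * real N * (c * R)" by (simp add: algebra_simps)
    also have "\<dots> \<le> 2 * (2 * (4 * real N * Y)) + 8 * real N * (4 * n1 * Y)"
    proof (intro add_mono mult_left_mono[of "c * b"] mult_left_mono[of "c * R"])
      show "c * b \<le> 2 * (4 * real N * Y)" using c bY ab0 Y0 by (intro mult_mono) auto
      show "c * R \<le> 4 * n1 * Y" using cR by (simp only: n1_def)
    qed auto
    also have "\<dots> = (16 * real N + 32 * real N * n1) * Y" by (simp add: algebra_simps)
    \<comment> \<open>As \<open>N = n1 - 1\<close>, the product \<open>32 * N * n1\<close> leaves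
      room for \<open>16 * N\<close>.\<close>
    also have "\<dots> \<le> (32 * n1\<^sup>2) * Y"
      using Y0 n1 by (intro mult_right_mono) (auto simp: power2_eq_square algebra_simps)
    finally show ?thesis by simp
  qed
  \<comment> \<open>Here \<open>\<delta>\<^sup>2 \<le> 1\<close> serves the term with
    \<open>u 0\<close>, and \<open>d \<le> 2\<close> the term with \<open>S\<close>: 6 * 64 + 18 * 2
    * 32 = 1536.\<close>
  have main: "c * d * \<delta>\<^sup>2 * (G * (\<Sum>k\<le>N. u k)) \<le> 1536 * (n1 ^ 4 * Y)"
  proof -
    have "c * d * \<delta>\<^sup>2 * (G * (\<Sum>k\<le>N. u k)) \<le> c * d * \<delta>\<^sup>2 * (n1 * (6 * u 0 + 18 * real N * S))"
      using Gu c d d2 unfolding n1_def by (intro mult_left_mono) auto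
    also have "\<dots> = 6 * n1 * (\<delta>\<^sup>2 * (c * (d * u 0))) + 18 * real N * n1 * (d * (c * (\<delta>\<^sup>2 * S)))"
      by (simp add: algebra_simps)
    also have "\<dots> \<le> 6 * n1 * (1 * (64 * (n1 * Y))) + 18 * n1 * n1 * (2 * (32 * (n1\<^sup>2 * Y)))"
    proof -
      have p: "0 \<le> c * (d * u 0)" "0 \<le> c * (\<delta>\<^sup>2 * S)" using c d d2 u0 S0 by simp_all
      have "\<delta>\<^sup>2 * (c * (d * u 0)) \<le> 1 * (64 * (n1 * Y))"
        by (rule mult_mono[OF d2(2) cu _ p(1)]) simp
      then have t1: "6 * n1 * (\<delta>\<^sup>2 * (c * (d * u 0))) \<le> 6 * n1 * (1 * (64 * (n1 * Y)))"
        using n1 by (intro mult_left_mono) auto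
      have t2: "d * (c * (\<delta>\<^sup>2 * S)) \<le> 2 * (32 * (n1\<^sup>2 * Y))"
        by (rule mult_mono[OF d(2) cS _ p(2)]) simp
      have "18 * real N * n1 * (d * (c * (\<delta>\<^sup>2 * S))) \<le> 18 * n1 * n1 * (2 * (32 * (n1\<^sup>2 * Y)))"
      proof (rule mult_mono[OF _ t2])
        show "18 * real N * n1 \<le> 18 * n1 * n1" using n1 by (intro mult_right_mono) auto
        show "0 \<le> 18 * n1 * n1" using n1 by simp
        show "0 \<le> d * (c * (\<delta>\<^sup>2 * S))" by (rule mult_nonneg_nonneg[OF d(1) p(2)])
      qed
      with t1 show ?thesis by (rule add_mono)
    qed
    also have "\<dots> = 384 * (n1\<^sup>2 * Y) + 1152 * (n1 ^ 4 * Y)" by (simp add: power2_eq_square power4_eq_xxxx)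
    also have "\<dots> \<le> 384 * (n1 ^ 4 * Y) + 1152 * (n1 ^ 4 * Y)"
      using n1 Y0 by (intro add_mono mult_left_mono mult_right_mono power_increasing) auto
    also have "\<dots> = 1536 * (n1 ^ 4 * Y)" by simp
    finally show ?thesis .
  qed
  have n1_4: "n1 * Y \<le> n1 ^ 4 * Y"
    using n1 Y0 power_increasing[of 1 4 n1] by (intro mult_right_mono) auto
  have "G * \<delta>\<^sup>2 * d * c * var_mu M f \<le> G * \<delta>\<^sup>2 * d * c * (2 * R + 2 * (\<Sum>k\<le>N. u k))"
    using var H G d d2 c by (intro mult_left_mono) auto
  also have "\<dots> = 2 * ((G * \<delta>\<^sup>2) * (d * (c * R))) + 2 * (c * d * \<delta>\<^sup>2 * (G * (\<Sum>k\<le>N. u k)))"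
    by (simp add: algebra_simps)
  also have "\<dots> \<le> 2 * (1 * (2 * (4 * n1 * Y))) + 2 * (1536 * (n1 ^ 4 * Y))"
  proof (intro add_mono mult_left_mono[of "_ * _" _ 2] main)
    have cR0: "0 \<le> c * R" "c * R \<le> 4 * n1 * Y" using c R0 cR by (simp_all only: n1_def mult_nonneg_nonneg)
    have "d * (c * R) \<le> 2 * (4 * n1 * Y)" by (rule mult_mono[OF d(2) cR0(2) _ cR0(1)]) simp
    with mult_le_one[OF G(2) d2] show "(G * \<delta>\<^sup>2) * (d * (c * R)) \<le> 1 * (2 * (4 * n1 * Y))"
      by (rule mult_mono[OF _ _ _ mult_nonneg_nonneg[OF d(1) cR0(1)]]) simp
  qed auto
  \<comment> \<open>The sum is 16 + 2 * 1536 = 3088, and \<open>2 ^ 12\<close> is the next power of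
    two.\<close>
  also have "\<dots> \<le> 4096 * (n1 ^ 4 * Y)"
  proof -
    have "0 \<le> n1 ^ 4 * Y" using n1 Y0 by simp
    then show ?thesis using n1_4 by linarith
  qed
  also have "\<dots> = 2 ^ 12 * n1 ^ 4 * Y" by simp
  finally show ?thesis by (simp only: G_def d_def Y_def n1_def)
qed

end

subsection \<open>Densities on products of arbitrary measures\<close>

text \<open>Without sigma-finiteness \<^const>\<open>PiM\<close> is some extension of the rectangle masses picked by
  \<^const>\<open>Eps\<close>, or null if there is none. Densities with finite integrals still give
  the expected product, whatever the extension; on the null measure no function has positive variance.\<close>

lemma PiM_null_or_rectangles:
  fixes L :: "'a measure" and I :: "'i set"
  assumes I: "finite I" "I \<noteq> {}"
  obtains (null) "\<And>B. emeasure (PiM I (\<lambda>_. L)) B = 0"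
  | (rectangles) "\<And>X. (\<And>i. i \<in> I \<Longrightarrow> X i \<in> sets L) \<Longrightarrow>
      emeasure (PiM I (\<lambda>_. L)) (Pi\<^sub>E I X) = (\<Prod>i\<in>I. emeasure L (X i))"
proof -
  define \<Omega> where "\<Omega> = (\<Pi>\<^sub>E i\<in>I. space L)"
  define Ix where "Ix = {(J, X). (J \<noteq> {} \<or> I = {}) \<and> finite J \<and> J \<subseteq> I \<and> X \<in> (\<Pi> j\<in>J. sets L)}"
  define G where "G = (\<lambda>(J, X). prod_emb I (\<lambda>_. L) J (\<Pi>\<^sub>E j\<in>J. X j))"
  define \<mu> where "\<mu> = (\<lambda>(J, X). \<Prod>j\<in>J \<union> {i\<in>I. emeasure L (space L) \<noteq> 1}. if j \<in> J then emeasure L (X j) else emeasure L (space L))"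
  have PiM: "PiM I (\<lambda>_. L) = extend_measure \<Omega> Ix G \<mu>"
    unfolding PiM_def \<Omega>_def Ix_def G_def \<mu>_def ..
  have sub: "G ` Ix \<subseteq> Pow \<Omega>"
    unfolding \<Omega>_def G_def by (auto simp: prod_emb_def)
  show thesis
  proof (cases "\<exists>\<mu>'. (\<forall>i\<in>Ix. \<mu>' (G i) = \<mu> i) \<and> measure_space \<Omega> (sigma_sets \<Omega> (G ` Ix)) \<mu>'")
    case True
    then obtain \<mu>' where \<mu>': "\<And>i. i \<in> Ix \<Longrightarrow> \<mu>' (G i) = \<mu> i" "measure_space \<Omega> (sigma_sets \<Omega> (G ` Ix)) \<mu>'"
      by auto
    have sets: "sets (PiM I (\<lambda>_. L)) = sigma_sets \<Omega> (G ` Ix)"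
      unfolding PiM by (rule sets_extend_measure[OF sub])
    have "emeasure (PiM I (\<lambda>_. L)) (Pi\<^sub>E I X) = (\<Prod>i\<in>I. emeasure L (X i))"
      if X: "\<And>i. i \<in> I \<Longrightarrow> X i \<in> sets L" for X
    proof -
      have ix: "(I, X) \<in> Ix" unfolding Ix_def using I X by simp
      have "emeasure (PiM I (\<lambda>_. L)) (G (I, X)) = \<mu> (I, X)"
      proof (rule emeasure_extend_measure[OF PiM, where \<mu>'=\<mu>'])
        show "\<mu>' (G i) = \<mu> i" if "i \<in> Ix" for i by (rule \<mu>'(1)[OF that])
        show "positive (sets (PiM I (\<lambda>_. L))) \<mu>'" "countably_additive (sets (PiM I (\<lambda>_. L))) \<mu>'"
          using \<mu>'(2) unfolding measure_space_def sets by simp_all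
      qed (fact sub ix)+
      moreover have "G (I, X) = Pi\<^sub>E I X"
        unfolding G_def using X by (auto intro!: prod_emb_PiE_same_index sets.sets_into_space)
      \<comment> \<open>For the full index set, the extra factors that \<open>PiM\<close> attaches
        to components of total mass other than 1 are absent.\<close>
      moreover have "\<mu> (I, X) = (\<Prod>i\<in>I. emeasure L (X i))"
        unfolding \<mu>_def by (auto intro!: prod.cong simp: Un_absorb2)
      ultimately show ?thesis by simp
    qed
    then show thesis by (rule rectangles)
  next
    case False
    then have PiM0: "PiM I (\<lambda>_. L) = measure_of \<Omega> (G ` Ix) (\<lambda>_. 0)"
      unfolding PiM extend_measure_def by (simp only: simp_thms if_False)
    have "emeasure (PiM I (\<lambda>_. L)) B = 0" for B
    proof (cases "B \<in> sets (PiM I (\<lambda>_. L))")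
      case True
      have "measure_space \<Omega> (sigma_sets \<Omega> (G ` Ix)) (\<lambda>_. 0)" using sub by (rule measure_space_0)
      then show ?thesis
        using True sub unfolding PiM0
        by (subst emeasure_measure_of[OF refl]) (auto simp: measure_space_def)
    qed (simp add: emeasure_notin_sets)
    then show thesis by (rule null)
  qed
qed

text \<open>Both sides integrate \<open>g\<close> against a measure on \<open>L\<close>: the image
  of \<open>density \<Lambda> h\<close> under the coordinate, and \<open>C\<close> times
  \<open>L\<close>. By \<open>ind\<close> they agree on every measurable set, hence are equal, and
  no uniqueness theorem or finiteness enters.\<close>

lemma nn_integral_coordinate_factor:
  fixes h :: "('i \<Rightarrow> 'a) \<Rightarrow> ennreal"
  assumes h[measurable]: "h \<in> borel_measurable \<Lambda>" and p[measurable]: "(\<lambda>x. x i) \<in> \<Lambda> \<rightarrow>\<^sub>M L"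
    and ind: "\<And>X. X \<in> sets L \<Longrightarrow> (\<integral>\<^sup>+x. indicator X (x i) * h x \<partial>\<Lambda>) = emeasure L X * C"
    and g[measurable]: "g \<in> borel_measurable L"
  shows "(\<integral>\<^sup>+x. g (x i) * h x \<partial>\<Lambda>) = (\<integral>\<^sup>+y. g y \<partial>L) * C"
proof -
  have p': "(\<lambda>x. x i) \<in> density \<Lambda> h \<rightarrow>\<^sub>M L" using p by simp
  have "distr (density \<Lambda> h) L (\<lambda>x. x i) = density L (\<lambda>_. C)"
  proof (rule measure_eqI)
    fix X assume "X \<in> sets (distr (density \<Lambda> h) L (\<lambda>x. x i))"
    then have X[measurable]: "X \<in> sets L" by simp
    have "emeasure (distr (density \<Lambda> h) L (\<lambda>x. x i)) X = (\<integral>\<^sup>+y. indicator X y \<partial>distr (density \<Lambda> h) L (\<lambda>x. x i))"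
      by simp
    also have "\<dots> = (\<integral>\<^sup>+x. indicator X (x i) \<partial>density \<Lambda> h)"
      by (rule nn_integral_distr[OF p']) simp
    also have "\<dots> = (\<integral>\<^sup>+x. h x * indicator X (x i) \<partial>\<Lambda>)"
      by (rule nn_integral_density) measurable
    also have "\<dots> = emeasure L X * C" using ind[OF X] by (simp add: mult.commute)
    also have "\<dots> = emeasure (density L (\<lambda>_. C)) X"
      by (simp add: emeasure_density nn_integral_cmult mult.commute)
    finally show "emeasure (distr (density \<Lambda> h) L (\<lambda>x. x i)) X = emeasure (density L (\<lambda>_. C)) X" .
  qed simp
  then have "(\<integral>\<^sup>+y. g y \<partial>distr (density \<Lambda> h) L (\<lambda>x. x i)) = (\<integral>\<^sup>+y. g y \<partial>density L (\<lambda>_. C))" by simp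
  moreover have "(\<integral>\<^sup>+y. g y \<partial>distr (density \<Lambda> h) L (\<lambda>x. x i)) = (\<integral>\<^sup>+x. g (x i) \<partial>density \<Lambda> h)"
    by (rule nn_integral_distr[OF p']) simp
  moreover have "(\<integral>\<^sup>+x. g (x i) \<partial>density \<Lambda> h) = (\<integral>\<^sup>+x. h x * g (x i) \<partial>\<Lambda>)"
    by (rule nn_integral_density) measurable
  moreover have "(\<integral>\<^sup>+y. g y \<partial>density L (\<lambda>_. C)) = (\<integral>\<^sup>+y. C * g y \<partial>L)"
    by (rule nn_integral_density) measurable
  ultimately show ?thesis by (simp add: nn_integral_cmult mult.commute)
qed

text \<open>Any measure with the right masses on rectangles; it need not be determined by
  them.\<close>

locale rectangle_measure =
  fixes \<Lambda> :: "('i \<Rightarrow> 'a) measure" and L :: "'a measure" and I :: "'i set"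
  assumes finite_I: "finite I"
    and sets_Lam: "sets \<Lambda> = sets (PiM I (\<lambda>_. L))"
    and rect: "\<And>X. (\<And>i. i \<in> I \<Longrightarrow> X i \<in> sets L) \<Longrightarrow> emeasure \<Lambda> (Pi\<^sub>E I X) = (\<Prod>i\<in>I. emeasure L (X i))"
begin

lemma space_Lam: "space \<Lambda> = (\<Pi>\<^sub>E i\<in>I. space L)"
  using sets_eq_imp_space_eq[OF sets_Lam] by (simp add: space_PiM)

lemma measurable_Lam_coord: "i \<in> I \<Longrightarrow> (\<lambda>x. x i) \<in> \<Lambda> \<rightarrow>\<^sub>M L"
  using measurable_component_singleton[of i I "\<lambda>_. L"] measurable_cong_sets[OF sets_Lam refl] by blast

lemma measurable_Lam_prod:
  fixes f :: "'i \<Rightarrow> 'a \<Rightarrow> ennreal"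
  assumes "J \<subseteq> I" "\<And>i. i \<in> J \<Longrightarrow> f i \<in> borel_measurable L"
  shows "(\<lambda>x. \<Prod>i\<in>J. f i (x i)) \<in> borel_measurable \<Lambda>"
  using assms by (intro borel_measurable_prod_ennreal measurable_compose[OF measurable_Lam_coord]) auto

text \<open>Induction on the set \<open>S\<close> of coordinates whose factor is not an indicator.
  Putting an indicator in place of factor \<open>i\<close> gives a case covered by the induction
  hypothesis, and \<open>nn_integral_coordinate_factor\<close> recovers the general factor from it.
  Rectangle masses are all that is used, so neither Fubini nor sigma-finiteness is invoked.\<close>

lemma nn_integral_prod:
  fixes f :: "'i \<Rightarrow> 'a \<Rightarrow> ennreal"
  assumes f: "\<And>i. i \<in> I \<Longrightarrow> f i \<in> borel_measurable L"
  shows "(\<integral>\<^sup>+x. (\<Prod>i\<in>I. f i (x i)) \<partial>\<Lambda>) = (\<Prod>i\<in>I. \<integral>\<^sup>+y. f i y \<partial>L)"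
proof -
  have "finite S \<Longrightarrow> S \<subseteq> I \<Longrightarrow> (\<And>i. i \<in> I \<Longrightarrow> f i \<in> borel_measurable L) \<Longrightarrow>
      (\<And>i. i \<in> I - S \<Longrightarrow> \<exists>X\<in>sets L. f i = indicator X) \<Longrightarrow>
      (\<integral>\<^sup>+x. (\<Prod>i\<in>I. f i (x i)) \<partial>\<Lambda>) = (\<Prod>i\<in>I. \<integral>\<^sup>+y. f i y \<partial>L)" for S and f :: "'i \<Rightarrow> 'a \<Rightarrow> ennreal"
  proof (induction S arbitrary: f rule: finite_induct)
    case empty
    then obtain X where X: "\<And>i. i \<in> I \<Longrightarrow> X i \<in> sets L" "\<And>i. i \<in> I \<Longrightarrow> f i = indicator (X i)"
      by (metis Diff_empty)
    have box: "Pi\<^sub>E I X \<in> sets \<Lambda>" unfolding sets_Lam using X(1) finite_I by (intro sets_PiM_I_finite) auto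
    have "(\<integral>\<^sup>+x. (\<Prod>i\<in>I. f i (x i)) \<partial>\<Lambda>) = (\<integral>\<^sup>+x. indicator (Pi\<^sub>E I X) x \<partial>\<Lambda>)"
    proof (rule nn_integral_cong)
      fix x assume x: "x \<in> space \<Lambda>"
      then have ext: "x \<in> extensional I" by (auto simp: space_Lam PiE_iff)
      have "(\<Prod>i\<in>I. f i (x i)) = (\<Prod>i\<in>I. indicator (X i) (x i))" by (intro prod.cong) (simp_all add: X(2))
      also have "\<dots> = indicator (Pi\<^sub>E I X) x"
        using ext finite_I by (auto simp: indicator_def PiE_iff prod_eq_1_iff intro!: prod_zero)
      finally show "(\<Prod>i\<in>I. f i (x i)) = indicator (Pi\<^sub>E I X) x" .
    qed
    also have "\<dots> = (\<Prod>i\<in>I. emeasure L (X i))" using box rect[OF X(1)] by simp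
    also have "\<dots> = (\<Prod>i\<in>I. \<integral>\<^sup>+y. f i y \<partial>L)" by (intro prod.cong) (simp_all add: X)
    finally show ?case .
  next
    case (insert i S)
    have i: "i \<in> I" using insert.prems(1) by simp
    let ?h = "\<lambda>x. \<Prod>j\<in>I-{i}. f j (x j)" and ?C = "\<Prod>j\<in>I-{i}. \<integral>\<^sup>+y. f j y \<partial>L"
    have "(\<integral>\<^sup>+x. f i (x i) * ?h x \<partial>\<Lambda>) = (\<integral>\<^sup>+y. f i y \<partial>L) * ?C"
    proof (rule nn_integral_coordinate_factor)
      show "?h \<in> borel_measurable \<Lambda>" using insert.prems(2) by (intro measurable_Lam_prod) auto
      show "(\<lambda>x. x i) \<in> \<Lambda> \<rightarrow>\<^sub>M L" by (rule measurable_Lam_coord[OF i])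
      show "f i \<in> borel_measurable L" by (rule insert.prems(2)[OF i])
      fix X assume X: "X \<in> sets L"
      let ?f = "f(i := indicator X)"
      have "(\<integral>\<^sup>+x. (\<Prod>j\<in>I. ?f j (x j)) \<partial>\<Lambda>) = (\<Prod>j\<in>I. \<integral>\<^sup>+y. ?f j y \<partial>L)"
      proof (rule insert.IH)
        show "S \<subseteq> I" using insert.prems(1) by simp
        show "?f j \<in> borel_measurable L" if "j \<in> I" for j using insert.prems(2)[OF that] X by simp
        show "\<exists>X\<in>sets L. ?f j = indicator X" if "j \<in> I - S" for j
          using insert.prems(3)[of j] that X by (cases "j = i") auto
      qed
      moreover have "(\<Prod>j\<in>I. ?f j (x j)) = indicator X (x i) * ?h x" for x
      proof -
        have "(\<Prod>j\<in>I. ?f j (x j)) = ?f i (x i) * (\<Prod>j\<in>I-{i}. ?f j (x j))"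
          using i finite_I by (intro prod.remove)
        also have "(\<Prod>j\<in>I-{i}. ?f j (x j)) = ?h x" by (intro prod.cong) auto
        finally show ?thesis by simp
      qed
      moreover have "(\<Prod>j\<in>I. \<integral>\<^sup>+y. ?f j y \<partial>L) = emeasure L X * ?C"
      proof -
        have "(\<Prod>j\<in>I. \<integral>\<^sup>+y. ?f j y \<partial>L) = (\<integral>\<^sup>+y. ?f i y \<partial>L) * (\<Prod>j\<in>I-{i}. \<integral>\<^sup>+y. ?f j y \<partial>L)"
          using i finite_I by (intro prod.remove)
        also have "(\<Prod>j\<in>I-{i}. \<integral>\<^sup>+y. ?f j y \<partial>L) = ?C" by (intro prod.cong) auto
        finally show ?thesis using X by simp
      qed
      ultimately show "(\<integral>\<^sup>+x. indicator X (x i) * ?h x \<partial>\<Lambda>) = emeasure L X * ?C" by simp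
    qed
    moreover have "(\<Prod>j\<in>I. f j (x j)) = f i (x i) * ?h x" for x
      using i finite_I by (intro prod.remove)
    moreover have "(\<Prod>j\<in>I. \<integral>\<^sup>+y. f j y \<partial>L) = (\<integral>\<^sup>+y. f i y \<partial>L) * ?C"
      using i finite_I by (intro prod.remove)
    ultimately show ?case by simp
  qed
  from this[OF finite_I subset_refl f] show ?thesis by simp
qed

text \<open>The density has the product masses on rectangles by \<open>nn_integral_prod\<close>, and
  those determine a product of probability laws even where they do not determine the reference
  measure.\<close>

lemma density_eq_PiM:
  fixes p :: "'i \<Rightarrow> 'a \<Rightarrow> real"
  assumes p: "\<And>i. p i \<in> borel_measurable L" "\<And>i x. x \<in> space L \<Longrightarrow> 0 \<le> p i x"
    and one: "\<And>i. (\<integral>\<^sup>+x. ennreal (p i x) \<partial>L) = 1"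
  shows "density \<Lambda> (\<lambda>x. ennreal (\<Prod>i\<in>I. p i (x i))) = PiM I (\<lambda>i. dens L (p i))"
proof -
  have ps: "prob_space (dens L (p i))" for i
    using p(1)[of i] one[of i] by (intro prob_spaceI) (simp add: dens_def emeasure_density cong: nn_integral_cong)
  interpret product_prob_space "\<lambda>i. dens L (p i)" I
    by (intro product_prob_spaceI ps)
  have sD: "sets (dens L (p i)) = sets L" for i by (simp add: dens_def)
  show ?thesis
  proof (rule PiM_eqI[OF finite_I])
    show "sets (density \<Lambda> (\<lambda>x. ennreal (\<Prod>i\<in>I. p i (x i)))) = sets (PiM I (\<lambda>i. dens L (p i)))"
      unfolding sets_density sets_Lam by (intro sets_PiM_cong) (simp_all add: sD)
    fix X assume X: "\<And>i. i \<in> I \<Longrightarrow> X i \<in> sets (dens L (p i))"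
    then have X': "\<And>i. i \<in> I \<Longrightarrow> X i \<in> sets L" by (simp add: sD)
    have box: "Pi\<^sub>E I X \<in> sets \<Lambda>" unfolding sets_Lam using X' finite_I by (intro sets_PiM_I_finite) auto
    have pe: "ennreal (\<Prod>i\<in>I. p i (x i)) = (\<Prod>i\<in>I. ennreal (p i (x i)))" if "x \<in> space \<Lambda>" for x
      using that p(2) by (intro prod_ennreal[symmetric]) (auto simp: space_Lam)
    have pm: "(\<lambda>x. \<Prod>i\<in>I. ennreal (p i (x i))) \<in> borel_measurable \<Lambda>"
      using p(1) by (intro measurable_Lam_prod[where f="\<lambda>i y. ennreal (p i y)"]) auto
    have pm': "(\<lambda>x. ennreal (\<Prod>i\<in>I. p i (x i))) \<in> borel_measurable \<Lambda>"
      using pm by (rule measurable_cong[THEN iffD2, rotated]) (rule pe)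
    have "emeasure (density \<Lambda> (\<lambda>x. ennreal (\<Prod>i\<in>I. p i (x i)))) (Pi\<^sub>E I X)
       = (\<integral>\<^sup>+x. ennreal (\<Prod>i\<in>I. p i (x i)) * indicator (Pi\<^sub>E I X) x \<partial>\<Lambda>)"
      by (rule emeasure_density[OF pm' box])
    also have "\<dots> = (\<integral>\<^sup>+x. (\<Prod>i\<in>I. ennreal (p i (x i)) * indicator (X i) (x i)) \<partial>\<Lambda>)"
    proof (rule nn_integral_cong)
      fix x assume x: "x \<in> space \<Lambda>"
      then have ext: "x \<in> extensional I" by (auto simp: space_Lam PiE_iff)
      have "(\<Prod>i\<in>I. indicator (X i) (x i) :: ennreal) = indicator (Pi\<^sub>E I X) x"
        using ext finite_I by (auto simp: indicator_def PiE_iff prod_eq_1_iff intro!: prod_zero)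
      then show "ennreal (\<Prod>i\<in>I. p i (x i)) * indicator (Pi\<^sub>E I X) x = (\<Prod>i\<in>I. ennreal (p i (x i)) * indicator (X i) (x i))"
        by (simp add: pe[OF x] prod.distrib)
    qed
    also have "\<dots> = (\<Prod>i\<in>I. \<integral>\<^sup>+y. ennreal (p i y) * indicator (X i) y \<partial>L)"
      using p(1) X' by (intro nn_integral_prod[where f="\<lambda>i y. ennreal (p i y) * indicator (X i) y"]) auto
    also have "\<dots> = (\<Prod>i\<in>I. emeasure (dens L (p i)) (X i))"
      using p(1) X' by (intro prod.cong refl) (simp add: dens_def emeasure_density)
    finally show "emeasure (density \<Lambda> (\<lambda>x. ennreal (\<Prod>i\<in>I. p i (x i)))) (Pi\<^sub>E I X) = (\<Prod>i\<in>I. emeasure (dens L (p i)) (X i))" .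
  qed
qed

end

lemma (in sigma_finite_measure) rectangle_measure_PiM:
  assumes "finite I"
  shows "rectangle_measure (PiM I (\<lambda>_. M)) M I"
proof
  interpret product_sigma_finite "\<lambda>_. M" by unfold_locales
  show "emeasure (PiM I (\<lambda>_. M)) (Pi\<^sub>E I X) = (\<Prod>i\<in>I. emeasure M (X i))" if "\<And>i. i \<in> I \<Longrightarrow> X i \<in> sets M" for X
    using assms that by (rule emeasure_PiM)
qed (use assms in auto)

text \<open>By Markov, the sets where \<open>f\<close> is at least \<open>1 / n\<close> have finite
  mass; they exhaust the support, and the rest of the space becomes a null set.\<close>

lemma sigma_finite_density_support:
  assumes f[measurable]: "f \<in> borel_measurable M" and fin: "(\<integral>\<^sup>+x. f x \<partial>M) < \<infinity>"
  shows "sigma_finite_measure (density M (indicator {x\<in>space M. f x \<noteq> 0}))"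
proof
  let ?S = "{x\<in>space M. f x \<noteq> 0}" and ?N = "density M (indicator {x\<in>space M. f x \<noteq> 0})"
  \<comment> \<open>A product instead of the quotient \<open>1 / n\<close> avoids division, and
    \<open>n = 1\<close> covers the points where \<open>f\<close> is infinite.\<close>
  define B where "B n = {x\<in>space M. 1 \<le> of_nat n * f x}" for n :: nat
  have B[measurable]: "B n \<in> sets M" for n unfolding B_def by measurable
  have S[measurable]: "?S \<in> sets M" by measurable
  have emN: "emeasure ?N X = emeasure M (?S \<inter> X)" if "X \<in> sets M" for X
    using that by (subst emeasure_density) (auto simp: indicator_inter_arith[symmetric])
  have cover: "(\<Union>n. B n) \<union> (space M - ?S) = space M"
  proof -
    have "\<exists>n. 1 \<le> of_nat n * f x" if "f x \<noteq> 0" for x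
    proof (cases "f x = \<infinity>")
      case True
      then show ?thesis by (intro exI[of _ 1]) simp
    next
      case False
      then obtain r where fr: "f x = ennreal r" "0 \<le> r" by (cases "f x") auto
      then have r: "f x = ennreal r" "r > 0" using that by (cases "r = 0"; simp)+
      obtain n :: nat where "1 / r < real n" using reals_Archimedean2 by blast
      then have "1 \<le> real n * r" using r by (simp add: field_simps)
      then have "ennreal 1 \<le> ennreal (real n * r)" by (rule ennreal_leI)
      then show ?thesis using r by (intro exI[of _ n]) (simp add: ennreal_mult ennreal_of_nat_eq_real_of_nat)
    qed
    then show ?thesis unfolding B_def by auto
  qed
  show "\<exists>A. countable A \<and> A \<subseteq> sets ?N \<and> \<Union>A = space ?N \<and> (\<forall>a\<in>A. emeasure ?N a \<noteq> \<infinity>)"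
  proof (intro exI[of _ "insert (space M - ?S) (range B)"] conjI ballI)
    show "\<Union>(insert (space M - ?S) (range B)) = space ?N" using cover by auto
    fix a assume "a \<in> insert (space M - ?S) (range B)"
    then consider "a = space M - ?S" | n where "a = B n" by auto
    then show "emeasure ?N a \<noteq> \<infinity>"
    proof cases
      case 1
      have "?S \<inter> (space M - ?S) = {}" by auto
      then show ?thesis unfolding 1 by (subst emN) auto
    next
      case 2
      have "emeasure ?N (B n) \<le> emeasure M (B n)" by (subst emN) (auto intro!: emeasure_mono)
      also have "\<dots> = (\<integral>\<^sup>+x. indicator (B n) x \<partial>M)" by simp
      also have "\<dots> \<le> (\<integral>\<^sup>+x. of_nat n * f x \<partial>M)"
        by (intro nn_integral_mono) (auto simp: indicator_def B_def)
      also have "\<dots> = of_nat n * (\<integral>\<^sup>+x. f x \<partial>M)" by (rule nn_integral_cmult) measurable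
      also have "\<dots> < \<infinity>" using fin by (simp add: ennreal_mult_less_top of_nat_less_top)
      finally show ?thesis unfolding 2 by simp
    qed
  qed auto
qed

subsection \<open>The tempering chain\<close>

lemma setcompr3_eq_image: "{f k l j | k l j. P k l j} = (\<lambda>(k, l, j). f k l j) ` {(k, l, j). P k l j}"
  by (auto simp: image_iff) blast

text \<open>Where the current pair has density 0, the quotient takes the default value 0 of
  division; both sides vanish there, so the convention is harmless.\<close>

lemma swap_acc_mult:
  assumes "0 \<le> p k (x k)" "0 \<le> p (Suc k) (x (Suc k))" "0 \<le> p k (x (Suc k))" "0 \<le> p (Suc k) (x k)"
  shows "swap_acc p k x * (p k (x k) * p (Suc k) (x (Suc k)))
    = min (p k (x k) * p (Suc k) (x (Suc k))) (p k (x (Suc k)) * p (Suc k) (x k))"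
proof (cases "p k (x k) * p (Suc k) (x (Suc k)) = 0")
  case True
  have "0 \<le> p k (x (Suc k)) * p (Suc k) (x k)" using assms by simp
  then show ?thesis unfolding True by simp
next
  case False
  then have "0 < p k (x k) * p (Suc k) (x (Suc k))" using assms by (simp add: less_le)
  moreover have "min 1 (b / a) * a = min a b" if "0 < a" for a b :: real
    using that by (simp add: min_def field_simps)
  ultimately show ?thesis unfolding swap_acc_def by blast
qed

lemma prod_remove_pair:
  fixes g :: "nat \<Rightarrow> 'c::comm_monoid_mult"
  assumes "l < N"
  shows "(\<Prod>k\<le>N. g k) = g l * g (Suc l) * (\<Prod>k\<in>{..N} - {l, Suc l}. g k)"
proof -
  have "(\<Prod>k\<le>N. g k) = g l * (\<Prod>k\<in>{..N} - {l}. g k)"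
    using assms by (intro prod.remove) auto
  also have "(\<Prod>k\<in>{..N} - {l}. g k) = g (Suc l) * (\<Prod>k\<in>{..N} - {l} - {Suc l}. g k)"
    using assms by (intro prod.remove) auto
  also have "{..N} - {l} - {Suc l} = {..N} - {l, Suc l}" by auto
  finally show ?thesis by (simp add: mult.assoc)
qed

locale tempering =
  fixes L :: "'a measure" and p :: "nat \<Rightarrow> 'a \<Rightarrow> real" and T :: "nat \<Rightarrow> 'a \<Rightarrow> 'a measure"
    and N J :: nat and A :: "nat \<Rightarrow> 'a set"
  assumes N: "N \<ge> 1"
    \<comment> \<open>the product measure locales want a family indexed by all of \<open>nat\<close>\<close>
    and dens_const: "\<And>k. p k = p (min k N)"
    and dens_meas: "\<And>k. p k \<in> borel_measurable L"
    and dens_nonneg: "\<And>k x. x \<in> space L \<Longrightarrow> 0 \<le> p k x"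
    and dens_one: "\<And>k. (\<integral>\<^sup>+ x. ennreal (p k x) \<partial>L) = 1"
    and kern: "\<And>k. T k \<in> L \<rightarrow>\<^sub>M prob_algebra L"
    and revers: "\<And>k. reversible (dens L (p k)) (kop (T k))"
    and part_meas: "\<And>j. j \<in> {1..J} \<Longrightarrow> A j \<in> sets L"
    and part_disj: "\<And>i j. i \<in> {1..J} \<Longrightarrow> j \<in> {1..J} \<Longrightarrow> i \<noteq> j \<Longrightarrow> A i \<inter> A j = {}"
    and part_cover: "(\<Union>j\<in>{1..J}. A j) = space L"
    and part_pos: "\<And>k j. j \<in> {1..J} \<Longrightarrow> pmass L (p k) (A j) > 0"
begin

abbreviation D :: "nat \<Rightarrow> 'a measure" where "D k \<equiv> dens L (p k)"

lemma sets_dens: "sets (D k) = sets L" and space_dens: "space (D k) = space L"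
  by (simp_all add: dens_def)

lemma prob_dens: "prob_space (D k)"
  using dens_meas[of k] dens_one[of k]
  by (intro prob_spaceI) (simp add: dens_def emeasure_density cong: nn_integral_cong)

lemma integrable_dens: "integrable L (p k)"
  using dens_one[of k] dens_nonneg by (intro integrableI_nonneg dens_meas AE_I2) auto

lemma integral_dens:
  fixes f :: "'a \<Rightarrow> real"
  assumes "f \<in> borel_measurable L"
  shows "(\<integral>x. f x \<partial>D k) = (\<integral>x. f x * p k x \<partial>L)"
  unfolding dens_def using assms dens_nonneg
  by (subst integral_density) (auto intro: dens_meas simp: mult.commute)

lemma measure_dens: "B \<in> sets L \<Longrightarrow> measure (D k) B = pmass L (p k) B"
proof -
  assume B: "B \<in> sets L"
  then have "B \<inter> space (D k) = B" by (simp add: space_dens Int_absorb2 sets.sets_into_space)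
  then have "measure (D k) B = (\<integral>x. indicator B x \<partial>D k)" by simp
  also have "\<dots> = (\<integral>x. indicator B x * p k x \<partial>L)" using B by (intro integral_dens) simp
  finally show ?thesis by (simp add: pmass_def)
qed

sublocale product_chain D T A J N
proof (rule product_chain.intro)
  fix k
  show "sets (D k) = sets (D 0)" by (simp only: sets_dens)
  show "partitioned_kernel (D k) (T k) A J"
  proof (intro partitioned_kernel.intro reversible_kernel.intro cell_partition.intro
      reversible_kernel_axioms.intro cell_partition_axioms.intro prob_dens revers)
    have "prob_algebra (D k) = prob_algebra L"
      unfolding prob_algebra_def subprob_algebra_cong[OF sets_dens] ..
    then show "T k \<in> D k \<rightarrow>\<^sub>M prob_algebra (D k)"
      using kern[of k] by (simp only: measurable_cong_sets[OF sets_dens refl])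
    show "A j \<in> sets (D k)" if "j \<in> {1..J}" for j using part_meas[OF that] by (simp only: sets_dens)
    show "0 < measure (D k) (A j)" if "j \<in> {1..J}" for j
      using part_pos[OF that] by (simp only: measure_dens[OF part_meas[OF that]])
    show "A i \<inter> A j = {}" if "i \<in> {1..J}" "j \<in> {1..J}" "i \<noteq> j" for i j by (rule part_disj[OF that])
    show "(\<Union>j\<in>{1..J}. A j) = space (D k)" by (simp only: part_cover space_dens)
  qed
qed

lemma cond_dens_eq:
  assumes "j \<in> {1..J}"
  shows "cond_dens L (p k) (A j) = Co.cond k (A j)"
proof -
  note [measurable] = part_meas[OF assms] dens_meas[of k]
  have "Co.cond k (A j) = density L (\<lambda>x. ennreal (p k x) * ennreal (indicator (A j) x / pmass L (p k) (A j)))"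
    unfolding dens_def measure_dens[OF part_meas[OF assms], unfolded dens_def]
    by (rule density_density_eq) measurable
  also have "\<dots> = cond_dens L (p k) (A j)"
    unfolding cond_dens_def
  proof (intro density_cong AE_I2)
    fix x assume "x \<in> space L"
    then show "ennreal (p k x) * ennreal (indicator (A j) x / pmass L (p k) (A j)) = ennreal (indicator (A j) x * p k x / pmass L (p k) (A j))"
      using dens_nonneg[of x k] part_pos[OF assms, of k] by (simp add: ennreal_mult[symmetric] mult.commute)
  qed measurable
  finally show ?thesis ..
qed

text \<open>Masses and matrices agree on the labels from 1 to \<open>J\<close> only, so the equality
  is proved for the variance and the form, not for their arguments.\<close>

lemma gap_fin_eq:
  "gap_fin {1..J} (\<lambda>j. pmass L (p 0) (A j)) (proj_mat L (p 0) (T 0) A)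
   = gap_fin {1..J} (\<lambda>j. measure (D 0) (A j)) (Co.proj 0)"
proof -
  have w: "pmass L (p 0) (A j) = measure (D 0) (A j)" if "j \<in> {1..J}" for j
    by (rule measure_dens[OF part_meas[OF that], symmetric])
  have P: "proj_mat L (p 0) (T 0) A i j = Co.proj 0 i j" if i: "i \<in> {1..J}" and j: "j \<in> {1..J}" for i j
  proof -
    have m: "(\<lambda>x. measure (T 0 x) (A j)) \<in> borel_measurable L"
      by (rule measurable_compose[OF kern measurable_measure_prob_algebra[OF part_meas[OF j]]])
    have "(\<integral>x. indicator (A i) x * measure (T 0 x) (A j) \<partial>D 0) = (\<integral>x. indicator (A i) x * measure (T 0 x) (A j) * p 0 x \<partial>L)"
      using m part_meas[OF i] by (intro integral_dens borel_measurable_times borel_measurable_indicator)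
    then show ?thesis unfolding proj_mat_def w[OF i] by simp
  qed
  have V: "fin_var {1..J} (\<lambda>j. pmass L (p 0) (A j)) = fin_var {1..J} (\<lambda>j. measure (D 0) (A j))"
    unfolding fin_var_def fin_inner_def by (intro ext arg_cong2[where f="(-)"] arg_cong[where f="\<lambda>x. x\<^sup>2"] sum.cong) (simp_all only: w)
  have E: "fin_dirichlet {1..J} (\<lambda>j. pmass L (p 0) (A j)) (proj_mat L (p 0) (T 0) A)
      = fin_dirichlet {1..J} (\<lambda>j. measure (D 0) (A j)) (Co.proj 0)"
    unfolding fin_dirichlet_def fin_inner_def
  proof (intro ext sum.cong refl)
    fix f i assume i: "i \<in> {1..J}"
    have "(\<Sum>j\<in>{1..J}. proj_mat L (p 0) (T 0) A i j * f j) = (\<Sum>j\<in>{1..J}. Co.proj 0 i j * f j)"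
      by (intro sum.cong refl) (simp only: P[OF i])
    then show "pmass L (p 0) (A i) * f i * (f i - (\<Sum>j\<in>{1..J}. proj_mat L (p 0) (T 0) A i j * f j))
      = measure (D 0) (A i) * f i * (f i - (\<Sum>j\<in>{1..J}. Co.proj 0 i j * f j))"
      by (simp only: w[OF i])
  qed
  show ?thesis unfolding gap_fin_def V E ..
qed

section \<open>Ranges of the local gaps, \<gamma> and \<delta>\<close>

definition min_gap :: real where
  "min_gap = Min {gap (cond_dens L (p k) (A j)) (restr_op (T k) (A j)) | k j. k \<le> N \<and> j \<in> {1..J}}"

abbreviation \<gamma> :: real where "\<gamma> \<equiv> gamma_ov L p N J A"
abbreviation \<delta> :: real where "\<delta> \<equiv> delta_ov L p N J A"

lemma J_pos: "1 \<le> J"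
proof (rule ccontr)
  assume "\<not> 1 \<le> J"
  then have "space L = {}" using part_cover by simp
  then have "(\<integral>\<^sup>+ x. ennreal (p 0 x) \<partial>L) = (\<integral>\<^sup>+ x. 0 \<partial>L)" by (intro nn_integral_cong) simp
  then show False using dens_one[of 0] by simp
qed

lemma local_gap:
  assumes k: "k \<le> N" and j: "j \<in> {1..J}"
  shows "0 \<le> gap (cond_dens L (p k) (A j)) (restr_op (T k) (A j))"
    and "gap (cond_dens L (p k) (A j)) (restr_op (T k) (A j)) \<le> 2"
    and "g \<in> L2fun (Co.cond k (A j)) \<Longrightarrow> gap (cond_dens L (p k) (A j)) (restr_op (T k) (A j)) * var_mu (Co.cond k (A j)) g
      \<le> dirichlet (Co.cond k (A j)) (restr_op (T k) (A j)) g"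
proof -
  have m: "A j \<in> sets (D k)" "measure (D k) (A j) > 0" using Co.cell_meas[OF j] Co.cell_pos[OF j] by auto
  note nn = Co.dirichlet_cond_nonneg[OF m] and le = Co.dirichlet_cond_le[OF m]
  show "0 \<le> gap (cond_dens L (p k) (A j)) (restr_op (T k) (A j))"
    unfolding cond_dens_eq[OF j] by (rule gap_nonneg) (fact nn le)+
  show "gap (cond_dens L (p k) (A j)) (restr_op (T k) (A j)) \<le> 2"
    unfolding cond_dens_eq[OF j] by (rule gap_le_2) (fact nn le)+
  show "gap (cond_dens L (p k) (A j)) (restr_op (T k) (A j)) * var_mu (Co.cond k (A j)) g
      \<le> dirichlet (Co.cond k (A j)) (restr_op (T k) (A j)) g" if "g \<in> L2fun (Co.cond k (A j))"
    unfolding cond_dens_eq[OF j] by (rule gap_times_var[OF nn le that])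
qed

lemma finite_gaps: "finite {gap (cond_dens L (p k) (A j)) (restr_op (T k) (A j)) | k j. k \<le> N \<and> j \<in> {1..J}}"
proof -
  have "{gap (cond_dens L (p k) (A j)) (restr_op (T k) (A j)) | k j. k \<le> N \<and> j \<in> {1..J}}
     = (\<lambda>(k, j). gap (cond_dens L (p k) (A j)) (restr_op (T k) (A j))) ` ({..N} \<times> {1..J})"
    by (auto simp: image_iff) blast+
  then show ?thesis by simp
qed

lemma min_gap_le: "k \<le> N \<Longrightarrow> j \<in> {1..J} \<Longrightarrow> min_gap \<le> gap (cond_dens L (p k) (A j)) (restr_op (T k) (A j))"
  unfolding min_gap_def by (intro Min_le finite_gaps) blast

lemma min_gap_range: "0 \<le> min_gap" "min_gap \<le> 2"
proof -
  have "gap (cond_dens L (p 0) (A 1)) (restr_op (T 0) (A 1))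
      \<in> {gap (cond_dens L (p k) (A j)) (restr_op (T k) (A j)) | k j. k \<le> N \<and> j \<in> {1..J}}"
    by (rule CollectI, rule exI[of _ 0], rule exI[of _ 1]) (use J_pos in simp)
  then have ne: "{gap (cond_dens L (p k) (A j)) (restr_op (T k) (A j)) | k j. k \<le> N \<and> j \<in> {1..J}} \<noteq> {}"
    by blast
  then have "min_gap \<in> {gap (cond_dens L (p k) (A j)) (restr_op (T k) (A j)) | k j. k \<le> N \<and> j \<in> {1..J}}"
    unfolding min_gap_def by (rule Min_in[OF finite_gaps])
  then obtain k j where "k \<le> N" "j \<in> {1..J}" "min_gap = gap (cond_dens L (p k) (A j)) (restr_op (T k) (A j))" by blast
  then show "0 \<le> min_gap" "min_gap \<le> 2" using local_gap(1,2)[of k j] by simp_all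
qed

lemma gamma_le_prod:
  assumes "j \<in> {1..J}"
  shows "\<gamma> \<le> (\<Prod>k\<in>{1..N}. min 1 (measure (D (k - 1)) (A j) / measure (D k) (A j)))"
  unfolding measure_dens[OF part_meas[OF assms]] gamma_ov_def
proof (rule Min_le)
  have "{\<Prod>k\<in>{1..N}. min 1 (pmass L (p (k - 1)) (A j) / pmass L (p k) (A j)) | j. j \<in> {1..J}}
    = (\<lambda>j. \<Prod>k\<in>{1..N}. min 1 (pmass L (p (k - 1)) (A j) / pmass L (p k) (A j))) ` {1..J}" by auto
  then show "finite {\<Prod>k\<in>{1..N}. min 1 (pmass L (p (k - 1)) (A j) / pmass L (p k) (A j)) | j. j \<in> {1..J}}" by simp
qed (use assms in blast)

lemma gamma_pos: "\<gamma> > 0" and gamma_le_1: "\<gamma> \<le> 1"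
proof -
  let ?S = "(\<lambda>j. \<Prod>k\<in>{1..N}. min 1 (pmass L (p (k - 1)) (A j) / pmass L (p k) (A j))) ` {1..J}"
  have "\<gamma> = Min ?S" unfolding gamma_ov_def by (rule arg_cong[where f=Min]) auto
  moreover have "Min ?S \<in> ?S" using J_pos by (intro Min_in) auto
  ultimately obtain j where j: "j \<in> {1..J}" "\<gamma> = (\<Prod>k\<in>{1..N}. min 1 (pmass L (p (k - 1)) (A j) / pmass L (p k) (A j)))"
    by auto
  show "\<gamma> > 0" unfolding j(2) using part_pos[OF j(1)] by (intro prod_pos) auto
  show "\<gamma> \<le> 1" unfolding j(2) using part_pos[OF j(1)] by (intro prod_le_1) (auto simp: less_imp_le)
qed

lemma integrable_overlap:
  assumes "j \<in> {1..J}"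
  shows "integrable L (\<lambda>z. indicator (A j) z * min (p k z) (p l z))"
proof (rule Bochner_Integration.integrable_bound[OF integrable_dens[of k]])
  show "(\<lambda>z. indicator (A j) z * min (p k z) (p l z)) \<in> borel_measurable L"
    using part_meas[OF assms] dens_meas by measurable
  show "AE x in L. norm (indicator (A j) x * min (p k x) (p l x)) \<le> norm (p k x)"
    using dens_nonneg by (intro AE_I2) (auto simp: indicator_def min_def)
qed

lemma delta_set:
  "{(1 / pmass L (p k) (A j)) * (\<integral>z. indicator (A j) z * min (p k z) (p l z) \<partial>L) |
      k l j. k \<le> N \<and> l \<le> N \<and> (k = Suc l \<or> l = Suc k) \<and> j \<in> {1..J}}
   = (\<lambda>(k, l, j). (1 / pmass L (p k) (A j)) * (\<integral>z. indicator (A j) z * min (p k z) (p l z) \<partial>L))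
     ` {(k, l, j). k \<le> N \<and> l \<le> N \<and> (k = Suc l \<or> l = Suc k) \<and> j \<in> {1..J}}"
  by (rule setcompr3_eq_image)

lemma finite_delta_index: "finite {(k, l, j). k \<le> N \<and> l \<le> N \<and> (k = Suc l \<or> l = Suc k) \<and> j \<in> {1..J}}"
  by (rule finite_subset[of _ "{..N} \<times> {..N} \<times> {1..J}"]) auto

lemma delta_le:
  assumes "k \<le> N" "l \<le> N" "k = Suc l \<or> l = Suc k" and j: "j \<in> {1..J}"
  shows "\<delta> * pmass L (p k) (A j) \<le> (\<integral>z. indicator (A j) z * min (p k z) (p l z) \<partial>L)"
proof -
  have "\<delta> \<le> (1 / pmass L (p k) (A j)) * (\<integral>z. indicator (A j) z * min (p k z) (p l z) \<partial>L)"
    unfolding delta_ov_def delta_set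
    by (rule Min_le[OF finite_imageI[OF finite_delta_index]]) (rule image_eqI[of _ _ "(k, l, j)"]; use assms in simp)
  then show ?thesis using part_pos[OF j, of k] by (simp add: field_simps)
qed

lemma delta_range: "0 \<le> \<delta>" "\<delta> \<le> 1"
proof -
  \<comment> \<open>As \<open>N \<ge> 1\<close>, there is a pair of adjacent levels, so the minimum
    is taken over a nonempty set.\<close>
  have "(0, 1, 1) \<in> {(k, l, j). k \<le> N \<and> l \<le> N \<and> (k = Suc l \<or> l = Suc k) \<and> j \<in> {1..J}}"
    using N J_pos by simp
  then have "\<delta> \<in> (\<lambda>(k, l, j). (1 / pmass L (p k) (A j)) * (\<integral>z. indicator (A j) z * min (p k z) (p l z) \<partial>L))
     ` {(k, l, j). k \<le> N \<and> l \<le> N \<and> (k = Suc l \<or> l = Suc k) \<and> j \<in> {1..J}}"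
    unfolding delta_ov_def delta_set by (intro Min_in finite_imageI finite_delta_index) blast
  then obtain k l j where j: "j \<in> {1..J}" and
    \<delta>: "\<delta> = (1 / pmass L (p k) (A j)) * (\<integral>z. indicator (A j) z * min (p k z) (p l z) \<partial>L)" by auto
  have "0 \<le> (\<integral>z. indicator (A j) z * min (p k z) (p l z) \<partial>L)"
    using dens_nonneg by (intro Bochner_Integration.integral_nonneg) (auto simp: min_def)
  then show "0 \<le> \<delta>" unfolding \<delta> using part_pos[OF j, of k] by simp
  have "(\<integral>z. indicator (A j) z * min (p k z) (p l z) \<partial>L) \<le> pmass L (p k) (A j)"
    unfolding pmass_def
  proof (rule integral_mono[OF integrable_overlap[OF j]])
    show "integrable L (\<lambda>x. indicator (A j) x * p k x)"
      using integrable_mult_indicator[OF part_meas[OF j] integrable_dens[of k]] by simp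
  qed (auto simp: indicator_def)
  then show "\<delta> \<le> 1" unfolding \<delta> using part_pos[OF j, of k] by (simp add: divide_le_eq)
qed

text \<open>\<open>L\<close> need not be sigma-finite, but its part carrying the densities is, and \<open>M\<close> has the
  density \<open>joint\<close> with respect to the product of that part. There the swaps preserve the reference
  measure.\<close>

definition supp :: "'a set" where "supp = {x \<in> space L. (\<Sum>k\<le>N. ennreal (p k x)) \<noteq> 0}"

definition L' :: "'a measure" where "L' = density L (indicator supp)"

lemma sigma_finite_L': "sigma_finite_measure L'"
  unfolding L'_def supp_def
proof (rule sigma_finite_density_support)
  show m: "(\<lambda>x. \<Sum>k\<le>N. ennreal (p k x)) \<in> borel_measurable L" using dens_meas by measurable
  have "(\<integral>\<^sup>+x. (\<Sum>k\<le>N. ennreal (p k x)) \<partial>L) = (\<Sum>k\<le>N. \<integral>\<^sup>+x. ennreal (p k x) \<partial>L)"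
    using dens_meas by (intro nn_integral_sum) measurable
  also have "\<dots> < \<infinity>" by (simp add: dens_one of_nat_less_top del: of_nat_Suc)
  finally show "(\<integral>\<^sup>+x. (\<Sum>k\<le>N. ennreal (p k x)) \<partial>L) < \<infinity>" .
qed

lemma sets_L': "sets L' = sets L" and space_L': "space L' = space L"
  by (simp_all add: L'_def)

lemma sets_supp: "supp \<in> sets L"
  unfolding supp_def using dens_meas by measurable

text \<open>The sum in \<open>supp\<close> stops at \<open>N\<close>; a larger \<open>k\<close>
  repeats the density of level \<open>N\<close>.\<close>

lemma outside_supp:
  assumes "x \<in> space L" "x \<notin> supp"
  shows "p k x = 0"
proof -
  have "\<forall>k\<in>{..N}. ennreal (p k x) = 0" using assms by (simp add: supp_def)
  then have "ennreal (p (min k N) x) = 0" by simp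
  then show ?thesis using dens_nonneg[OF assms(1), of "min k N"] unfolding dens_const[of k] by (simp add: ennreal_eq_0_iff)
qed

lemma nn_integral_L':
  assumes g: "g \<in> borel_measurable L" and z: "\<And>x. x \<in> space L \<Longrightarrow> x \<notin> supp \<Longrightarrow> g x = 0"
  shows "(\<integral>\<^sup>+x. g x \<partial>L') = (\<integral>\<^sup>+x. g x \<partial>L)"
proof -
  have "(\<integral>\<^sup>+x. g x \<partial>L') = (\<integral>\<^sup>+x. indicator supp x * g x \<partial>L)"
    unfolding L'_def using sets_supp g by (intro nn_integral_density) auto
  also have "\<dots> = (\<integral>\<^sup>+x. g x \<partial>L)" using z by (intro nn_integral_cong) (auto simp: indicator_def)
  finally show ?thesis .
qed

lemma meas_L': "borel_measurable L' = borel_measurable L"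
  by (rule measurable_cong_sets[OF sets_L' refl])

lemma dens_L': "dens L' (p k) = D k"
proof (rule measure_eqI)
  fix X assume "X \<in> sets (dens L' (p k))"
  then have X: "X \<in> sets L" by (simp add: dens_def sets_L')
  have "emeasure (dens L' (p k)) X = (\<integral>\<^sup>+x. ennreal (p k x) * indicator X x \<partial>L')"
    unfolding dens_def using X dens_meas[of k] by (intro emeasure_density) (simp_all add: meas_L' sets_L')
  also have "\<dots> = (\<integral>\<^sup>+x. ennreal (p k x) * indicator X x \<partial>L)"
    using X dens_meas[of k] outside_supp by (intro nn_integral_L') auto
  also have "\<dots> = emeasure (D k) X"
    unfolding dens_def using X dens_meas[of k] by (intro emeasure_density[symmetric]) simp_all
  finally show "emeasure (dens L' (p k)) X = emeasure (D k) X" .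
qed (simp add: dens_def sets_L')

abbreviation Lam :: "(nat \<Rightarrow> 'a) measure" where "Lam \<equiv> PiM {..N} (\<lambda>_. L')"

sublocale R: rectangle_measure Lam L' "{..N}"
  by (rule sigma_finite_measure.rectangle_measure_PiM[OF sigma_finite_L']) simp

definition joint :: "(nat \<Rightarrow> 'a) \<Rightarrow> real" where "joint x = (\<Prod>k\<le>N. p k (x k))"

lemma M_eq_density: "M = density Lam (\<lambda>x. ennreal (joint x))"
proof -
  have one: "(\<integral>\<^sup>+x. ennreal (p k x) \<partial>L') = 1" for k
    using dens_meas[of k] dens_one[of k] outside_supp by (subst nn_integral_L') auto
  have "density Lam (\<lambda>x. ennreal (\<Prod>k\<in>{..N}. p k (x k))) = PiM {..N} (\<lambda>k. dens L' (p k))"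
    by (rule R.density_eq_PiM[OF _ _ one]) (simp_all add: meas_L' dens_meas space_L' dens_nonneg)
  then show ?thesis by (simp add: dens_L' joint_def)
qed

lemma sets_Lam_M: "sets Lam = sets M"
  by (intro sets_PiM_cong) (simp_all add: sets_L' sets_dens)

lemma space_Lam_M: "space Lam = space M"
  by (rule sets_eq_imp_space_eq[OF sets_Lam_M])

lemma meas_Lam: "borel_measurable Lam = borel_measurable M"
  by (rule measurable_cong_sets[OF sets_Lam_M refl])

lemma measurable_dens_coord: "i \<le> N \<Longrightarrow> (\<lambda>x. p k (x i)) \<in> borel_measurable M"
  using dens_meas[of k] measurable_coord[of i]
  by (intro measurable_compose[OF measurable_coord]) (simp_all add: measurable_cong_sets[OF sets_dens refl])

lemma measurable_joint: "joint \<in> borel_measurable M"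
  unfolding joint_def[abs_def] by (intro borel_measurable_prod measurable_dens_coord) simp

lemma dens_coord_nonneg: "x \<in> space M \<Longrightarrow> i \<le> N \<Longrightarrow> 0 \<le> p k (x i)"
  using space_M_coord[of x i] by (intro dens_nonneg) (simp add: space_dens)

lemma joint_nonneg: "x \<in> space M \<Longrightarrow> 0 \<le> joint x"
  unfolding joint_def by (intro prod_nonneg) (simp add: dens_coord_nonneg)

lemma measurable_swap_acc: "l < N \<Longrightarrow> swap_acc p l \<in> borel_measurable M"
  unfolding swap_acc_def[abs_def]
  by (intro borel_measurable_min borel_measurable_divide borel_measurable_times measurable_dens_coord borel_measurable_const) simp_all

lemma swap_acc_range: "l < N \<Longrightarrow> x \<in> space M \<Longrightarrow> 0 \<le> swap_acc p l x \<and> swap_acc p l x \<le> 1"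
  unfolding swap_acc_def by (simp add: dens_coord_nonneg)

text \<open>The density of the accepted moves with respect to \<open>Lam\<close>: the minimum of
  forward and backward density, as usual for a Metropolis rule, and therefore symmetric under the
  swap.\<close>

definition swap_dens :: "nat \<Rightarrow> (nat \<Rightarrow> 'a) \<Rightarrow> real" where
  "swap_dens l x = min (p l (x l) * p (Suc l) (x (Suc l))) (p l (x (Suc l)) * p (Suc l) (x l))
     * (\<Prod>k\<in>{..N} - {l, Suc l}. p k (x k))"

lemma swap_dens_eq:
  assumes l: "l < N" and x: "x \<in> space M"
  shows "swap_acc p l x * joint x = swap_dens l x"
proof -
  have "swap_acc p l x * (p l (x l) * p (Suc l) (x (Suc l))) = min (p l (x l) * p (Suc l) (x (Suc l))) (p l (x (Suc l)) * p (Suc l) (x l))"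
    using l x by (intro swap_acc_mult dens_coord_nonneg) simp_all
  then show ?thesis
    unfolding joint_def swap_dens_def prod_remove_pair[OF l] by (simp only: mult.assoc[symmetric])
qed

lemma swap_dens_swp: "swap_dens l (swp l x) = swap_dens l x"
proof -
  have "(\<Prod>k\<in>{..N} - {l, Suc l}. p k (swp l x k)) = (\<Prod>k\<in>{..N} - {l, Suc l}. p k (x k))"
    by (intro prod.cong) (auto simp: swp_def)
  moreover have "swp l x l = x (Suc l)" "swp l x (Suc l) = x l" by (simp_all add: swp_def)
  ultimately show ?thesis unfolding swap_dens_def by (simp only: min.commute)
qed

lemma nn_integral_swap_acc:
  assumes l: "l < N" and G: "G \<in> borel_measurable M"
  shows "(\<integral>\<^sup>+x. ennreal (swap_acc p l x) * G x \<partial>M) = (\<integral>\<^sup>+x. ennreal (swap_dens l x) * G x \<partial>Lam)"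
proof -
  have "(\<integral>\<^sup>+x. ennreal (swap_acc p l x) * G x \<partial>M) = (\<integral>\<^sup>+x. ennreal (joint x) * (ennreal (swap_acc p l x) * G x) \<partial>Lam)"
    unfolding M_eq_density using measurable_joint measurable_swap_acc[OF l] G
    by (intro nn_integral_density) (simp_all add: meas_Lam)
  also have "\<dots> = (\<integral>\<^sup>+x. ennreal (swap_dens l x) * G x \<partial>Lam)"
  proof (rule nn_integral_cong)
    fix x assume "x \<in> space Lam"
    then have x: "x \<in> space M" by (simp only: space_Lam_M)
    show "ennreal (joint x) * (ennreal (swap_acc p l x) * G x) = ennreal (swap_dens l x) * G x"
      unfolding swap_dens_eq[OF l x, symmetric]
      using joint_nonneg[OF x] swap_acc_range[OF l x] by (simp add: ennreal_mult mult_ac)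
  qed
  finally show ?thesis .
qed

text \<open>All factors of \<open>Lam\<close> are equal, so a swap only permutes the factors in the
  mass of a rectangle.\<close>

lemma distr_swp:
  assumes l: "l < N"
  shows "distr Lam Lam (swp l) = Lam"
proof -
  interpret S: sigma_finite_measure L' by (rule sigma_finite_L')
  interpret PS: product_sigma_finite "\<lambda>_. L'" by unfold_locales
  have ms: "swp l \<in> Lam \<rightarrow>\<^sub>M Lam"
    using measurable_swp[OF l] by (simp only: measurable_cong_sets[OF sets_Lam_M sets_Lam_M])
  show ?thesis
  proof (rule PS.PiM_eqI)
    fix X assume X: "\<And>i. i \<in> {..N} \<Longrightarrow> X i \<in> sets L'"
    have X': "swp l X i \<in> sets L'" if "i \<in> {..N}" for i
      using X[of i] X[of l] X[of "Suc l"] l that by (auto simp: swp_def)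
    define \<tau> where "\<tau> i = (if i = l then Suc l else if i = Suc l then l else i)" for i
    have swp\<tau>: "swp l y i = y (\<tau> i)" for y :: "nat \<Rightarrow> 'c" and i by (simp add: swp_def \<tau>_def)
    have \<tau>: "\<tau> (\<tau> i) = i" "i \<le> N \<Longrightarrow> \<tau> i \<le> N" for i using l by (auto simp: \<tau>_def)
    have "swp l -` Pi\<^sub>E {..N} X \<inter> space Lam = Pi\<^sub>E {..N} (swp l X)"
    proof (intro equalityI subsetI)
      fix x assume x: "x \<in> swp l -` Pi\<^sub>E {..N} X \<inter> space Lam"
      have "x i \<in> swp l X i" if i: "i \<le> N" for i
        using x PiE_mem[of "swp l x" "{..N}" X "\<tau> i"] \<tau>(2)[OF i] by (simp add: swp\<tau> \<tau>)
      moreover have "x \<in> extensional {..N}" using x by (auto simp: space_PiM PiE_iff)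
      ultimately show "x \<in> Pi\<^sub>E {..N} (swp l X)" by (simp add: PiE_iff)
    next
      fix x assume x: "x \<in> Pi\<^sub>E {..N} (swp l X)"
      have "x i \<in> space L'" if "i \<le> N" for i
        using PiE_mem[OF x, of i] sets.sets_into_space[OF X'[of i]] that by auto
      moreover have ext: "x \<in> extensional {..N}" using x by (auto simp: PiE_iff)
      ultimately have "x \<in> space Lam" by (simp add: space_PiM PiE_iff)
      moreover have "swp l x i \<in> X i" if i: "i \<le> N" for i
        using PiE_mem[OF x, of "\<tau> i"] \<tau>(2)[OF i] by (simp add: swp\<tau> \<tau>)
      moreover have "swp l x \<in> extensional {..N}" using ext l by (simp add: extensional_def swp_def)
      ultimately show "x \<in> swp l -` Pi\<^sub>E {..N} X \<inter> space Lam" by (simp add: PiE_iff)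
    qed
    moreover have "Pi\<^sub>E {..N} X \<in> sets Lam" using X by (intro sets_PiM_I_finite) auto
    ultimately have "emeasure (distr Lam Lam (swp l)) (Pi\<^sub>E {..N} X) = emeasure Lam (Pi\<^sub>E {..N} (swp l X))"
      by (simp only: emeasure_distr[OF ms])
    also have "\<dots> = (\<Prod>i\<in>{..N}. emeasure L' (swp l X i))" by (rule R.rect[OF X'])
    also have "\<dots> = (\<Prod>i\<in>{..N}. emeasure L' (X i))"
      by (rule prod.reindex_bij_witness[of _ \<tau> \<tau>]) (simp_all add: \<tau> swp\<tau>)
    finally show "emeasure (distr Lam Lam (swp l)) (Pi\<^sub>E {..N} X) = (\<Prod>i\<in>{..N}. emeasure L' (X i))" .
  qed simp_all
qed

lemma measurable_swap_dens: "l < N \<Longrightarrow> swap_dens l \<in> borel_measurable M"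
  unfolding swap_dens_def[abs_def]
  by (intro borel_measurable_min borel_measurable_times borel_measurable_prod measurable_dens_coord) auto

text \<open>Expressed through \<open>Lam\<close>, both the density of accepted moves and the
  reference measure are invariant under the swap.\<close>

lemma swap_acc_invariant:
  assumes l: "l < N" and G: "G \<in> borel_measurable M"
  shows "(\<integral>\<^sup>+x. ennreal (swap_acc p l x) * G (swp l x) \<partial>M) = (\<integral>\<^sup>+x. ennreal (swap_acc p l x) * G x \<partial>M)"
proof -
  have ms: "swp l \<in> Lam \<rightarrow>\<^sub>M Lam"
    using measurable_swp[OF l] by (simp only: measurable_cong_sets[OF sets_Lam_M sets_Lam_M])
  have H: "(\<lambda>x. ennreal (swap_dens l x) * G x) \<in> borel_measurable Lam"
    using measurable_swap_dens[OF l] G by (simp add: meas_Lam)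
  have "(\<integral>\<^sup>+x. ennreal (swap_acc p l x) * G (swp l x) \<partial>M) = (\<integral>\<^sup>+x. ennreal (swap_dens l (swp l x)) * G (swp l x) \<partial>Lam)"
    unfolding swap_dens_swp by (rule nn_integral_swap_acc[OF l measurable_compose[OF measurable_swp[OF l] G]])
  also have "\<dots> = (\<integral>\<^sup>+x. ennreal (swap_dens l x) * G x \<partial>distr Lam Lam (swp l))"
    by (rule nn_integral_distr[OF ms, symmetric]) (simp only: measurable_distr_eq1 H)
  also have "\<dots> = (\<integral>\<^sup>+x. ennreal (swap_acc p l x) * G x \<partial>M)"
    unfolding distr_swp[OF l] by (rule nn_integral_swap_acc[OF l G, symmetric])
  finally show ?thesis .
qed

text \<open>The minimum of the two products of densities is at least the product of the minima of
  \<open>p l\<close> and \<open>p (Suc l)\<close> taken at each of the two points. This lower bound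
  factors over the coordinates: the two overlaps give a factor \<delta> each, the remaining
  coordinates their cell masses.\<close>

lemma swap_acc_flow:
  assumes l: "l < N" and s: "s \<in> {..N} \<rightarrow>\<^sub>E {1..J}"
  shows "ennreal (\<delta>\<^sup>2 * box_mass s) \<le> (\<integral>\<^sup>+x. ennreal (swap_acc p l x) * indicator (Pi\<^sub>E {..N} (\<lambda>k. A (s k))) x \<partial>M)"
proof -
  have sJ: "s k \<in> {1..J}" if "k \<le> N" for k using PiE_mem[OF s, of k] that by simp
  let ?box = "Pi\<^sub>E {..N} (\<lambda>k. A (s k))"
  \<comment> \<open>Coordinate by coordinate, \<open>m\<close> bounds the density from below and
    \<open>c\<close> is the share of the cell mass it retains.\<close>
  define m where "m k = (if k = l \<or> k = Suc l then (\<lambda>z. min (p l z) (p (Suc l) z)) else p k)" for k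
  define c where "c k = (if k = l \<or> k = Suc l then \<delta> else 1)" for k :: nat
  have mm: "m k \<in> borel_measurable L" for k unfolding m_def using dens_meas by auto
  have m0: "0 \<le> m k z" if "z \<in> space L" for k z unfolding m_def using dens_nonneg[OF that] by auto
  have mz: "m k z = 0" if "z \<in> space L" "z \<notin> supp" for k z unfolding m_def using outside_supp[OF that] by auto
  have low: "ennreal (c k * measure (D k) (A (s k))) \<le> (\<integral>\<^sup>+z. ennreal (m k z) * indicator (A (s k)) z \<partial>L')" if k: "k \<le> N" for k
  proof -
    note Am = part_meas[OF sJ[OF k]]
    have eq: "(\<integral>\<^sup>+z. ennreal (m k z) * indicator (A (s k)) z \<partial>L') = (\<integral>\<^sup>+z. ennreal (m k z) * indicator (A (s k)) z \<partial>L)"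
      using mm[of k] Am mz by (intro nn_integral_L') auto
    show ?thesis
    proof (cases "k = l \<or> k = Suc l")
      case True
      \<comment> \<open>\<open>delta_ov\<close> ranges over both orders of adjacent levels, so the
        same overlap may be compared with the mass at level \<open>l\<close> and with that at level
        \<open>Suc l\<close>.\<close>
      have ov: "\<delta> * pmass L (p k) (A (s k)) \<le> (\<integral>z. indicator (A (s k)) z * min (p l z) (p (Suc l) z) \<partial>L)"
      proof (cases "k = l")
        case True
        then show ?thesis using delta_le[of l "Suc l" "s k"] sJ[OF k] l by simp
      next
        case False
        then have "k = Suc l" using \<open>k = l \<or> k = Suc l\<close> by simp
        then show ?thesis using delta_le[of "Suc l" l "s k"] sJ[OF k] l by (simp add: min.commute)
      qed
      have "(\<integral>\<^sup>+z. ennreal (m k z) * indicator (A (s k)) z \<partial>L) = (\<integral>\<^sup>+z. ennreal (indicator (A (s k)) z * min (p l z) (p (Suc l) z)) \<partial>L)"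
        using True by (intro nn_integral_cong) (auto simp: m_def indicator_def)
      also have "\<dots> = ennreal (\<integral>z. indicator (A (s k)) z * min (p l z) (p (Suc l) z) \<partial>L)"
        using dens_nonneg by (intro nn_integral_eq_integral integrable_overlap sJ k AE_I2) auto
      finally show ?thesis
        unfolding eq measure_dens[OF Am] using ov True by (simp add: c_def ennreal_leI)
    next
      case False
      have "(\<integral>\<^sup>+z. ennreal (m k z) * indicator (A (s k)) z \<partial>L) = emeasure (D k) (A (s k))"
        unfolding dens_def using False Am dens_meas[of k] by (subst emeasure_density) (auto simp: m_def)
      then show ?thesis unfolding eq using False by (simp add: c_def Co.emeasure_eq_measure)
    qed
  qed
  have "(\<Prod>k\<le>N. c k) = \<delta>\<^sup>2"
    unfolding prod_remove_pair[OF l] by (simp add: c_def power2_eq_square)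
  then have "ennreal (\<delta>\<^sup>2 * box_mass s) = ennreal (\<Prod>k\<le>N. c k * measure (D k) (A (s k)))"
    by (simp add: prod.distrib box_mass_def)
  also have "\<dots> = (\<Prod>k\<le>N. ennreal (c k * measure (D k) (A (s k))))"
    using delta_range by (intro prod_ennreal[symmetric]) (simp add: c_def)
  also have "\<dots> \<le> (\<Prod>k\<le>N. \<integral>\<^sup>+z. ennreal (m k z) * indicator (A (s k)) z \<partial>L')"
    using low by (intro prod_mono_ennreal) simp
  also have "\<dots> = (\<integral>\<^sup>+x. (\<Prod>k\<in>{..N}. ennreal (m k (x k)) * indicator (A (s k)) (x k)) \<partial>Lam)"
    using mm part_meas[OF sJ]
    by (intro R.nn_integral_prod[where f="\<lambda>k z. ennreal (m k z) * indicator (A (s k)) z", symmetric]) (simp add: meas_L')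
  also have "\<dots> \<le> (\<integral>\<^sup>+x. ennreal (swap_dens l x) * indicator ?box x \<partial>Lam)"
  proof (rule nn_integral_mono)
    fix x assume "x \<in> space Lam"
    then have x: "x \<in> space M" by (simp only: space_Lam_M)
    show "(\<Prod>k\<in>{..N}. ennreal (m k (x k)) * indicator (A (s k)) (x k)) \<le> ennreal (swap_dens l x) * indicator ?box x"
    proof (cases "x \<in> ?box")
      case False
      have "x \<in> extensional {..N}" using x by (auto simp: space_PiM PiE_iff)
      then obtain k where k: "k \<le> N" "x k \<notin> A (s k)" using False by (auto simp: PiE_iff)
      have "(\<Prod>k\<in>{..N}. ennreal (m k (x k)) * indicator (A (s k)) (x k)) = 0"
        by (rule prod_zero[OF finite_atMost], rule bexI[of _ k]) (use k in simp_all)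
      then show ?thesis by (simp only: zero_le)
    next
      case True
      have xk: "x k \<in> space L" if "k \<le> N" for k using space_M_coord[OF x that] by (simp add: space_dens)
      have "(\<Prod>k\<in>{..N}. ennreal (m k (x k)) * indicator (A (s k)) (x k)) = (\<Prod>k\<in>{..N}. ennreal (m k (x k)))"
        using PiE_mem[OF True] by (intro prod.cong) auto
      also have "\<dots> = ennreal (\<Prod>k\<le>N. m k (x k))" using m0[OF xk] by (intro prod_ennreal) simp
      also have "(\<Prod>k\<le>N. m k (x k)) \<le> swap_dens l x"
      proof -
        have r: "(\<Prod>k\<in>{..N} - {l, Suc l}. m k (x k)) = (\<Prod>k\<in>{..N} - {l, Suc l}. p k (x k))"
          by (intro prod.cong) (auto simp: m_def)
        have "m l (x l) * m (Suc l) (x (Suc l)) \<le> min (p l (x l) * p (Suc l) (x (Suc l))) (p l (x (Suc l)) * p (Suc l) (x l))"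
          unfolding m_def using dens_coord_nonneg[OF x] l
          by (auto intro!: mult_mono simp: mult.commute[of "p l (x (Suc l))"])
        then show ?thesis
          unfolding prod_remove_pair[OF l] swap_dens_def r using dens_coord_nonneg[OF x]
          by (intro mult_right_mono prod_nonneg) auto
      qed
      finally show ?thesis using True by (simp add: ennreal_leI)
    qed
  qed
  also have "\<dots> = (\<integral>\<^sup>+x. ennreal (swap_acc p l x) * indicator ?box x \<partial>M)"
    using sets_box[OF s] by (intro nn_integral_swap_acc[OF l, symmetric]) simp
  finally show ?thesis .
qed

sublocale SC: swap_chain D T A J N "swap_acc p" \<delta>
  by unfold_locales (use N measurable_swap_acc swap_acc_range swap_acc_invariant swap_acc_flow in auto)

lemma P_sc_eq: "P_sc p T N = (\<lambda>f. SC.swap_mix (SC.update_mix (SC.swap_mix f)))"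
proof -
  have "Q_op p N = SC.swap_mix"
    by (intro ext) (simp add: Q_op_def SC.swap_mix_def SC.swap_op_def)
  moreover have "T_op T N = SC.update_mix"
    by (intro ext) (simp add: T_op_def SC.update_mix_def coord_op_def)
  ultimately show ?thesis by (intro ext) (simp add: P_sc_def)
qed

text \<open>For \<open>gap_geI\<close> the bound must also be at most 1: its numerator is at most 4,
  as both gaps are at most 2, and its denominator is at least \<open>2 ^ 12\<close>.\<close>

proposition gap_bound:
  "(\<gamma> ^ (J + 3) * \<delta> ^ 2 / (2 ^ 12 * real (N + 1) ^ 4 * real J ^ 3))
     * gap_fin {1..J} (\<lambda>j. pmass L (p 0) (A j)) (proj_mat L (p 0) (T 0) A) * min_gap
   \<le> gap (sc_meas L p N) (P_sc p T N)"
proof (rule gap_geI)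
  let ?B = "2 ^ 12 * real (N + 1) ^ 4 * real J ^ 3"
  define d where "d = gap_fin {1..J} (\<lambda>j. measure (D 0) (A j)) (Co.proj 0)"
  have d: "gap_fin {1..J} (\<lambda>j. pmass L (p 0) (A j)) (proj_mat L (p 0) (T 0) A) = d"
    unfolding d_def by (rule gap_fin_eq)
  have d02: "0 \<le> d" "d \<le> 2" unfolding d_def by (rule Co.gap_fin_nonneg Co.gap_fin_le_2)+
  have g: "0 \<le> \<gamma>" "\<gamma> \<le> 1" using gamma_pos gamma_le_1 by simp_all
  have g1: "0 \<le> \<gamma> ^ (J + 3)" "\<gamma> ^ (J + 3) \<le> 1" using g by (simp_all add: power_le_one)
  have dl: "0 \<le> \<delta>\<^sup>2" "\<delta>\<^sup>2 \<le> 1" using delta_range by (auto simp: power_le_one)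
  have J1: "1 \<le> real J ^ 3" using J_pos by (intro one_le_power) simp
  have N1: "1 \<le> real (N + 1) ^ 4" by (intro one_le_power) simp
  have B: "4096 \<le> ?B" using mult_mono[OF N1 J1] by simp
  have num: "\<gamma> ^ (J + 3) * \<delta>\<^sup>2 * d * min_gap \<le> 1 * 1 * 2 * 2"
    using g1 dl d02 min_gap_range by (intro mult_mono) auto
  show "(\<gamma> ^ (J + 3) * \<delta> ^ 2 / ?B)
     * gap_fin {1..J} (\<lambda>j. pmass L (p 0) (A j)) (proj_mat L (p 0) (T 0) A) * min_gap \<le> 1"
  proof -
    have "\<gamma> ^ (J + 3) * \<delta>\<^sup>2 * d * min_gap / ?B \<le> 1"
      using num B by (subst divide_le_eq_1_pos) linarith+
    then show ?thesis unfolding d by simp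
  qed
  fix f assume f: "f \<in> L2fun (sc_meas L p N)" and var: "0 < var_mu (sc_meas L p N) f"
  \<comment> \<open>Positive variance of \<open>f\<close> rules out a null product measure;
    otherwise the rectangle masses of the product identify the law.\<close>
  have sc: "sc_meas L p N = M"
  proof -
    let ?P = "PiM {..N} (\<lambda>_. L)"
    have PM: "sets ?P = sets M" by (intro sets_PiM_cong) (simp_all add: sets_dens)
    have ne: "{..N} \<noteq> {}" by auto
    show ?thesis
    proof (rule PiM_null_or_rectangles[OF finite_atMost ne])
      assume null: "\<And>B. emeasure ?P B = 0"
      have jm: "(\<lambda>x. ennreal (joint x)) \<in> borel_measurable ?P"
        using measurable_joint by (simp add: measurable_cong_sets[OF PM refl])
      have "AE x in ?P. False" by (rule AE_I[of _ _ "space ?P"]) (simp_all add: null)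
      then have "AE x in sc_meas L p N. False"
        unfolding sc_meas_def joint_def[symmetric] by (subst AE_density[OF jm]) (rule AE_mp, auto)
      then have "(\<integral>x. h x \<partial>sc_meas L p N) = 0" for h :: "_ \<Rightarrow> real"
        by (intro integral_eq_zero_AE) (rule AE_mp, auto)
      then have "var_mu (sc_meas L p N) f = 0" by (simp add: var_mu_def inner_mu_def)
      with var show ?thesis by simp
    next
      assume rect: "\<And>X. (\<And>i. i \<in> {..N} \<Longrightarrow> X i \<in> sets L) \<Longrightarrow>
        emeasure ?P (Pi\<^sub>E {..N} X) = (\<Prod>i\<in>{..N}. emeasure L (X i))"
      interpret R0: rectangle_measure ?P L "{..N}"
        by (rule rectangle_measure.intro[OF finite_atMost refl rect])
      show ?thesis
        unfolding sc_meas_def by (rule R0.density_eq_PiM[OF dens_meas dens_nonneg dens_one])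
    qed
  qed
  have "\<gamma> ^ (J + 1) * \<delta>\<^sup>2 * d * min_gap * var_mu M f
     \<le> 2 ^ 12 * real (N + 1) ^ 4 * dirichlet M (P_sc p T N) f"
    unfolding d_def P_sc_eq
  proof (rule SC.poincare_mix)
    show "f \<in> L2fun M" using f by (simp only: sc)
    show "0 \<le> \<delta>" "\<delta> \<le> 1" by (rule delta_range)+
    show "0 < \<gamma>" by (rule gamma_pos)
    show "\<gamma> \<le> (\<Prod>k\<in>{1..N}. min 1 (measure (D (k - 1)) (A j) / measure (D k) (A j)))" if "j \<in> {1..J}" for j
      by (rule gamma_le_prod[OF that])
    show "0 \<le> min_gap" "min_gap \<le> 2" by (rule min_gap_range)+
    fix k j g assume k: "k \<le> N" and j: "j \<in> {1..J}" and g: "g \<in> L2fun (Co.cond k (A j))"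
    have "0 \<le> var_mu (Co.cond k (A j)) g"
      by (rule Co.var_cond_nonneg[OF Co.cell_meas[OF j] Co.cell_pos[OF j] g])
    then have "min_gap * var_mu (Co.cond k (A j)) g \<le> gap (cond_dens L (p k) (A j)) (restr_op (T k) (A j)) * var_mu (Co.cond k (A j)) g"
      by (intro mult_right_mono min_gap_le k j)
    also have "\<dots> \<le> dirichlet (Co.cond k (A j)) (restr_op (T k) (A j)) g" by (rule local_gap(3)[OF k j g])
    finally show "min_gap * var_mu (Co.cond k (A j)) g \<le> dirichlet (Co.cond k (A j)) (restr_op (T k) (A j)) g" .
  qed
  \<comment> \<open>Since \<gamma> \<le> 1, the larger exponent of the statement weakens the bound;
    \<open>J ^ 3 \<ge> 1\<close> does the same below.\<close>
  moreover have "\<gamma> ^ (J + 3) * \<delta>\<^sup>2 * d * min_gap * var_mu M f \<le> \<gamma> ^ (J + 1) * \<delta>\<^sup>2 * d * min_gap * var_mu M f"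
    using g dl d02 min_gap_range var by (intro mult_right_mono power_decreasing) (auto simp: sc)
  ultimately have le: "\<gamma> ^ (J + 3) * \<delta>\<^sup>2 * d * min_gap * var_mu M f \<le> 2 ^ 12 * real (N + 1) ^ 4 * dirichlet M (P_sc p T N) f"
    by linarith
  have "0 \<le> \<gamma> ^ (J + 3) * \<delta>\<^sup>2 * d * min_gap * var_mu M f"
    using g dl d02 min_gap_range var by (simp add: sc)
  then have "0 \<le> 2 ^ 12 * real (N + 1) ^ 4 * dirichlet M (P_sc p T N) f" using le by linarith
  then have "2 ^ 12 * real (N + 1) ^ 4 * dirichlet M (P_sc p T N) f * 1 \<le> 2 ^ 12 * real (N + 1) ^ 4 * dirichlet M (P_sc p T N) f * real J ^ 3"
    using J1 by (intro mult_left_mono)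
  with le have "\<gamma> ^ (J + 3) * \<delta>\<^sup>2 * d * min_gap * var_mu M f
      \<le> 2 ^ 12 * real (N + 1) ^ 4 * dirichlet M (P_sc p T N) f * real J ^ 3"
    unfolding mult_1_right by (rule order_trans)
  also have "\<dots> = dirichlet M (P_sc p T N) f * ?B" by (simp only: mult_ac)
  finally have "\<gamma> ^ (J + 3) * \<delta>\<^sup>2 * d * min_gap * var_mu M f \<le> dirichlet M (P_sc p T N) f * ?B" .
  then have "\<gamma> ^ (J + 3) * \<delta>\<^sup>2 * d * min_gap * var_mu M f / ?B \<le> dirichlet M (P_sc p T N) f"
    using B by (subst pos_divide_le_eq) linarith+
  then show "(\<gamma> ^ (J + 3) * \<delta> ^ 2 / ?B)
     * gap_fin {1..J} (\<lambda>j. pmass L (p 0) (A j)) (proj_mat L (p 0) (T 0) A) * min_gap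
     * var_mu (sc_meas L p N) f \<le> dirichlet (sc_meas L p N) (P_sc p T N) f"
    unfolding d sc by simp
qed

end

theorem theorem3p1:
  fixes L :: "'a measure" and p :: "nat \<Rightarrow> 'a \<Rightarrow> real"
    and T :: "nat \<Rightarrow> 'a \<Rightarrow> 'a measure" and N J :: nat and A :: "nat \<Rightarrow> 'a set"
  assumes countably_generated: "\<exists>G. countable G \<and> sets L = sigma_sets (space L) G"
    and N: "N \<ge> 1"
    and dens_meas: "\<And>k. k \<le> N \<Longrightarrow> p k \<in> borel_measurable L"
    and dens_nonneg: "\<And>k x. k \<le> N \<Longrightarrow> x \<in> space L \<Longrightarrow> p k x \<ge> 0"
    and dens_one: "\<And>k. k \<le> N \<Longrightarrow> (\<integral>\<^sup>+ x. ennreal (p k x) \<partial>L) = 1"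
    and kernel: "\<And>k. k \<le> N \<Longrightarrow> T k \<in> L \<rightarrow>\<^sub>M prob_algebra L"
    and rev: "\<And>k. k \<le> N \<Longrightarrow> reversible (dens L (p k)) (kop (T k))"
    and part_meas: "\<And>j. j \<in> {1..J} \<Longrightarrow> A j \<in> sets L"
    and part_disj: "\<And>i j. i \<in> {1..J} \<Longrightarrow> j \<in> {1..J} \<Longrightarrow> i \<noteq> j \<Longrightarrow> A i \<inter> A j = {}"
    and part_cover: "(\<Union>j\<in>{1..J}. A j) = space L"
    and part_pos: "\<And>k j. k \<le> N \<Longrightarrow> j \<in> {1..J} \<Longrightarrow> pmass L (p k) (A j) > 0"
  shows "gap (sc_meas L p N) (P_sc p T N) \<ge>
     (gamma_ov L p N J A ^ (J + 3) * delta_ov L p N J A ^ 2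
        / (2 ^ 12 * real (N + 1) ^ 4 * real J ^ 3))
     * gap_fin {1..J} (\<lambda>j. pmass L (p 0) (A j)) (proj_mat L (p 0) (T 0) A)
     * Min {gap (cond_dens L (p k) (A j)) (restr_op (T k) (A j)) | k j. k \<le> N \<and> j \<in> {1..J}}"
proof -
  \<comment> \<open>The hypotheses concern levels up to \<open>N\<close> only. Repeating level
    \<open>N\<close> beyond makes them hold at every index and leaves all quantities in the
    statement unchanged.\<close>
  define p' where "p' k = p (min k N)" for k
  define T' where "T' k = T (min k N)" for k
  have p': "p' k = p k" and T': "T' k = T k" if "k \<le> N" for k using that by (simp_all add: p'_def T'_def)
  interpret tempering L p' T' N J A
    by unfold_locales
      (use N part_cover in \<open>simp_all add: p'_def T'_def dens_meas dens_nonneg dens_one kernel rev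
        part_meas part_disj part_pos\<close>)
  have sc: "sc_meas L p' N = sc_meas L p N"
    unfolding sc_meas_def
    by (intro arg_cong2[where f=density] refl ext arg_cong[where f=ennreal] prod.cong) (simp add: p')
  have acc: "swap_acc p' k x = swap_acc p k x" if "k < N" for k x
    using that by (simp add: swap_acc_def p')
  have "Q_op p' N = Q_op p N"
    unfolding Q_op_def by (intro ext arg_cong2[where f="(+)"] refl sum.cong) (simp add: acc)
  moreover have "T_op T' N = T_op T N"
    unfolding T_op_def by (intro ext arg_cong2[where f="(+)"] arg_cong2[where f="(*)"] refl sum.cong) (simp add: T')
  ultimately have P: "P_sc p' T' N = P_sc p T N"
    unfolding P_sc_def by simp
  have gamma: "gamma_ov L p' N J A = gamma_ov L p N J A"
  proof -
    have "(\<Prod>k\<in>{1..N}. min 1 (pmass L (p' (k - 1)) (A j) / pmass L (p' k) (A j)))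
      = (\<Prod>k\<in>{1..N}. min 1 (pmass L (p (k - 1)) (A j) / pmass L (p k) (A j)))" for j
    proof (intro prod.cong refl)
      fix k assume "k \<in> {1..N}"
      then have "k \<le> N" "k - 1 \<le> N" by auto
      then show "min 1 (pmass L (p' (k - 1)) (A j) / pmass L (p' k) (A j))
        = min 1 (pmass L (p (k - 1)) (A j) / pmass L (p k) (A j))" by (simp only: p')
    qed
    then show ?thesis unfolding gamma_ov_def by simp
  qed
  have delta: "delta_ov L p' N J A = delta_ov L p N J A"
    unfolding delta_ov_def setcompr3_eq_image by (intro arg_cong[where f=Min] image_cong refl) (auto simp: p')
  have gaps: "min_gap = Min {gap (cond_dens L (p k) (A j)) (restr_op (T k) (A j)) | k j. k \<le> N \<and> j \<in> {1..J}}"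
    unfolding min_gap_def by (intro arg_cong[where f=Min] Collect_cong ex_cong1) (auto simp: p' T')
  show ?thesis
    using gap_bound unfolding sc P gamma delta gaps p'[OF le0] T'[OF le0] .
qed

end
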